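(* Consider the symmetric V-cycle multigrid algorithm on the locally refined spaces $V_0\subset\dots\subset V_J$, with smoothing error operators $S_k=\widehat E^s_{k}$ given by the symmetric successive subspace correction (SSC) algorithm with the nested-subdomain subspaces $V_k^i$ and approximate subsolvers $R_k^i$ (all defined in the context). If $m_k$ is chosen so that $\psi_k=\dfrac{m_k}{C_4(1+k^2)}$, $k=1,\dots,J$, is non-increasing in $k$, then the multigrid algorithm converges with $$\gamma_k=\frac{C_4(1+k^2)}{C_4(1+k^2)+2m_k},\qquad k=1,\dots,J,$$ that is, $a(E_Jv,v)\le\gamma_J\,a(v,v)$ for all $v\in V_J$. Moreover, the error bound is optimal (in the sense that it does not depend on the number of multigrid spaces $J$) if and only if $m_k=q(1+k^2)$ for some $q\in\mathbb N$, and in that case it is given by $$\gamma_1=\gamma_2=\dots=\gamma_J=\frac{C_4}{2q+C_4}.$$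
   Context: Model problem. $\Omega\subset\mathbb R^n$ is polygonal, $\Theta=(\theta_{ij})$ is a symmetric matrix, $(\cdot,\cdot)$ is the $L^2(\Omega)$ inner product, and $a(u,v)=\sum_{i,j=1}^n\int_\Omega\theta_{ij}\,\partial_{x_j}u\,\partial_{x_i}v\,dx$. There are constants $C_{\Theta,1},C_{\Theta,2}>0$ depending on $\Theta$ with $C_{\Theta,1}\|u\|_{H^1}^2\le a(u,u)\le C_{\Theta,2}\|u\|_{H^1}^2$ for $u\in V_k\subset H_0^1(\Omega)$. Triangulations. $\Omega_J\subset\Omega_{J-1}\subset\dots\subset\Omega_0\equiv\Omega$ are closed subdomains of $\Omega$. $\mathcal T_0$ is a coarse quasi-uniform triangulation of $\Omega$ of size $h_0\in(0,1]$, and $\mathcal T_k$ is obtained from $\mathcal T_{k-1}$ by midpoint refinement of only those elements of $\mathcal T_{k-1}$ that belong to $\Omega_k$. (It is understood that $\Omega_k$ is a union of elements of $\mathcal T_{k-1}$.) Thus $\mathcal T_k$ may have hanging nodes, but restricted to $\Omega_k$ it is a regular grid of size $h_k=2^{-k}h_0$. $V_k=\{v\in H_0^1(\Omega)\cap C^0(\Omega): v|_\tau\in\mathcal P_1\ \forall\tau\in\mathcal T_k\}$ ($\mathcal P_1$ = linear polynomials), $k=0,\dots,J$. Subspaces and subsolvers. $V_k^0=V_0$ and $V_k^i=\{v\in V_i:\mathrm{supp}(v)\subseteq\Omega_i\}$ for $i=1,\dots,k$. $A_k:V_k\to V_k$ is defined by $(A_ku,v)=a(u,v)$, $A^i=A_k^i:V_k^i\to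 V_k^i$ by $(A_k^iu,v)=(A_ku,v)$ for $u,v\in V_k^i$, and $Q_k^i:V_k\to V_k^i$ is the $(\cdot,\cdot)$-orthogonal projection. $R_k^0=A_0^{-1}$ and $R_k^i=\frac{1}{\lambda^i k}I$ for $i=1,\dots,k$, where $\lambda^i$ is the spectral radius of $A^i$. Smoother. $T_k^i=R_k^iQ_k^iA_k$ on $V_k$ and, for $k\ge1$, $$S_k=\widehat E^s_{k}=(I-T_k^{k})\cdots(I-T_k^1)(I-T_k^0)^2(I-T_k^1)\cdots(I-T_k^{k}).$$ Multigrid. $m_k\ge1$ is the integer number of pre-smoothing steps, and also of post-smoothing steps, at level $k$. $P_k:V_J\to V_k$ is the $a$-orthogonal projection. The multigrid error operators of the V-cycle (exact solve at level $0$) are $E_0=0$, $E_k=S_k^{m_k}[I-(I-E_{k-1})P_{k-1}]S_k^{m_k}$. Constants. $C_4=9\,C_3$ with $C_3=\max\{C_1,C_2\}$, where $C_1,C_2$ are constants not depending on the levels for which the following known estimates hold. Let $\overline V_i$ be the space $V_i$ obtained by taking $\Omega_0=\Omega_1=\dots=\Omega_i$ (uniform refinement, size $h_i$), and $\overline Q_i$ the $L^2(\Omega)$ projection onto $\overline V_i$. For given $k$ define $\widehat Q_i:V_k\to V_i$ by $\widehat Q_k=I$ and, for $i=0,\dots,k-1$, let $\widehat Q_iv$ be the unique function of $V_i$ equal to $\overline Q_iv$ at the nodes of $V_i$ in the interior of $\Omega_{i+1}$ and to $v$ at the remaining nodes of $V_i$. With $\lambda_i$ the spectral radius of $A_i$,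 for all $v\in V_k$: $((\widehat Q_i-\widehat Q_{i-1})v,(\widehat Q_i-\widehat Q_{i-1})v)\le C_1\lambda_i^{-1}a(v,v)$ for $i=1,\dots,k$, and $a(\widehat Q_iv,\widehat Q_iv)\le C_2\,a(v,v)$ for $i=0,\dots,k-1$. *)

theory Defs
  imports "HOL-Analysis.Analysis"
begin

subsection \<open>The Sobolev space $H^1_0$\<close>

text \<open>
  A domain is given as a closed set \<open>\<Omega>\<close>; \<open>H1\<close> and \<open>H10\<close> are the Sobolev spaces of its interior.
  For the polygonal sets considered here the boundary is a null set, so it does not matter whether
  one integrates over \<open>\<Omega>\<close> or over its interior.
\<close>

definition L2 :: "(real^'n) set \<Rightarrow> (real^'n \<Rightarrow> real) set" where
  "L2 \<Omega> = {u. u \<in> borel_measurable (lebesgue_on \<Omega>) \<and> integrable (lebesgue_on \<Omega>) (\<lambda>x. (u x)\<^sup>2)}"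

definition L2_inner :: "(real^'n) set \<Rightarrow> (real^'n \<Rightarrow> real) \<Rightarrow> (real^'n \<Rightarrow> real) \<Rightarrow> real" where
  "L2_inner \<Omega> u v = (LINT x|lebesgue_on \<Omega>. u x * v x)"

primrec C_k :: "nat \<Rightarrow> (real^'n \<Rightarrow> real) \<Rightarrow> bool" where
  "C_k 0 f \<longleftrightarrow> continuous_on UNIV f"
| "C_k (Suc k) f \<longleftrightarrow> (\<exists>G. (\<forall>x. GDERIV f x :> G x) \<and> (\<forall>i. C_k k (\<lambda>x. G x $ i)))"

definition test_functions :: "(real^'n) set \<Rightarrow> (real^'n \<Rightarrow> real) set" where
  "test_functions \<Omega> = {\<phi>. (\<forall>k. C_k k \<phi>) \<and>
     compact (closure {x. \<phi> x \<noteq> 0}) \<and> closure {x. \<phi> x \<noteq> 0} \<subseteq> interior \<Omega>}"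

definition weak_partial :: "(real^'n) set \<Rightarrow> 'n \<Rightarrow> (real^'n \<Rightarrow> real) \<Rightarrow> (real^'n \<Rightarrow> real) \<Rightarrow> bool" where
  "weak_partial \<Omega> j u g \<longleftrightarrow> g \<in> L2 \<Omega> \<and> (\<forall>\<phi>\<in>test_functions \<Omega>.
     (LINT x|lebesgue_on \<Omega>. u x * frechet_derivative \<phi> (at x) (axis j 1)) =
     - (LINT x|lebesgue_on \<Omega>. g x * \<phi> x))"

definition H1 :: "(real^'n) set \<Rightarrow> (real^'n \<Rightarrow> real) set" where
  "H1 \<Omega> = {u. u \<in> L2 \<Omega> \<and> (\<forall>j. \<exists>g. weak_partial \<Omega> j u g)}"

text \<open>The weak derivative is unique only almost everywhere; \<open>partial_deriv\<close> picks a representative.\<close>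

definition partial_deriv :: "(real^'n) set \<Rightarrow> 'n \<Rightarrow> (real^'n \<Rightarrow> real) \<Rightarrow> (real^'n \<Rightarrow> real)" where
  "partial_deriv \<Omega> j u = (SOME g. weak_partial \<Omega> j u g)"

definition H1_norm :: "(real^'n) set \<Rightarrow> (real^'n \<Rightarrow> real) \<Rightarrow> real" where
  "H1_norm \<Omega> u = sqrt (L2_inner \<Omega> u u +
     (\<Sum>j\<in>UNIV. L2_inner \<Omega> (partial_deriv \<Omega> j u) (partial_deriv \<Omega> j u)))"

definition H10 :: "(real^'n) set \<Rightarrow> (real^'n \<Rightarrow> real) set" where
  "H10 \<Omega> = {u \<in> H1 \<Omega>. \<exists>\<phi> :: nat \<Rightarrow> real^'n \<Rightarrow> real. (\<forall>m. \<phi> m \<in> test_functions \<Omega>) \<and>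
     (\<lambda>m. H1_norm \<Omega> (\<lambda>x. u x - \<phi> m x)) \<longlonglongrightarrow> 0}"


subsection \<open>Operators on subspaces of functions\<close>

definition id_minus :: "(('a \<Rightarrow> real) \<Rightarrow> ('a \<Rightarrow> real)) \<Rightarrow> ('a \<Rightarrow> real) \<Rightarrow> ('a \<Rightarrow> real)" where
  "id_minus T v = (\<lambda>x. v x - T v x)"

definition orth_proj ::
  "(('a \<Rightarrow> real) \<Rightarrow> ('a \<Rightarrow> real) \<Rightarrow> real) \<Rightarrow> ('a \<Rightarrow> real) set \<Rightarrow> ('a \<Rightarrow> real) \<Rightarrow> ('a \<Rightarrow> real)" where
  "orth_proj b W u = (THE w. w \<in> W \<and> (\<forall>z\<in>W. b (\<lambda>x. u x - w x) z = 0))"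

text \<open>
  A complex \<open>\<mu>\<close> is an eigenvalue of (the complexification of) the operator \<open>A\<close> on the real space
  \<open>W\<close> if \<open>A (u + i w) = \<mu> (u + i w)\<close> for some \<open>u + i w \<noteq> 0\<close>. The zero space has spectral radius 0.
\<close>

definition eigenvalues :: "('a \<Rightarrow> real) set \<Rightarrow> (('a \<Rightarrow> real) \<Rightarrow> ('a \<Rightarrow> real)) \<Rightarrow> complex set" where
  "eigenvalues W A = {\<mu>. \<exists>u\<in>W. \<exists>w\<in>W. (u \<noteq> (\<lambda>x. 0) \<or> w \<noteq> (\<lambda>x. 0)) \<and>
     A u = (\<lambda>x. Re \<mu> * u x - Im \<mu> * w x) \<and> A w = (\<lambda>x. Im \<mu> * u x + Re \<mu> * w x)}"

definition spectral_radius_on :: "('a \<Rightarrow> real) set \<Rightarrow> (('a \<Rightarrow> real) \<Rightarrow> ('a \<Rightarrow> real)) \<Rightarrow> real" where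
  "spectral_radius_on W A = Sup (insert 0 (cmod ` eigenvalues W A))"


subsection \<open>Locally refined meshes\<close>

definition vertices :: "(real^'n) set \<Rightarrow> (real^'n) set" where
  "vertices \<tau> = {p. p extreme_point_of \<tau>}"

text \<open>
  Midpoint refinement of an \<open>n\<close>-simplex: every vertex of a child is a vertex or an edge midpoint of
  the parent, there are \<open>2 ^ n\<close> children, and for each vertex of the parent the copy of the parent
  shrunk by one half towards it is a child. For \<open>n \<le> 2\<close> this determines the children (bisection,
  or four congruent triangles); for \<open>n \<ge> 3\<close> it leaves free how the part between the corner simplices
  is cut.
\<close>

definition midpoint_refinement :: "(real^'n) set \<Rightarrow> (real^'n) set set \<Rightarrow> bool" where
  "midpoint_refinement \<tau> C \<longleftrightarrow>
     triangulation C \<and> (\<forall>\<sigma>\<in>C. int CARD('n) simplex \<sigma>) \<and> \<Union>C = \<tau> \<and> card C = 2 ^ CARD('n) \<and>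
     (\<forall>\<sigma>\<in>C. vertices \<sigma> \<subseteq> {midpoint p q |p q. p \<in> vertices \<tau> \<and> q \<in> vertices \<tau>}) \<and>
     (\<forall>p\<in>vertices \<tau>. midpoint p ` \<tau> \<in> C)"

definition quasi_uniform :: "real \<Rightarrow> real \<Rightarrow> (real^'n) set set \<Rightarrow> bool" where
  "quasi_uniform \<kappa> h T \<longleftrightarrow> (\<forall>\<tau>\<in>T. diameter \<tau> \<le> h \<and> (\<exists>x. cball x (\<kappa> * h) \<subseteq> \<tau>))"

primrec refined_mesh ::
  "((real^'n) set \<Rightarrow> (real^'n) set set) \<Rightarrow> (real^'n) set set \<Rightarrow> (nat \<Rightarrow> (real^'n) set) \<Rightarrow>
   nat \<Rightarrow> (real^'n) set set" where
  "refined_mesh \<rho> T \<Omega> 0 = T"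
| "refined_mesh \<rho> T \<Omega> (Suc k) =
     {\<tau> \<in> refined_mesh \<rho> T \<Omega> k. \<not> \<tau> \<subseteq> \<Omega> (Suc k)} \<union>
     \<Union> (\<rho> ` {\<tau> \<in> refined_mesh \<rho> T \<Omega> k. \<tau> \<subseteq> \<Omega> (Suc k)})"

text \<open>
  Vertices that are not hanging. Vertices on the boundary are kept, which is immaterial since the
  finite element functions vanish there.
\<close>

definition nodes :: "(real^'n) set set \<Rightarrow> (real^'n) set" where
  "nodes T = {p \<in> \<Union> (vertices ` T). \<forall>\<tau>\<in>T. p \<in> \<tau> \<longrightarrow> p \<in> vertices \<tau>}"

text \<open>Functions are extended by zero outside \<open>\<Omega>\<close>, so that they are determined by their values on \<open>\<Omega>\<close>.\<close>

definition fe_space :: "(real^'n) set \<Rightarrow> (real^'n) set set \<Rightarrow> (real^'n \<Rightarrow> real) set" where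
  "fe_space \<Omega> T = {v. v \<in> H10 \<Omega> \<and> continuous_on \<Omega> v \<and> (\<forall>x. x \<notin> \<Omega> \<longrightarrow> v x = 0) \<and>
     (\<forall>\<tau>\<in>T. \<exists>b c. \<forall>x\<in>\<tau>. v x = b + c \<bullet> x)}"


subsection \<open>The model problem and its multilevel hierarchy\<close>

text \<open>
  \<open>children D \<tau>\<close> is the set of elements into which \<open>\<tau>\<close> is cut if it is refined, and \<open>subdomain D 0\<close>
  is the domain \<open>\<Omega>\<close> itself.
\<close>

record ('n::finite) hierarchy =
  subdomain :: "nat \<Rightarrow> (real^'n) set"
  coarse_mesh :: "(real^'n) set set"
  children :: "(real^'n) set \<Rightarrow> (real^'n) set set"
  coeff :: "real^'n^'n"

definition mesh :: "('n::finite) hierarchy \<Rightarrow> nat \<Rightarrow> (real^'n) set set" where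
  "mesh D = refined_mesh (children D) (coarse_mesh D) (subdomain D)"

definition uniform_mesh :: "('n::finite) hierarchy \<Rightarrow> nat \<Rightarrow> (real^'n) set set" where
  "uniform_mesh D = refined_mesh (children D) (coarse_mesh D) (\<lambda>_. subdomain D 0)"

text \<open>
  The uniformly refined meshes, and hence each \<open>mesh D k\<close> restricted to \<open>subdomain D k\<close>, are required
  to be regular (face-to-face). For \<open>n \<le> 2\<close> this follows from the other conditions; for \<open>n \<ge> 3\<close> it is
  a compatibility condition on the choice of \<open>children\<close>.
\<close>

definition nested_hierarchy :: "('n::finite) hierarchy \<Rightarrow> nat \<Rightarrow> real \<Rightarrow> real \<Rightarrow> bool" where
  "nested_hierarchy D J \<kappa> h0 \<longleftrightarrow>
     triangulation (coarse_mesh D) \<and> (\<forall>\<tau>\<in>coarse_mesh D. int CARD('n) simplex \<tau>) \<and>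
     subdomain D 0 = \<Union> (coarse_mesh D) \<and>
     0 < h0 \<and> h0 \<le> 1 \<and> 0 < \<kappa> \<and> quasi_uniform \<kappa> h0 (coarse_mesh D) \<and>
     (\<forall>k\<in>{1..J}. subdomain D k \<subseteq> subdomain D (k - 1) \<and>
        (\<exists>U \<subseteq> mesh D (k - 1). subdomain D k = \<Union> U)) \<and>
     (\<forall>k<J. \<forall>\<tau>\<in>uniform_mesh D k. midpoint_refinement \<tau> (children D \<tau>)) \<and>
     (\<forall>k\<le>J. triangulation (uniform_mesh D k))"

definition ip :: "('n::finite) hierarchy \<Rightarrow> (real^'n \<Rightarrow> real) \<Rightarrow> (real^'n \<Rightarrow> real) \<Rightarrow> real" where
  "ip D = L2_inner (subdomain D 0)"

definition aform :: "('n::finite) hierarchy \<Rightarrow> (real^'n \<Rightarrow> real) \<Rightarrow> (real^'n \<Rightarrow> real) \<Rightarrow> real" where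
  "aform D u v = (\<Sum>i\<in>UNIV. \<Sum>j\<in>UNIV. LINT x|lebesgue_on (subdomain D 0).
     coeff D $ i $ j * partial_deriv (subdomain D 0) j u x * partial_deriv (subdomain D 0) i v x)"

definition V :: "('n::finite) hierarchy \<Rightarrow> nat \<Rightarrow> (real^'n \<Rightarrow> real) set" where
  "V D k = fe_space (subdomain D 0) (mesh D k)"

definition V_uniform :: "('n::finite) hierarchy \<Rightarrow> nat \<Rightarrow> (real^'n \<Rightarrow> real) set" where
  "V_uniform D k = fe_space (subdomain D 0) (uniform_mesh D k)"

definition A :: "('n::finite) hierarchy \<Rightarrow> nat \<Rightarrow> (real^'n \<Rightarrow> real) \<Rightarrow> (real^'n \<Rightarrow> real)" where
  "A D k u = (THE w. w \<in> V D k \<and> (\<forall>v\<in>V D k. ip D w v = aform D u v))"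

definition lambda_max :: "('n::finite) hierarchy \<Rightarrow> nat \<Rightarrow> real" where
  "lambda_max D k = spectral_radius_on (V D k) (A D k)"


subsection \<open>The smoother and the V-cycle\<close>

definition V_sub :: "('n::finite) hierarchy \<Rightarrow> nat \<Rightarrow> nat \<Rightarrow> (real^'n \<Rightarrow> real) set" where
  "V_sub D k i = (if i = 0 then V D 0
     else {v \<in> V D i. closure {x. v x \<noteq> 0} \<subseteq> subdomain D i})"

definition A_sub :: "('n::finite) hierarchy \<Rightarrow> nat \<Rightarrow> nat \<Rightarrow> (real^'n \<Rightarrow> real) \<Rightarrow> (real^'n \<Rightarrow> real)" where
  "A_sub D k i u = (THE w. w \<in> V_sub D k i \<and> (\<forall>v\<in>V_sub D k i. ip D w v = ip D (A D k u) v))"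

definition Q_sub :: "('n::finite) hierarchy \<Rightarrow> nat \<Rightarrow> nat \<Rightarrow> (real^'n \<Rightarrow> real) \<Rightarrow> (real^'n \<Rightarrow> real)" where
  "Q_sub D k i = orth_proj (ip D) (V_sub D k i)"

definition lambda_sub :: "('n::finite) hierarchy \<Rightarrow> nat \<Rightarrow> nat \<Rightarrow> real" where
  "lambda_sub D k i = spectral_radius_on (V_sub D k i) (A_sub D k i)"

definition R_sub :: "('n::finite) hierarchy \<Rightarrow> nat \<Rightarrow> nat \<Rightarrow> (real^'n \<Rightarrow> real) \<Rightarrow> (real^'n \<Rightarrow> real)" where
  "R_sub D k i u = (if i = 0 then inv_into (V D 0) (A D 0) u
     else (\<lambda>x. 1 / (lambda_sub D k i * real k) * u x))"

definition T_sub :: "('n::finite) hierarchy \<Rightarrow> nat \<Rightarrow> nat \<Rightarrow> (real^'n \<Rightarrow> real) \<Rightarrow> (real^'n \<Rightarrow> real)" where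
  "T_sub D k i = R_sub D k i \<circ> Q_sub D k i \<circ> A D k"

text \<open>The value is \<open>(I - T\<^sub>k) \<cdots> (I - T\<^sub>1) (I - T\<^sub>0)\<^sup>2 (I - T\<^sub>1) \<cdots> (I - T\<^sub>k)\<close>\<close>

primrec symmetric_product ::
  "(nat \<Rightarrow> ('a \<Rightarrow> real) \<Rightarrow> ('a \<Rightarrow> real)) \<Rightarrow> nat \<Rightarrow> ('a \<Rightarrow> real) \<Rightarrow> ('a \<Rightarrow> real)" where
  "symmetric_product T 0 = id_minus (T 0) ^^ 2"
| "symmetric_product T (Suc k) = id_minus (T (Suc k)) \<circ> symmetric_product T k \<circ> id_minus (T (Suc k))"

definition smoother :: "('n::finite) hierarchy \<Rightarrow> nat \<Rightarrow> (real^'n \<Rightarrow> real) \<Rightarrow> (real^'n \<Rightarrow> real)" where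
  "smoother D k = symmetric_product (T_sub D k) k"

definition P :: "('n::finite) hierarchy \<Rightarrow> nat \<Rightarrow> (real^'n \<Rightarrow> real) \<Rightarrow> (real^'n \<Rightarrow> real)" where
  "P D k = orth_proj (aform D) (V D k)"

primrec mg_error ::
  "('n::finite) hierarchy \<Rightarrow> (nat \<Rightarrow> nat) \<Rightarrow> nat \<Rightarrow> (real^'n \<Rightarrow> real) \<Rightarrow> (real^'n \<Rightarrow> real)" where
  "mg_error D m 0 = (\<lambda>v x. 0)"
| "mg_error D m (Suc k) =
     (smoother D (Suc k) ^^ m (Suc k)) \<circ>
     id_minus (id_minus (mg_error D m k) \<circ> P D k) \<circ>
     (smoother D (Suc k) ^^ m (Suc k))"


subsection \<open>The decomposition operators and the convergence bound\<close>

text \<open>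
  \<open>is_Q_hat D k Qh\<close>: on \<open>V D k\<close>, \<open>Qh i\<close> is the operator that takes the nodal values of the
  \<open>L\<^sup>2\<close> projection onto the uniformly refined space in the interior of \<open>subdomain D (i + 1)\<close> and
  leaves the other nodal values unchanged; \<open>Qh k\<close> is the identity. A function of \<open>V D i\<close> is
  determined by its nodal values, so \<open>Qh i\<close> is unique on \<open>V D k\<close>.
\<close>

definition is_Q_hat ::
  "('n::finite) hierarchy \<Rightarrow> nat \<Rightarrow> (nat \<Rightarrow> (real^'n \<Rightarrow> real) \<Rightarrow> (real^'n \<Rightarrow> real)) \<Rightarrow> bool" where
  "is_Q_hat D k Qh \<longleftrightarrow> (\<forall>v\<in>V D k. Qh k v = v \<and>
     (\<forall>i<k. Qh i v \<in> V D i \<and>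
        (\<forall>p\<in>nodes (mesh D i). Qh i v p =
           (if p \<in> interior (subdomain D (i + 1))
            then orth_proj (ip D) (V_uniform D i) v p else v p))))"

definition psi :: "real \<Rightarrow> (nat \<Rightarrow> nat) \<Rightarrow> nat \<Rightarrow> real" where
  "psi C4 m k = real (m k) / (C4 * (1 + real k ^ 2))"

definition gamma :: "real \<Rightarrow> (nat \<Rightarrow> nat) \<Rightarrow> nat \<Rightarrow> real" where
  "gamma C4 m k = C4 * (1 + real k ^ 2) / (C4 * (1 + real k ^ 2) + 2 * real (m k))"

end

theory Submission
  imports Defs
begin

text \<open>
  The smoother is already a convergent method on \<open>V\<^sub>k\<close>, because its subspaces include all coarser
  levels. Write \<open>S = G* G\<close> with \<open>G = (I - T\<^sub>0) (I - T\<^sub>1) \<cdots> (I - T\<^sub>k)\<close>, adjoints being taken in the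
  energy inner product. The decomposition \<open>v = Q\<^sub>0 v + \<Sum>\<^sub>i (Q\<^sub>i - Q\<^sub>i\<^sub>-\<^sub>1) v\<close> gives
  \<open>a(v, v) \<le> C\<^sub>3 (1 + k\<^sup>2) \<Sum>\<^sub>i a(T\<^sub>i v, v)\<close>; comparing \<open>v\<close> with the iterates to which the corrections are
  applied costs a factor 9, so \<open>\<parallel>G\<parallel>\<^sup>2 \<le> 1 - 1 / K\<close> with \<open>K = C\<^sub>4 (1 + k\<^sup>2)\<close>. Hence
  \<open>\<parallel>S\<^sup>m\<parallel>\<^sup>2 \<le> (1 - 1 / K)\<^sup>2\<^sup>m \<le> K / (K + 2 m)\<close>, and the coarse grid correction does not increase the energy.
\<close>

subsection \<open>Forms on finite-dimensional spaces of functions\<close>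

text \<open>The growth \<open>1 + k^2\<close> is the price of damping the subsolvers by
  \<open>1 / k\<close>: with the damping, plain Cauchy-Schwarz over the \<open>k\<close> levels
  bounds their interaction by a constant, and in exchange each of the \<open>k\<close> levels enters
  the stability estimate with weight \<open>k\<close>.

  The Sobolev part serves to make \<open>aform D\<close> and \<open>ip D\<close> inner products on
  each \<open>V D k\<close>. The obstacle is that \<open>partial_deriv\<close> is a chosen
  representative: its linearity holds only almost everywhere and rests on the uniqueness of weak
  derivatives.

  The delicate part of the mesh geometry is to place the pieces of the decomposition in the local
  subspaces, that is, to bound their supports. The decomposition operators prescribe values at nodes
  only, and hanging vertices are not nodes, so agreement on an unrefined element must be traced back
  to coarser elements.

  Spaces are sets of functions on one ambient type, because all levels have to be compared with each
  other; finite dimension is expressed by finitely many points at which vanishing forces the zero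
  function.\<close>

locale fun_space =
  fixes W :: "('a \<Rightarrow> real) set"
  assumes zero_mem: "(\<lambda>x. 0) \<in> W"
    and lincomb_mem: "u \<in> W \<Longrightarrow> v \<in> W \<Longrightarrow> (\<lambda>x. u x + c * v x) \<in> W"
begin

lemma scale_mem: "v \<in> W \<Longrightarrow> (\<lambda>x. c * v x) \<in> W"
  using lincomb_mem[OF zero_mem, of v c] by simp

lemma diff_mem: "u \<in> W \<Longrightarrow> v \<in> W \<Longrightarrow> (\<lambda>x. u x - v x) \<in> W"
  using lincomb_mem[of u v "-1"] by simp

lemma sum_mem:
  assumes "\<And>i. i \<in> I \<Longrightarrow> f i \<in> W"
  shows "(\<lambda>x. \<Sum>i\<in>I. c i * f i x) \<in> W"
proof (cases "finite I")
  case True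
  then show ?thesis
    using assms
  proof (induction I)
    case (insert i I)
    then have "(\<lambda>x. (\<Sum>i\<in>I. c i * f i x) + c i * f i x) \<in> W"
      by (intro lincomb_mem) auto
    then show ?case
      using insert by (simp add: add.commute)
  qed (simp add: zero_mem)
qed (simp add: zero_mem)

end

text \<open>The laws are relativised to \<open>W\<close> since \<open>aform\<close> is bilinear only
  where weak derivatives exist. Definiteness is split off because two forms that occur later,
  \<open>a (T i u) v\<close> and \<open>M * b u v - a u v\<close>, are only semidefinite.\<close>

locale psd_form = fun_space W for W :: "('a \<Rightarrow> real) set" +
  fixes b :: "('a \<Rightarrow> real) \<Rightarrow> ('a \<Rightarrow> real) \<Rightarrow> real"
  assumes sym: "u \<in> W \<Longrightarrow> v \<in> W \<Longrightarrow> b u v = b v u"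
    and lin: "u \<in> W \<Longrightarrow> v \<in> W \<Longrightarrow> w \<in> W \<Longrightarrow> b (\<lambda>x. u x + c * v x) w = b u w + c * b v w"
    and nonneg: "u \<in> W \<Longrightarrow> 0 \<le> b u u"
begin

lemma lin_right:
  "u \<in> W \<Longrightarrow> v \<in> W \<Longrightarrow> w \<in> W \<Longrightarrow> b w (\<lambda>x. u x + c * v x) = b w u + c * b w v"
  using lin[of u v w c] sym lincomb_mem[of u v c] by simp

lemma zero_left: "w \<in> W \<Longrightarrow> b (\<lambda>x. 0) w = 0"
  using lin[OF zero_mem zero_mem, of w 1] by simp

lemma scale_left: "v \<in> W \<Longrightarrow> w \<in> W \<Longrightarrow> b (\<lambda>x. c * v x) w = c * b v w"
  using lin[OF zero_mem, of v w c] zero_left by simp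

lemma add_left:
  "u \<in> W \<Longrightarrow> v \<in> W \<Longrightarrow> w \<in> W \<Longrightarrow> b (\<lambda>x. u x + v x) w = b u w + b v w"
  using lin[of u v w 1] by simp

lemma diff_left:
  "u \<in> W \<Longrightarrow> v \<in> W \<Longrightarrow> w \<in> W \<Longrightarrow> b (\<lambda>x. u x - v x) w = b u w - b v w"
  using lin[of u v w "-1"] by simp

lemma zero_right: "w \<in> W \<Longrightarrow> b w (\<lambda>x. 0) = 0"
  using zero_left sym zero_mem by simp

lemma scale_right: "v \<in> W \<Longrightarrow> w \<in> W \<Longrightarrow> b w (\<lambda>x. c * v x) = c * b w v"
  using lin_right[OF zero_mem, of v w c] zero_right by simp

lemma add_right:
  "u \<in> W \<Longrightarrow> v \<in> W \<Longrightarrow> w \<in> W \<Longrightarrow> b w (\<lambda>x. u x + v x) = b w u + b w v"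
  using lin_right[of u v w 1] by simp

lemma diff_right:
  "u \<in> W \<Longrightarrow> v \<in> W \<Longrightarrow> w \<in> W \<Longrightarrow> b w (\<lambda>x. u x - v x) = b w u - b w v"
  using lin_right[of u v w "-1"] by simp

lemma sum_left:
  assumes "\<And>i. i \<in> I \<Longrightarrow> f i \<in> W" "w \<in> W"
  shows "b (\<lambda>x. \<Sum>i\<in>I. c i * f i x) w = (\<Sum>i\<in>I. c i * b (f i) w)"
proof (cases "finite I")
  case True
  then show ?thesis
    using assms(1)
  proof (induction I)
    case (insert i I)
    then have "b (\<lambda>x. (\<Sum>i\<in>I. c i * f i x) + c i * f i x) w =
        b (\<lambda>x. \<Sum>i\<in>I. c i * f i x) w + c i * b (f i) w"
      by (intro lin sum_mem) (auto simp: assms(2))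
    then show ?case
      using insert by (simp add: add.commute)
  qed (simp add: zero_left assms(2))
qed (simp add: zero_left assms(2))

lemma sum_right:
  assumes "\<And>i. i \<in> I \<Longrightarrow> f i \<in> W" "w \<in> W"
  shows "b w (\<lambda>x. \<Sum>i\<in>I. c i * f i x) = (\<Sum>i\<in>I. c i * b w (f i))"
proof -
  have "b w (\<lambda>x. \<Sum>i\<in>I. c i * f i x) = b (\<lambda>x. \<Sum>i\<in>I. c i * f i x) w"
    using assms by (intro sym sum_mem) auto
  also have "\<dots> = (\<Sum>i\<in>I. c i * b (f i) w)"
    using assms by (rule sum_left)
  also have "\<dots> = (\<Sum>i\<in>I. c i * b w (f i))"
    using assms by (intro sum.cong) (auto simp: sym)
  finally show ?thesis .
qed

lemma Cauchy_Schwarz_square: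
  assumes "u \<in> W" "v \<in> W"
  shows "(b u v)\<^sup>2 \<le> b u u * b v v"
proof -
  have *: "0 \<le> b u u + 2 * c * b u v + c\<^sup>2 * b v v" for c
  proof -
    have "0 \<le> b (\<lambda>x. u x + c * v x) (\<lambda>x. u x + c * v x)"
      using assms by (intro nonneg lincomb_mem)
    also have "\<dots> = b u u + 2 * c * b u v + c\<^sup>2 * b v v"
      using assms sym[of v u]
      by (simp add: lin[OF assms lincomb_mem[OF assms]] lin_right power2_eq_square algebra_simps)
    finally show ?thesis .
  qed
  show ?thesis
  proof (cases "b v v = 0")
    case True
    have "b u v = 0"
    proof (rule ccontr)
      assume "b u v \<noteq> 0"
      then show False
        \<comment> \<open>With \<open>b v v = 0\<close> the expression is affine in
          \<open>c\<close>; this \<open>c\<close> gives it the value -1.\<close>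
        using *[of "- (b u u + 1) / (2 * b u v)"] True by (simp add: field_simps)
    qed
    then show ?thesis using assms nonneg by simp
  next
    case False
    then have "b v v > 0" using nonneg[OF assms(2)] by simp
    then show ?thesis
      using *[of "- b u v / b v v"] by (simp add: field_simps power2_eq_square)
  qed
qed

lemma Cauchy_Schwarz:
  assumes "u \<in> W" "v \<in> W"
  shows "\<bar>b u v\<bar> \<le> sqrt (b u u) * sqrt (b v v)"
  using real_sqrt_le_mono[OF Cauchy_Schwarz_square[OF assms]] by (simp add: real_sqrt_mult)

lemma subspace_psd_form: "fun_space U \<Longrightarrow> U \<subseteq> W \<Longrightarrow> psd_form U b"
  unfolding psd_form_def psd_form_axioms_def using sym lin nonneg by blast

end

locale pd_form = psd_form +
  assumes definite: "u \<in> W \<Longrightarrow> b u u = 0 \<Longrightarrow> u = (\<lambda>x. 0)"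
begin

lemma subspace_pd_form: "fun_space U \<Longrightarrow> U \<subseteq> W \<Longrightarrow> pd_form U b"
  unfolding pd_form_def pd_form_axioms_def using subspace_psd_form definite by blast

end

text \<open>Orthonormality of \<open>B\<close> is never needed beyond the expansion property.\<close>

lemma expansion_exists:
  assumes "finite F" "pd_form W b" "\<And>u. u \<in> W \<Longrightarrow> (\<forall>p\<in>F. u p = 0) \<Longrightarrow> u = (\<lambda>x. 0)"
  shows "\<exists>B. finite B \<and> B \<subseteq> W \<and> (\<forall>v\<in>W. v = (\<lambda>x. \<Sum>e\<in>B. b v e * e x))"
  using assms
proof (induction F arbitrary: W)
  case empty
  then show ?case by (intro exI[of _ "{}"]) auto
next
  case (insert p F)
  interpret pd_form W b by fact
  \<comment> \<open>Spending one determining point on a subspace: a function of \<open>U\<close>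
    that vanishes on \<open>F\<close> also vanishes at \<open>p\<close>, so \<open>F\<close>
    determines \<open>U\<close> and the induction hypothesis applies.\<close>
  define U where "U = {u \<in> W. u p = 0}"
  have U: "fun_space U"
    by unfold_locales (auto simp: U_def zero_mem lincomb_mem)
  have "U \<subseteq> W" by (auto simp: U_def)
  have "\<exists>B. finite B \<and> B \<subseteq> U \<and> (\<forall>v\<in>U. v = (\<lambda>x. \<Sum>e\<in>B. b v e * e x))"
    by (rule insert.IH) (use subspace_pd_form[OF U \<open>U \<subseteq> W\<close>] insert.prems in \<open>auto simp: U_def\<close>)
  then obtain B where B: "finite B" "B \<subseteq> U" "\<And>v. v \<in> U \<Longrightarrow> v = (\<lambda>x. \<Sum>e\<in>B. b v e * e x)"
    by blast
  have BW: "e \<in> W" if "e \<in> B" for e using that B(2) \<open>U \<subseteq> W\<close> by auto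
  show ?case
  proof (cases "U = W")
    case True
    then show ?thesis using B by blast
  next
    case False
    then obtain w where w: "w \<in> W" "w p \<noteq> 0" unfolding U_def by auto
    define y where "y = (\<lambda>x. \<Sum>e\<in>B. b w e * e x)"
    have y: "y \<in> U" unfolding y_def
      using B(1,2) by (intro fun_space.sum_mem[OF U]) auto
    \<comment> \<open>Gram-Schmidt: \<open>y\<close> is the projection of \<open>w\<close> onto
      \<open>U\<close>. Since \<open>y p = 0\<close>, subtracting it leaves the value at
      \<open>p\<close> nonzero.\<close>
    define e' where "e' = (\<lambda>x. w x - y x)"
    have e': "e' \<in> W" "e' p \<noteq> 0"
      using w y by (auto simp: e'_def U_def intro: diff_mem)
    have orth: "b e' z = 0" if "z \<in> U" for z
    proof -
      have zW: "z \<in> W" using that \<open>U \<subseteq> W\<close> by auto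
      have "b y z = (\<Sum>e\<in>B. b w e * b e z)"
        unfolding y_def using BW zW by (intro sum_left) auto
      also have "\<dots> = (\<Sum>e\<in>B. b z e * b w e)"
        using BW zW by (intro sum.cong) (auto simp: sym)
      also have "\<dots> = b w (\<lambda>x. \<Sum>e\<in>B. b z e * e x)"
        using BW w by (intro sum_right[symmetric]) auto
      also have "\<dots> = b w z"
        by (simp only: B(3)[OF that, symmetric])
      finally show ?thesis
        unfolding e'_def using w y \<open>U \<subseteq> W\<close> zW by (subst diff_left) auto
    qed
    have pos: "b e' e' > 0"
      using definite[OF e'(1)] nonneg[OF e'(1)] e'(2) by (metis less_eq_real_def)
    define e where "e = (\<lambda>x. (1 / sqrt (b e' e')) * e' x)"
    have e: "e \<in> W" "e p \<noteq> 0"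
      unfolding e_def using e' pos scale_mem[OF e'(1)] by (blast, simp)
    have ee: "b e e = 1"
      unfolding e_def using e' pos by (simp only: scale_left scale_right scale_mem) (simp add: field_simps)
    have eo: "b e z = 0" if "z \<in> U" for z
      unfolding e_def using orth[OF that] e' that \<open>U \<subseteq> W\<close> by (subst scale_left) auto
    have "e \<notin> B" using e B(2) by (auto simp: U_def)
    have "v = (\<lambda>x. \<Sum>f\<in>insert e B. b v f * f x)" if v: "v \<in> W" for v
    proof -
      define c where "c = v p / e p"
      define z where "z = (\<lambda>x. v x + (-c) * e x)"
      have z: "z \<in> U" unfolding U_def z_def
        using e lincomb_mem[OF v e(1), of "-c"] by (simp add: c_def)
      have zW: "z \<in> W" using z \<open>U \<subseteq> W\<close> by auto
      have vz: "v = (\<lambda>x. z x + c * e x)" by (auto simp: z_def)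
      have "b v e = c"
        using lin[OF zW e(1) e(1), of c, folded vz] ee eo[OF z] sym[OF zW e(1)] by simp
      moreover have "b v f = b z f" if "f \<in> B" for f
        using lin[OF zW e(1) BW[OF that], of c, folded vz] eo[of f] B(2) that by auto
      ultimately have "(\<lambda>x. \<Sum>f\<in>insert e B. b v f * f x) = (\<lambda>x. c * e x + (\<Sum>f\<in>B. b z f * f x))"
        using \<open>e \<notin> B\<close> B(1) by simp
      also have "\<dots> = v"
      proof
        fix x
        show "c * e x + (\<Sum>f\<in>B. b z f * f x) = v x"
          using fun_cong[OF vz, of x] fun_cong[OF B(3)[OF z], of x] by linarith
      qed
      finally show ?thesis by simp
    qed
    moreover have "finite (insert e B)" "insert e B \<subseteq> W"
      using B(1) e BW by auto
    ultimately show ?thesis by blast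
  qed
qed

text \<open>Finite dimension in the form of a finite determining set of points: subspaces inherit it
  at once, and for finite element functions the mesh vertices provide it.\<close>

locale finite_form = pd_form +
  assumes determined: "\<exists>F. finite F \<and> (\<forall>u\<in>W. (\<forall>p\<in>F. u p = 0) \<longrightarrow> u = (\<lambda>x. 0))"
begin

lemma subspace_finite_form: "fun_space U \<Longrightarrow> U \<subseteq> W \<Longrightarrow> finite_form U b"
  unfolding finite_form_def finite_form_axioms_def
  using subspace_pd_form determined by blast

lemma expansion: "\<exists>B. finite B \<and> B \<subseteq> W \<and> (\<forall>v\<in>W. v = (\<lambda>x. \<Sum>e\<in>B. b v e * e x))"
proof -
  obtain F where "finite F" "\<forall>u\<in>W. (\<forall>p\<in>F. u p = 0) \<longrightarrow> u = (\<lambda>x. 0)"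
    using determined by blast
  then show ?thesis
    by (intro expansion_exists[OF _ pd_form_axioms]) blast+
qed

lemma eqI:
  assumes "u \<in> W" "v \<in> W" "\<And>w. w \<in> W \<Longrightarrow> b u w = b v w"
  shows "u = v"
proof -
  have "(\<lambda>x. u x - v x) = (\<lambda>x. 0)"
    using assms by (intro definite diff_mem) (simp_all add: diff_left diff_mem)
  then show ?thesis by (simp add: fun_eq_iff)
qed

text \<open>Expanding \<open>v\<close> turns \<open>l v\<close> into the sum of
  \<open>b v e * l e\<close>, so the function with coefficients \<open>l e\<close> represents
  \<open>l\<close>.\<close>

lemma Riesz:
  assumes l: "\<And>u v c. u \<in> W \<Longrightarrow> v \<in> W \<Longrightarrow> l (\<lambda>x. u x + c * v x) = l u + c * l v"
  shows "\<exists>!w. w \<in> W \<and> (\<forall>v\<in>W. b w v = l v)"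
proof -
  obtain B where B: "finite B" "B \<subseteq> W" "\<And>v. v \<in> W \<Longrightarrow> v = (\<lambda>x. \<Sum>e\<in>B. b v e * e x)"
    using expansion by blast
  define w where "w = (\<lambda>x. \<Sum>e\<in>B. l e * e x)"
  have w: "w \<in> W" unfolding w_def using B(1,2) by (intro sum_mem) auto
  have l0: "l (\<lambda>x. 0) = 0" using l[OF zero_mem zero_mem, of 1] by simp
  have lsum: "l (\<lambda>x. \<Sum>e\<in>C. c e * e x) = (\<Sum>e\<in>C. c e * l e)" if "C \<subseteq> W" "finite C" for c C
    using that(2,1)
  proof induction
    case (insert e C)
    then have "l (\<lambda>x. (\<Sum>e\<in>C. c e * e x) + c e * e x) = l (\<lambda>x. \<Sum>e\<in>C. c e * e x) + c e * l e"
      by (intro l sum_mem) auto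
    then show ?case using insert by (simp add: add.commute)
  qed (simp add: l0)
  have bw: "b w v = l v" if "v \<in> W" for v
  proof -
    have "b w v = (\<Sum>e\<in>B. l e * b e v)"
      unfolding w_def using B(1,2) that by (intro sum_left) auto
    also have "\<dots> = (\<Sum>e\<in>B. b v e * l e)"
      using B(1,2) that by (intro sum.cong) (auto simp: sym subset_iff)
    also have "\<dots> = l v"
      using lsum[OF B(2,1), of "b v", folded B(3)[OF that]] by simp
    finally show ?thesis .
  qed
  show ?thesis
  proof (rule ex1I[of _ w])
    show "w \<in> W \<and> (\<forall>v\<in>W. b w v = l v)" using w bw by blast
    show "y = w" if y: "y \<in> W \<and> (\<forall>v\<in>W. b y v = l v)" for y
    proof (rule eqI)
      show "b y z = b w z" if "z \<in> W" for z
        unfolding bw[OF that] using y that by blast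
    qed (use y w in blast)+
  qed
qed

text \<open>The functional \<open>b u\<close> restricted to \<open>U\<close> has a unique Riesz
  representative there, which gives meaning to the definite description in
  \<open>orth_proj\<close>.\<close>

lemma orth_proj:
  assumes U: "fun_space U" "U \<subseteq> W" and u: "u \<in> W"
  shows "orth_proj b U u \<in> U" "z \<in> U \<Longrightarrow> b (orth_proj b U u) z = b u z"
proof -
  interpret U: finite_form U b by (rule subspace_finite_form[OF U])
  have "\<exists>!w. w \<in> U \<and> (\<forall>v\<in>U. b w v = b u v)"
    using U u by (intro U.Riesz) (auto simp: subset_iff lin_right)
  moreover have "(w \<in> U \<and> (\<forall>v\<in>U. b w v = b u v)) \<longleftrightarrow>
      (w \<in> U \<and> (\<forall>z\<in>U. b (\<lambda>x. u x - w x) z = 0))" for w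
    using U u by (auto simp: subset_iff diff_left)
  ultimately have "\<exists>!w. w \<in> U \<and> (\<forall>z\<in>U. b (\<lambda>x. u x - w x) z = 0)"
    by simp
  from theI'[OF this] have "orth_proj b U u \<in> U \<and> (\<forall>z\<in>U. b (\<lambda>x. u x - orth_proj b U u x) z = 0)"
    unfolding orth_proj_def .
  then show "orth_proj b U u \<in> U" "z \<in> U \<Longrightarrow> b (orth_proj b U u) z = b u z"
    using U u by (auto simp: subset_iff diff_left)
qed

text \<open>Discharges the definite descriptions by which \<open>A\<close> and \<open>A_sub\<close>
  are defined.\<close>

lemma representing_operator:
  assumes "\<And>u v c. u \<in> W \<Longrightarrow> v \<in> W \<Longrightarrow> l (\<lambda>x. u x + c * v x) = l u + c * l v"
  defines "w \<equiv> THE w. w \<in> W \<and> (\<forall>v\<in>W. b w v = l v)"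
  shows "w \<in> W" "v \<in> W \<Longrightarrow> b w v = l v"
  using theI'[OF Riesz[of l, OF assms(1)]] unfolding w_def by blast+

end

text \<open>This replaces compactness of the unit sphere.\<close>

lemma form_bound:
  assumes b: "psd_form W b" and c: "finite_form W c"
  shows "\<exists>M>0. \<forall>v\<in>W. b v v \<le> M * c v v"
proof -
  interpret b: psd_form W b by fact
  interpret c: finite_form W c by fact
  obtain B where B: "finite B" "B \<subseteq> W" "\<And>v. v \<in> W \<Longrightarrow> v = (\<lambda>x. \<Sum>e\<in>B. c v e * e x)"
    using c.expansion by blast
  define N where "N = (\<Sum>e\<in>B. sqrt (c e e) * sqrt (b e e))"
  \<comment> \<open>The \<open>+ 1\<close> only keeps the constant positive when
    \<open>N = 0\<close>.\<close>
  have "b v v \<le> (N\<^sup>2 + 1) * c v v" if v: "v \<in> W" for v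
  proof -
    \<comment> \<open>Only one argument is expanded. Cauchy-Schwarz for both forms then leaves a
      factor \<open>sqrt (b v v)\<close> on the right, which cancels.\<close>
    have "b v v = b (\<lambda>x. \<Sum>e\<in>B. c v e * e x) v"
      by (simp only: B(3)[OF v, symmetric])
    also have "\<dots> = (\<Sum>e\<in>B. c v e * b e v)"
      using B(1,2) v by (intro b.sum_left) auto
    also have "\<dots> \<le> (\<Sum>e\<in>B. (sqrt (c v v) * sqrt (c e e)) * (sqrt (b e e) * sqrt (b v v)))"
    proof (rule sum_mono)
      fix e assume "e \<in> B"
      then have e: "e \<in> W" using B(1,2) by auto
      have "c v e * b e v \<le> \<bar>c v e\<bar> * \<bar>b e v\<bar>"
        by (metis abs_ge_self abs_mult)
      also have "\<dots> \<le> (sqrt (c v v) * sqrt (c e e)) * (sqrt (b e e) * sqrt (b v v))"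
        using e v by (intro mult_mono c.Cauchy_Schwarz b.Cauchy_Schwarz mult_nonneg_nonneg)
          (auto simp: c.nonneg)
      finally show "c v e * b e v \<le> (sqrt (c v v) * sqrt (c e e)) * (sqrt (b e e) * sqrt (b v v))" .
    qed
    also have "\<dots> = N * sqrt (c v v) * sqrt (b v v)"
      unfolding N_def sum_distrib_right by (intro sum.cong) auto
    finally have "sqrt (b v v) * sqrt (b v v) \<le> N * sqrt (c v v) * sqrt (b v v)"
      using b.nonneg[OF v] by simp
    moreover have "0 \<le> N * sqrt (c v v)"
      unfolding N_def using B(1,2) v
      by (intro mult_nonneg_nonneg sum_nonneg) (auto simp: subset_iff b.nonneg c.nonneg)
    ultimately have "sqrt (b v v) \<le> N * sqrt (c v v)"
      using b.nonneg[OF v] by (cases "b v v = 0") (auto intro: mult_right_le_imp_le simp del: real_sqrt_mult_self)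
    then have "(sqrt (b v v))\<^sup>2 \<le> (N * sqrt (c v v))\<^sup>2"
      using b.nonneg[OF v] by (intro power_mono) auto
    then have "b v v \<le> N\<^sup>2 * c v v"
      using b.nonneg[OF v] c.nonneg[OF v] by (simp add: power_mult_distrib)
    then show ?thesis
      using c.nonneg[OF v] by (simp add: algebra_simps)
  qed
  then show ?thesis by (intro exI[of _ "N\<^sup>2 + 1"]) (auto simp: add_nonneg_pos)
qed

section \<open>Spectral radius and Rayleigh quotients\<close>

locale form_pair = b: finite_form W b + a: psd_form W a
  for W :: "('a \<Rightarrow> real) set" and b a +
  fixes Op :: "('a \<Rightarrow> real) \<Rightarrow> ('a \<Rightarrow> real)"
  assumes Op_mem: "u \<in> W \<Longrightarrow> Op u \<in> W"
    and Op: "u \<in> W \<Longrightarrow> v \<in> W \<Longrightarrow> b (Op u) v = a u v"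
begin

text \<open>Testing the equation for \<open>Op u\<close> with \<open>w\<close> and that for
  \<open>Op w\<close> with \<open>u\<close>, symmetry of \<open>a\<close> forces
  \<open>Im \<mu> = 0\<close>. Testing each with its own argument and adding exhibits
  \<open>Re \<mu>\<close> as a quotient of \<open>a\<close> by \<open>b\<close>.\<close>

lemma eigenvalue_le:
  assumes \<mu>: "\<mu> \<in> eigenvalues W Op" and r: "\<And>v. v \<in> W \<Longrightarrow> a v v \<le> r * b v v"
  shows "cmod \<mu> \<le> r"
proof -
  obtain u w where uw: "u \<in> W" "w \<in> W" "u \<noteq> (\<lambda>x. 0) \<or> w \<noteq> (\<lambda>x. 0)"
    and Ou: "Op u = (\<lambda>x. Re \<mu> * u x - Im \<mu> * w x)"
    and Ow: "Op w = (\<lambda>x. Im \<mu> * u x + Re \<mu> * w x)"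
    using \<mu> unfolding eigenvalues_def by blast
  have Ou': "a u z = Re \<mu> * b u z - Im \<mu> * b w z" if "z \<in> W" for z
    using Op[OF uw(1) that] uw that unfolding Ou
    by (simp add: b.diff_left b.scale_left b.scale_mem)
  have Ow': "a w z = Im \<mu> * b u z + Re \<mu> * b w z" if "z \<in> W" for z
    using Op[OF uw(2) that] uw that unfolding Ow
    by (simp add: b.add_left b.scale_left b.scale_mem)
  have pos: "b u u + b w w > 0"
    using uw b.nonneg b.definite by (smt (verit, ccfv_SIG))
  have "a u w = a w u" using uw by (simp add: a.sym)
  then have "Im \<mu> * (b u u + b w w) = 0"
    using Ou'[OF uw(2)] Ow'[OF uw(1)] b.sym[OF uw(1,2)] by (simp add: algebra_simps)
  then have im: "Im \<mu> = 0" using pos by simp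
  have "a u u + a w w = Re \<mu> * (b u u + b w w)"
    using Ou'[OF uw(1)] Ow'[OF uw(2)] im by (simp add: algebra_simps)
  moreover have "0 \<le> a u u + a w w"
    using uw a.nonneg by (simp add: add_nonneg_nonneg)
  moreover have "a u u + a w w \<le> r * (b u u + b w w)"
    using r uw by (simp add: distrib_left add_mono)
  ultimately have "0 \<le> Re \<mu>" "Re \<mu> \<le> r"
    using pos by (auto simp: zero_le_mult_iff mult_le_cancel_right)
  then show ?thesis using im by (simp add: cmod_def)
qed

lemma spectral_radius_le:
  assumes "0 \<le> r" "\<And>v. v \<in> W \<Longrightarrow> a v v \<le> r * b v v"
  shows "spectral_radius_on W Op \<le> r"
  unfolding spectral_radius_on_def using assms eigenvalue_le by (intro cSup_least) auto

text \<open>Without an upper bound the \<open>Sup\<close> in \<open>spectral_radius_on\<close> would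
  carry no information.\<close>

lemma bdd_eigenvalues: "bdd_above (insert 0 (cmod ` eigenvalues W Op))"
proof -
  obtain M where "M > 0" "\<forall>v\<in>W. a v v \<le> M * b v v"
    using form_bound[OF a.psd_form_axioms b.finite_form_axioms] by blast
  then show ?thesis
    using eigenvalue_le by (intro bdd_aboveI[of _ M]) auto
qed

lemma spectral_radius_nonneg: "0 \<le> spectral_radius_on W Op"
  unfolding spectral_radius_on_def using bdd_eigenvalues by (intro cSup_upper) auto

text \<open>
  The supremum \<open>M\<close> of the Rayleigh quotient is an eigenvalue: otherwise \<open>M b - a\<close> is definite and
  hence bounds \<open>b\<close> from above up to a constant, so that \<open>M\<close> could be lowered.
\<close>

lemma Rayleigh:
  assumes v: "v \<in> W"
  shows "a v v \<le> spectral_radius_on W Op * b v v"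
proof (cases "v = (\<lambda>x. 0)")
  case True
  then show ?thesis by (simp add: a.zero_left b.zero_left b.zero_mem)
next
  case False
  have bpos: "b u u > 0" if "u \<in> W" "u \<noteq> (\<lambda>x. 0)" for u
    using that b.definite b.nonneg by (metis less_eq_real_def)
  define R where "R = (\<lambda>u. a u u / b u u) ` (W - {\<lambda>x. 0})"
  define M where "M = Sup R"
  obtain N where N: "N > 0" "\<forall>v\<in>W. a v v \<le> N * b v v"
    using form_bound[OF a.psd_form_axioms b.finite_form_axioms] by blast
  have bdd: "bdd_above R"
  proof (rule bdd_aboveI)
    fix x assume "x \<in> R"
    then obtain u where u: "u \<in> W" "u \<noteq> (\<lambda>x. 0)" "x = a u u / b u u"
      by (auto simp: R_def)
    then show "x \<le> N" using N(2) bpos[OF u(1,2)] by (simp add: pos_divide_le_eq)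
  qed
  have M: "a u u \<le> M * b u u" if "u \<in> W" for u
  proof (cases "u = (\<lambda>x. 0)")
    case True
    then show ?thesis by (simp add: a.zero_left b.zero_left b.zero_mem)
  next
    case False
    then have "a u u / b u u \<le> M"
      unfolding M_def using bdd that by (intro cSup_upper) (auto simp: R_def)
    then show ?thesis using bpos[OF that False] by (simp add: field_simps)
  qed
  define c where "c = (\<lambda>u v. M * b u v - a u v)"
  interpret c: psd_form W c
  proof unfold_locales
    fix u v w d assume m: "u \<in> W" "v \<in> W"
    show "c u v = c v u" using m by (simp add: c_def a.sym b.sym)
    show "0 \<le> c u u" using M m by (simp add: c_def)
    assume "w \<in> W"
    then show "c (\<lambda>x. u x + d * v x) w = c u w + d * c v w"
      using m by (simp add: c_def a.lin b.lin algebra_simps)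
  qed
  have "\<exists>u\<in>W. u \<noteq> (\<lambda>x. 0) \<and> c u u = 0"
  proof (rule ccontr)
    assume "\<not> ?thesis"
    then have "finite_form W c"
      using b.determined by unfold_locales auto
    then obtain K where K: "K > 0" "\<forall>v\<in>W. b v v \<le> K * c v v"
      using form_bound[OF b.psd_form_axioms] by blast
    have "Sup R \<le> M - 1 / K"
    proof (rule cSup_least)
      show "R \<noteq> {}" using v False by (auto simp: R_def)
      fix x assume "x \<in> R"
      then obtain u where u: "u \<in> W" "u \<noteq> (\<lambda>x. 0)" "x = a u u / b u u"
        by (auto simp: R_def)
      have "b u u \<le> K * (M * b u u - a u u)"
        using K u unfolding c_def by blast
      then have "a u u \<le> (M - 1 / K) * b u u"
        using K(1) by (simp add: field_simps)
      then have "x \<le> M - 1 / K"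
        using u bpos by (simp add: pos_divide_le_eq)
      then show "x \<le> M - 1 / K" .
    qed
    then show False using K(1) by (simp add: M_def)
  qed
  then obtain u where u: "u \<in> W" "u \<noteq> (\<lambda>x. 0)" "c u u = 0" by blast
  \<comment> \<open>An isotropic vector of a semidefinite form lies in its radical, by
    Cauchy-Schwarz; for \<open>c\<close> this is the eigenvalue equation with eigenvalue
    \<open>M\<close>.\<close>
  have cu: "c u z = 0" if "z \<in> W" for z
    using c.Cauchy_Schwarz[OF u(1) that] u(3) by simp
  have "Op u = (\<lambda>x. M * u x)"
  proof (rule b.eqI)
    show "b (Op u) w = b (\<lambda>x. M * u x) w" if "w \<in> W" for w
      using cu[OF that] u that by (simp add: Op c_def b.scale_left)
  qed (use u Op_mem b.scale_mem in auto)
  moreover have "Op (\<lambda>x. 0) = (\<lambda>x. 0)"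
    using Op Op_mem by (intro b.eqI) (auto simp: b.zero_mem a.zero_left b.zero_left)
  ultimately have "complex_of_real M \<in> eigenvalues W Op"
    unfolding eigenvalues_def using u b.zero_mem
    by (intro CollectI bexI[of _ u] bexI[of _ "\<lambda>x. 0"]) auto
  then have "cmod (complex_of_real M) \<le> spectral_radius_on W Op"
    unfolding spectral_radius_on_def using bdd_eigenvalues by (intro cSup_upper) blast+
  then have "M \<le> spectral_radius_on W Op" by simp
  then have "M * b v v \<le> spectral_radius_on W Op * b v v"
    using b.nonneg[OF v] by (rule mult_right_mono)
  then show ?thesis using M[OF v] by linarith
qed

end

subsection \<open>Successive subspace correction\<close>

lemma Cauchy_Schwarz_sum:
  fixes f g :: "'i \<Rightarrow> real"
  assumes "\<And>i. i \<in> I \<Longrightarrow> 0 \<le> f i" "\<And>i. i \<in> I \<Longrightarrow> 0 \<le> g i"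
  shows "(\<Sum>i\<in>I. sqrt (f i) * sqrt (g i)) \<le> sqrt (\<Sum>i\<in>I. f i) * sqrt (\<Sum>i\<in>I. g i)"
proof -
  have "(\<Sum>i\<in>I. sqrt (f i) * sqrt (g i)) \<le> sqrt (\<Sum>i\<in>I. (sqrt (f i))\<^sup>2) * sqrt (\<Sum>i\<in>I. (sqrt (g i))\<^sup>2)"
    using L2_set_mult_ineq[of "\<lambda>i. sqrt (f i)" "\<lambda>i. sqrt (g i)" I] assms
    by (simp add: L2_set_def abs_mult)
  also have "\<dots> = sqrt (\<Sum>i\<in>I. f i) * sqrt (\<Sum>i\<in>I. g i)"
    using assms by (intro arg_cong2[of _ _ _ _ "(*)"] arg_cong[of _ _ sqrt] sum.cong) auto
  finally show ?thesis .
qed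

text \<open>The factor \<open>G\<close> of the overview. The correction with the largest index acts
  first.\<close>

primrec correction_product ::
  "(nat \<Rightarrow> ('a \<Rightarrow> real) \<Rightarrow> ('a \<Rightarrow> real)) \<Rightarrow> nat \<Rightarrow> ('a \<Rightarrow> real) \<Rightarrow> ('a \<Rightarrow> real)" where
  "correction_product T 0 = id_minus (T 0)"
| "correction_product T (Suc j) = correction_product T j \<circ> id_minus (T (Suc j))"

text \<open>
  The scaling \<open>1 / k\<close> of the subsolvers makes the trivial bound on the interaction of the
  subspaces independent of their number \<open>k\<close>.
\<close>

locale subspace_correction = psd_form W a for W :: "('a \<Rightarrow> real) set" and a +
  fixes T :: "nat \<Rightarrow> ('a \<Rightarrow> real) \<Rightarrow> ('a \<Rightarrow> real)" and k :: nat and K :: real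
  assumes k: "1 \<le> k"
    and T_mem: "i \<le> k \<Longrightarrow> v \<in> W \<Longrightarrow> T i v \<in> W"
    and T_sym: "i \<le> k \<Longrightarrow> u \<in> W \<Longrightarrow> v \<in> W \<Longrightarrow> a (T i u) v = a u (T i v)"
    and T_0: "v \<in> W \<Longrightarrow> a (T 0 v) (T 0 v) \<le> a (T 0 v) v"
    and T_le: "1 \<le> i \<Longrightarrow> i \<le> k \<Longrightarrow> v \<in> W \<Longrightarrow> a (T i v) (T i v) \<le> a (T i v) v / real k"
    and stable: "v \<in> W \<Longrightarrow> a v v \<le> K * (\<Sum>i\<le>k. a (T i v) v)"
begin

lemma T_nonneg: "i \<le> k \<Longrightarrow> v \<in> W \<Longrightarrow> 0 \<le> a (T i v) v"
proof (cases "i = 0")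
  case True
  assume "v \<in> W"
  then show ?thesis using T_0[of v] nonneg[OF T_mem, of 0 v] True by simp
next
  case False
  assume *: "i \<le> k" "v \<in> W"
  have "0 \<le> a (T i v) v / real k"
    using T_le[of i v] nonneg[OF T_mem, OF *] * False by simp
  then show ?thesis using k by (simp add: zero_le_divide_iff)
qed

text \<open>Treats level 0 and the damped levels alike, and is what makes each factor
  \<open>id_minus (T i)\<close> decrease the energy.\<close>

lemma T_contract:
  assumes "i \<le> k" "v \<in> W"
  shows "a (T i v) (T i v) \<le> a (T i v) v"
proof (cases "i = 0")
  case False
  then have "a (T i v) (T i v) \<le> a (T i v) v / real k"
    using T_le assms by simp
  also have "\<dots> \<le> a (T i v) v"
    using T_nonneg[OF assms] k by (simp add: divide_le_eq mult_le_cancel_left1)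
  finally show ?thesis .
qed (use T_0 assms in auto)

text \<open>Makes Cauchy-Schwarz available for the pairing through \<open>T i\<close>.\<close>

lemma T_form: "i \<le> k \<Longrightarrow> psd_form W (\<lambda>u v. a (T i u) v)"
proof
  fix u v w c assume i: "i \<le> k" and m: "u \<in> W" "v \<in> W" "w \<in> W"
  show "a (T i (\<lambda>x. u x + c * v x)) w = a (T i u) w + c * a (T i v) w"
    using i m by (simp add: T_sym lincomb_mem lin T_mem)
next
  fix u v assume "i \<le> k" "u \<in> W" "v \<in> W"
  then show "a (T i u) v = a (T i v) u" by (metis T_sym sym T_mem)
qed (rule T_nonneg)

text \<open>Cauchy-Schwarz over the levels \<open>1..k\<close> costs a factor \<open>k\<close> under
  the root, which the \<open>1 / k\<close> in \<open>T_le\<close> gives back. Level 0 is undamped,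
  and joining it to the others costs the factor 2.\<close>

lemma sum_norms:
  assumes u: "\<And>i. i \<le> k \<Longrightarrow> u i \<in> W"
  shows "(\<Sum>i\<le>k. sqrt (a (T i (u i)) (T i (u i)))) \<le> sqrt (2 * (\<Sum>i\<le>k. a (T i (u i)) (u i)))"
proof -
  let ?t = "\<lambda>i. a (T i (u i)) (u i)"
  have split: "(\<Sum>i\<le>k. f i) = f 0 + (\<Sum>i\<in>{1..k}. f i)" for f :: "nat \<Rightarrow> real"
    by (simp add: atMost_atLeast0 sum.atLeast_Suc_atMost)
  have "(\<Sum>i\<in>{1..k}. sqrt (a (T i (u i)) (T i (u i)))) \<le>
      (\<Sum>i\<in>{1..k}. sqrt (?t i) * sqrt (1 / real k))"
    using T_le u by (intro sum_mono) (simp add: real_sqrt_mult[symmetric])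
  also have "\<dots> \<le> sqrt (\<Sum>i\<in>{1..k}. ?t i) * sqrt (\<Sum>i\<in>{1..k}. 1 / real k)"
    using u T_nonneg by (intro Cauchy_Schwarz_sum) auto
  also have "\<dots> = sqrt (\<Sum>i\<in>{1..k}. ?t i)"
    using k by simp
  finally have 1: "(\<Sum>i\<in>{1..k}. sqrt (a (T i (u i)) (T i (u i)))) \<le> sqrt (\<Sum>i\<in>{1..k}. ?t i)" .
  have 2: "sqrt (a (T 0 (u 0)) (T 0 (u 0))) \<le> sqrt (?t 0)"
    using T_0 u by simp
  have s: "sqrt x + sqrt y \<le> sqrt (2 * (x + y))" if "0 \<le> x" "0 \<le> y" for x y :: real
  proof (rule real_le_rsqrt)
    have "0 \<le> (sqrt x - sqrt y)\<^sup>2" by simp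
    then show "(sqrt x + sqrt y)\<^sup>2 \<le> 2 * (x + y)"
      using that by (simp add: power2_sum power2_diff)
  qed
  have "(\<Sum>i\<le>k. sqrt (a (T i (u i)) (T i (u i)))) \<le> sqrt (?t 0) + sqrt (\<Sum>i\<in>{1..k}. ?t i)"
    using 1 2 by (simp only: split add_mono)
  also have "\<dots> \<le> sqrt (2 * (?t 0 + (\<Sum>i\<in>{1..k}. ?t i)))"
    using u T_nonneg by (intro s sum_nonneg) auto
  finally show ?thesis by (simp only: split)
qed

lemma correction_product_mem: "j \<le> k \<Longrightarrow> v \<in> W \<Longrightarrow> correction_product T j v \<in> W"
  by (induction j arbitrary: v) (auto simp: id_minus_def intro!: diff_mem T_mem)

text \<open>\<open>u i\<close> is the iterate to which the \<open>i\<close>-th correction is applied.\<close>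

lemma iterates:
  assumes "j \<le> k" "v \<in> W"
  shows "\<exists>u. (\<forall>i\<le>j. u i \<in> W \<and> u i = (\<lambda>x. v x - (\<Sum>l\<in>{i<..j}. T l (u l) x))) \<and>
    (\<Sum>i\<le>j. a (T i (u i)) (u i)) \<le>
      a v v - a (correction_product T j v) (correction_product T j v)"
  using assms
proof (induction j arbitrary: v)
  \<comment> \<open>The square expands to
    \<open>a v v - 2 * a (T i v) v + a (T i v) (T i v)\<close>, and \<open>T_contract\<close>
    absorbs the last term in half of the middle one.\<close>
  have energy: "a (id_minus (T i) v) (id_minus (T i) v) \<le> a v v - a (T i v) v"
    if "i \<le> k" "v \<in> W" for i v
    using that T_contract[OF that] unfolding id_minus_def
    by (simp add: diff_left diff_right diff_mem T_mem sym[of v "T i v"])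
  {
    case 0
    then show ?case
      using energy[of 0 v] by (intro exI[of _ "\<lambda>_. v"]) auto
  next
    case (Suc j)
    define v' where "v' = id_minus (T (Suc j)) v"
    have v': "v' \<in> W" unfolding v'_def id_minus_def
      using Suc.prems by (intro diff_mem T_mem) auto
    have "j \<le> k" using Suc.prems by simp
    obtain u where u: "\<forall>i\<le>j. u i \<in> W \<and> u i = (\<lambda>x. v' x - (\<Sum>l\<in>{i<..j}. T l (u l) x))"
      and e: "(\<Sum>i\<le>j. a (T i (u i)) (u i)) \<le>
        a v' v' - a (correction_product T j v') (correction_product T j v')"
      using Suc.IH[OF \<open>j \<le> k\<close> v'] by blast
    \<comment> \<open>The correction with index \<open>Suc j\<close> acts first, hence on
      \<open>v\<close> itself; the iterates of the shorter product, started from \<open>v'\<close>,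
      keep their indices.\<close>
    define u' where "u' = u(Suc j := v)"
    have *: "u' i \<in> W \<and> u' i = (\<lambda>x. v x - (\<Sum>l\<in>{i<..Suc j}. T l (u' l) x))" if "i \<le> Suc j" for i
    proof (cases "i = Suc j")
      case True
      then show ?thesis using Suc.prems by (simp add: u'_def)
    next
      case False
      then have i: "i \<le> j" using that by simp
      have "{i<..Suc j} = insert (Suc j) {i<..j}" using i by auto
      then have "(\<Sum>l\<in>{i<..Suc j}. T l (u' l) x) = T (Suc j) v x + (\<Sum>l\<in>{i<..j}. T l (u l) x)" for x
        by (simp add: u'_def)
      moreover have "u i x = v x - T (Suc j) v x - (\<Sum>l\<in>{i<..j}. T l (u l) x)" for x
        using fun_cong[OF u[rule_format, OF i, THEN conjunct2], of x] by (simp add: v'_def id_minus_def)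
      ultimately show ?thesis using u[rule_format, OF i, THEN conjunct1] i by (simp add: u'_def fun_eq_iff)
    qed
    have "(\<Sum>i\<le>Suc j. a (T i (u' i)) (u' i)) = (\<Sum>i\<le>j. a (T i (u i)) (u i)) + a (T (Suc j) v) v"
      by (simp add: u'_def)
    also have "\<dots> \<le>
        a v v - a (correction_product T (Suc j) v) (correction_product T (Suc j) v)"
      using e energy[of "Suc j" v] Suc.prems by (simp add: v'_def)
    finally have F: "(\<forall>i\<le>Suc j. u' i \<in> W \<and> u' i = (\<lambda>x. v x - (\<Sum>l\<in>{i<..Suc j}. T l (u' l) x))) \<and>
        (\<Sum>i\<le>Suc j. a (T i (u' i)) (u' i)) \<le>
          a v v - a (correction_product T (Suc j) v) (correction_product T (Suc j) v)"
      using * by blast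
    show ?case by (rule exI[of _ u'], rule F)
  }
qed

text \<open>Write \<open>v\<close> as the iterate \<open>u i\<close> plus the corrections applied
  before it. In \<open>a (T i v) v\<close> the first part sums to at most
  \<open>sqrt X * sqrt Y\<close>, the interaction to at most twice that, by \<open>sum_norms\<close>
  for \<open>v\<close> and for the iterates. So \<open>X \<le> (1 + 2)^2 * Y\<close>, which is the
  origin of the 9, and \<open>Y\<close> is at most the energy lost.\<close>

lemma correction_product_contract:
  assumes v: "v \<in> W"
  shows "a v v \<le> 9 * K * (a v v - a (correction_product T k v) (correction_product T k v))"
    (is "_ \<le> 9 * K * ?\<delta>")
proof (cases "K \<le> 0")
  case True
  have "K * (\<Sum>i\<le>k. a (T i v) v) \<le> 0"
    using True T_nonneg v by (intro mult_nonpos_nonneg sum_nonneg) auto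
  then have "a v v = 0" using stable[OF v] nonneg[OF v] by linarith
  moreover have "0 \<le> a (correction_product T k v) (correction_product T k v)"
    using v by (intro nonneg correction_product_mem) auto
  ultimately show ?thesis using True mult_nonpos_nonneg by fastforce
next
  case False
  obtain u where u': "\<forall>i\<le>k. u i \<in> W \<and> u i = (\<lambda>x. v x - (\<Sum>l\<in>{i<..k}. T l (u l) x))"
    and e: "(\<Sum>i\<le>k. a (T i (u i)) (u i)) \<le> ?\<delta>"
    using iterates[OF order_refl v] by blast
  have u: "u i \<in> W" "u i = (\<lambda>x. v x - (\<Sum>l\<in>{i<..k}. T l (u l) x))" if "i \<le> k" for i
    using u'[rule_format, OF that, THEN conjunct1] u'[rule_format, OF that, THEN conjunct2] by -
  define X where "X = (\<Sum>i\<le>k. a (T i v) v)"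
  define Y where "Y = (\<Sum>i\<le>k. a (T i (u i)) (u i))"
  let ?n = "\<lambda>w. sqrt (a w w)"
  have X0: "0 \<le> X" and Y0: "0 \<le> Y"
    unfolding X_def Y_def using v u(1) T_nonneg by (auto intro!: sum_nonneg)
  have single: "a (T i v) v \<le> sqrt (a (T i v) v) * sqrt (a (T i (u i)) (u i)) +
      ?n (T i v) * (\<Sum>l\<le>k. ?n (T l (u l)))" if i: "i \<le> k" for i
  proof -
    interpret Ti: psd_form W "\<lambda>u v. a (T i u) v" by (rule T_form[OF i])
    have Tv: "T i v \<in> W" using i v T_mem by simp
    have v_eq: "v = (\<lambda>x. u i x + (\<Sum>l\<in>{i<..k}. 1 * T l (u l) x))"
      using fun_cong[OF u(2)[OF i]] by (simp add: fun_eq_iff)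
    have "a (T i v) v = a (T i v) (\<lambda>x. u i x + (\<Sum>l\<in>{i<..k}. 1 * T l (u l) x))"
      by (rule arg_cong[OF v_eq])
    also have "\<dots> = a (T i v) (u i) + (\<Sum>l\<in>{i<..k}. a (T i v) (T l (u l)))"
    proof -
      have m: "T l (u l) \<in> W" if "l \<in> {i<..k}" for l using that u(1) T_mem by simp
      show ?thesis
        using sum_mem[of "{i<..k}" "\<lambda>l. T l (u l)" "\<lambda>_. 1", OF m]
          sum_right[of "{i<..k}" "\<lambda>l. T l (u l)" _ "\<lambda>_. 1", OF m Tv]
        by (subst add_right) (simp_all add: u(1) i Tv)
    qed
    also have "a (T i v) (u i) \<le> sqrt (a (T i v) v) * sqrt (a (T i (u i)) (u i))"
      using Ti.Cauchy_Schwarz[OF v u(1)[OF i]] by simp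
    also have "(\<Sum>l\<in>{i<..k}. a (T i v) (T l (u l))) \<le> (\<Sum>l\<in>{i<..k}. ?n (T i v) * ?n (T l (u l)))"
    proof (rule sum_mono)
      fix l assume "l \<in> {i<..k}"
      then have "T l (u l) \<in> W" using u(1) T_mem by simp
      then show "a (T i v) (T l (u l)) \<le> ?n (T i v) * ?n (T l (u l))"
        using Cauchy_Schwarz[OF Tv] by (meson abs_ge_self order_trans)
    qed
    \<comment> \<open>Enlarging the range to all \<open>l\<close> uncouples the double sum over
      \<open>i\<close> and \<open>l\<close> into a product of two sums.\<close>
    also have "\<dots> \<le> (\<Sum>l\<le>k. ?n (T i v) * ?n (T l (u l)))"
      using Tv u(1) T_mem nonneg by (intro sum_mono2) auto
    finally show ?thesis by (simp add: sum_distrib_left)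
  qed
  have "X \<le> (\<Sum>i\<le>k. sqrt (a (T i v) v) * sqrt (a (T i (u i)) (u i))) +
      (\<Sum>i\<le>k. ?n (T i v)) * (\<Sum>l\<le>k. ?n (T l (u l)))"
    unfolding X_def sum_distrib_right sum.distrib[symmetric]
    by (rule sum_mono) (use single in simp)
  also have "(\<Sum>i\<le>k. sqrt (a (T i v) v) * sqrt (a (T i (u i)) (u i))) \<le> sqrt X * sqrt Y"
    unfolding X_def Y_def using v u(1) T_nonneg by (intro Cauchy_Schwarz_sum) auto
  also have "(\<Sum>i\<le>k. ?n (T i v)) * (\<Sum>l\<le>k. ?n (T l (u l))) \<le> sqrt (2 * X) * sqrt (2 * Y)"
    unfolding X_def Y_def using v u(1) T_mem nonneg T_nonneg
    by (intro mult_mono sum_norms sum_nonneg real_sqrt_ge_zero mult_nonneg_nonneg) auto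
  also have "sqrt X * sqrt Y + sqrt (2 * X) * sqrt (2 * Y) = 3 * sqrt Y * sqrt X"
    by (simp add: real_sqrt_mult)
  finally have "sqrt X * sqrt X \<le> (3 * sqrt Y) * sqrt X" using X0 by simp
  then have "sqrt X \<le> 3 * sqrt Y"
    using X0 Y0 by (cases "X = 0") (auto intro: mult_right_le_imp_le simp del: real_sqrt_mult_self)
  then have "(sqrt X)\<^sup>2 \<le> (3 * sqrt Y)\<^sup>2" using X0 by (intro power_mono) auto
  then have "X \<le> 9 * Y" using X0 Y0 by (simp add: power_mult_distrib)
  also have "\<dots> \<le> 9 * ?\<delta>" using e unfolding Y_def by simp
  finally have "K * X \<le> K * (9 * ?\<delta>)" using False by (intro mult_left_mono) auto
  then show ?thesis using stable[OF v] unfolding X_def by linarith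
qed

lemma symmetric_product_mem: "j \<le> k \<Longrightarrow> v \<in> W \<Longrightarrow> symmetric_product T j v \<in> W"
  by (induction j arbitrary: v)
    (auto simp: id_minus_def eval_nat_numeral intro!: diff_mem T_mem)

lemma id_minus_sym:
  "i \<le> k \<Longrightarrow> u \<in> W \<Longrightarrow> v \<in> W \<Longrightarrow> a (id_minus (T i) u) v = a u (id_minus (T i) v)"
  by (simp add: id_minus_def diff_left diff_right T_mem T_sym)

text \<open>Self-adjointness moves the left factor of each symmetric pair to the other argument;
  this is \<open>S = G* G\<close>.\<close>

lemma symmetric_product:
  "j \<le> k \<Longrightarrow> u \<in> W \<Longrightarrow> v \<in> W \<Longrightarrow>
    a (symmetric_product T j u) v = a (correction_product T j u) (correction_product T j v)"
proof (induction j arbitrary: u v)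
  have mem: "id_minus (T i) v \<in> W" if "i \<le> k" "v \<in> W" for i v
    using that by (auto simp: id_minus_def intro!: diff_mem T_mem)
  {
    case 0
    then show ?case by (simp add: eval_nat_numeral id_minus_sym mem)
  next
    case (Suc j)
    then show ?case
      by (simp add: id_minus_sym symmetric_product_mem mem)
  }
qed

lemma symmetric_product_sym:
  "u \<in> W \<Longrightarrow> v \<in> W \<Longrightarrow> a (symmetric_product T k u) v = a u (symmetric_product T k v)"
  using symmetric_product[of k u v] symmetric_product[of k v u]
    sym[of u "symmetric_product T k v"]
    sym[of "correction_product T k u" "correction_product T k v"]
  by (simp add: symmetric_product_mem correction_product_mem)

text \<open>\<open>a w w\<close> pairs \<open>S v\<close> with \<open>w\<close>, so it equals the
  pairing of \<open>G v\<close> with \<open>G w\<close>. Each \<open>G\<close> contributes the root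
  of its contraction factor, and one norm of \<open>w\<close> cancels.\<close>

lemma symmetric_product_contract:
  assumes K: "0 < K" and K9: "1 \<le> 9 * K" and v: "v \<in> W"
  defines "w \<equiv> symmetric_product T k v"
  shows "sqrt (a w w) \<le> (1 - 1 / (9 * K)) * sqrt (a v v)"
proof -
  let ?G = "correction_product T k" and ?c = "1 - 1 / (9 * K)"
  have w: "w \<in> W" unfolding w_def using v symmetric_product_mem by simp
  have c: "0 \<le> ?c" using K K9 by simp
  have G: "a (?G u) (?G u) \<le> ?c * a u u" if "u \<in> W" for u
    using correction_product_contract[OF that] K by (simp add: field_simps)
  have G': "sqrt (a (?G u) (?G u)) \<le> sqrt ?c * sqrt (a u u)" if "u \<in> W" for u
    using real_sqrt_le_mono[OF G[OF that]] by (simp only: real_sqrt_mult)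
  have "a w w = a (?G v) (?G w)"
    unfolding w_def using v symmetric_product_mem by (simp add: symmetric_product)
  also have "\<dots> \<le> sqrt (a (?G v) (?G v)) * sqrt (a (?G w) (?G w))"
    using Cauchy_Schwarz[of "?G v" "?G w"] v w correction_product_mem by fastforce
  also have "\<dots> \<le> (sqrt ?c * sqrt (a v v)) * (sqrt ?c * sqrt (a w w))"
    using v w correction_product_mem nonneg c by (intro mult_mono G' mult_nonneg_nonneg) auto
  also have "\<dots> = (sqrt ?c * sqrt ?c) * sqrt (a v v) * sqrt (a w w)" by (simp only: ac_simps)
  also have "sqrt ?c * sqrt ?c = ?c" using c by simp
  finally have "sqrt (a w w) * sqrt (a w w) \<le> ?c * sqrt (a v v) * sqrt (a w w)"
    using nonneg[OF w] by simp
  then show ?thesis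
    using nonneg[OF w] nonneg[OF v] c mult_nonneg_nonneg[OF c, of "sqrt (a v v)"]
    by (cases "a w w = 0") (auto intro: mult_right_le_imp_le simp del: real_sqrt_mult_self)
qed

lemma power_mem: "v \<in> W \<Longrightarrow> (symmetric_product T k ^^ n) v \<in> W"
  by (induction n) (auto simp: symmetric_product_mem)

lemma power_sym:
  "u \<in> W \<Longrightarrow> v \<in> W \<Longrightarrow>
    a ((symmetric_product T k ^^ n) u) v = a u ((symmetric_product T k ^^ n) v)"
  by (induction n arbitrary: v)
    (simp_all add: symmetric_product_sym power_mem symmetric_product_mem flip: funpow_swap1)

text \<open>Uses \<open>(1 - 1 / x)^(2 n) \<le> exp (- 2 n / x) \<le> 1 / (1 + 2 n / x)\<close>.\<close>

lemma power_contract: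
  fixes n :: nat
  assumes K: "0 < K" and v: "v \<in> W"
  defines "w \<equiv> (symmetric_product T k ^^ n) v"
  shows "a w w \<le> 9 * K / (9 * K + 2 * real n) * a v v"
proof (cases "1 \<le> 9 * K")
  case True
  let ?c = "1 - 1 / (9 * K)"
  have c: "0 \<le> ?c" using K True by simp
  have "sqrt (a ((symmetric_product T k ^^ n) v) ((symmetric_product T k ^^ n) v)) \<le>
      ?c ^ n * sqrt (a v v)"
  proof (induction n)
    case (Suc n)
    have "sqrt (a ((symmetric_product T k ^^ Suc n) v) ((symmetric_product T k ^^ Suc n) v)) \<le>
        ?c * sqrt (a ((symmetric_product T k ^^ n) v) ((symmetric_product T k ^^ n) v))"
      using symmetric_product_contract[OF K True power_mem[OF v]] by simp
    also have "\<dots> \<le> ?c * (?c ^ n * sqrt (a v v))"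
      using Suc c by (rule mult_left_mono)
    finally show ?case by (simp only: power_Suc mult.assoc)
  qed simp
  then have "(sqrt (a w w))\<^sup>2 \<le> (?c ^ n * sqrt (a v v))\<^sup>2"
    unfolding w_def using nonneg[OF power_mem[OF v]] by (intro power_mono) auto
  then have "a w w \<le> ?c ^ (2 * n) * a v v"
    unfolding w_def using nonneg[OF power_mem[OF v]] nonneg[OF v]
    by (simp add: power_mult_distrib power_mult[symmetric] mult.commute)
  also have "?c ^ (2 * n) \<le> exp (- (1 / (9 * K))) ^ (2 * n)"
    using c exp_ge_add_one_self[of "- (1 / (9 * K))"] by (intro power_mono) auto
  also have "\<dots> = exp (- (2 * real n / (9 * K)))"
    by (simp add: exp_of_nat_mult[symmetric])
  also have "\<dots> = 1 / exp (2 * real n / (9 * K))"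
    by (simp add: exp_minus inverse_eq_divide)
  also have "\<dots> \<le> 1 / (1 + 2 * real n / (9 * K))"
    using K exp_ge_add_one_self[of "2 * real n / (9 * K)"]
    by (intro divide_left_mono mult_pos_pos) (auto intro!: add_pos_nonneg)
  also have "\<dots> = 9 * K / (9 * K + 2 * real n)"
    using K by (simp add: field_simps)
  finally show ?thesis using nonneg[OF v] by (simp add: mult_right_mono)
next
  case False
  \<comment> \<open>If \<open>9 * K < 1\<close>, the factor \<open>1 - 1 / (9 * K)\<close> is
    negative and cannot bound a norm. But then losing energy at the stated rate is possible only for
    elements of zero energy.\<close>
  have "a u u = 0" if u: "u \<in> W" for u
  proof (rule ccontr)
    assume "a u u \<noteq> 0"
    then have pos: "0 < a u u" using nonneg[OF u] by simp
    have "a u u \<le> 9 * K * (a u u - a (correction_product T k u) (correction_product T k u))"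
      by (rule correction_product_contract[OF u])
    also have "\<dots> \<le> 9 * K * a u u"
      using K nonneg[OF correction_product_mem[OF _ u]] by (intro mult_left_mono) auto
    also have "\<dots> < 1 * a u u"
      using False pos by (intro mult_strict_right_mono) auto
    finally show False by simp
  qed
  then show ?thesis unfolding w_def using v power_mem by simp
qed

end

subsection \<open>Square-integrable functions\<close>

lemma L2_lincomb:
  assumes "u \<in> L2 \<Omega>" "v \<in> L2 \<Omega>"
  shows "(\<lambda>x. u x + c * v x) \<in> L2 \<Omega>"
proof -
  have [measurable]: "u \<in> borel_measurable (lebesgue_on \<Omega>)" "v \<in> borel_measurable (lebesgue_on \<Omega>)"
    using assms by (auto simp: L2_def)
  have "integrable (lebesgue_on \<Omega>) (\<lambda>x. (u x + c * v x)\<^sup>2)"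
  proof (rule Bochner_Integration.integrable_bound)
    show "integrable (lebesgue_on \<Omega>) (\<lambda>x. 2 * (u x)\<^sup>2 + 2 * c\<^sup>2 * (v x)\<^sup>2)"
      using assms by (auto simp: L2_def)
    have "(u x + c * v x)\<^sup>2 \<le> 2 * (u x)\<^sup>2 + 2 * c\<^sup>2 * (v x)\<^sup>2" for x
      using zero_le_power2[of "u x - c * v x"] by (simp add: power2_eq_square algebra_simps)
    then show "AE x in lebesgue_on \<Omega>. norm ((u x + c * v x)\<^sup>2) \<le>
        norm (2 * (u x)\<^sup>2 + 2 * c\<^sup>2 * (v x)\<^sup>2)"
      by (intro AE_I2) (simp add: add_nonneg_nonneg)
  qed measurable
  then show ?thesis by (simp add: L2_def)
qed

lemma L2_mult_integrable:
  assumes "u \<in> L2 \<Omega>" "v \<in> L2 \<Omega>"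
  shows "integrable (lebesgue_on \<Omega>) (\<lambda>x. u x * v x)"
proof (rule Bochner_Integration.integrable_bound)
  have [measurable]: "u \<in> borel_measurable (lebesgue_on \<Omega>)" "v \<in> borel_measurable (lebesgue_on \<Omega>)"
    using assms by (auto simp: L2_def)
  show "(\<lambda>x. u x * v x) \<in> borel_measurable (lebesgue_on \<Omega>)" by measurable
  show "integrable (lebesgue_on \<Omega>) (\<lambda>x. (u x)\<^sup>2 + (v x)\<^sup>2)"
    using assms by (auto simp: L2_def)
  have "\<bar>u x * v x\<bar> \<le> (u x)\<^sup>2 + (v x)\<^sup>2" for x
    using zero_le_power2[of "u x - v x"] zero_le_power2[of "u x + v x"]
    by (simp add: power2_eq_square algebra_simps abs_le_iff)
  then show "AE x in lebesgue_on \<Omega>. norm (u x * v x) \<le> norm ((u x)\<^sup>2 + (v x)\<^sup>2)"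
    by (intro AE_I2) (simp add: add_nonneg_nonneg)
qed

lemma L2_inner_lin:
  assumes "u \<in> L2 \<Omega>" "v \<in> L2 \<Omega>" "w \<in> L2 \<Omega>"
  shows "L2_inner \<Omega> (\<lambda>x. u x + c * v x) w = L2_inner \<Omega> u w + c * L2_inner \<Omega> v w"
proof -
  have "L2_inner \<Omega> (\<lambda>x. u x + c * v x) w =
      (LINT x|lebesgue_on \<Omega>. u x * w x + c * (v x * w x))"
    unfolding L2_inner_def by (simp add: algebra_simps)
  also have "\<dots> = L2_inner \<Omega> u w + c * L2_inner \<Omega> v w"
    unfolding L2_inner_def using assms L2_mult_integrable
    by (subst Bochner_Integration.integral_add) (auto intro!: integrable_mult_right)
  finally show ?thesis .
qed

lemma L2_inner_sym: "L2_inner \<Omega> u v = L2_inner \<Omega> v u"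
  by (simp add: L2_inner_def mult.commute)

lemma L2_inner_nonneg: "0 \<le> L2_inner \<Omega> u u"
  by (simp add: L2_inner_def)

subsection \<open>Smooth functions\<close>

lemma C_k_Suc_imp: "C_k (Suc k) f \<Longrightarrow> C_k k f"
proof (induction k arbitrary: f)
  case 0
  then obtain G where "\<And>x. GDERIV f x :> G x" by auto
  then have "f differentiable (at x)" for x
    unfolding gderiv_def differentiable_def by blast
  then show ?case
    by (auto intro!: continuous_at_imp_continuous_on differentiable_imp_continuous_within)
next
  case (Suc k)
  from Suc.prems obtain G where "\<forall>x. GDERIV f x :> G x" "\<forall>i. C_k (Suc k) (\<lambda>x. G x $ i)"
    unfolding C_k.simps(2)[of "Suc k"] by blast
  then show ?case using Suc.IH C_k.simps(2)[of k f] by blast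
qed

lemma C_k_const: "C_k k (\<lambda>x. c)"
proof (induction k arbitrary: c)
  case (Suc k)
  then show ?case by (auto intro!: exI[of _ "\<lambda>x. 0"] GDERIV_const)
qed simp

lemma C_k_add: "C_k k f \<Longrightarrow> C_k k g \<Longrightarrow> C_k k (\<lambda>x. f x + g x)"
proof (induction k arbitrary: f g)
  case 0
  then show ?case by (auto intro: continuous_intros)
next
  case (Suc k)
  obtain G where G: "\<forall>x. GDERIV f x :> G x" "\<forall>i. C_k k (\<lambda>x. G x $ i)"
    using Suc.prems(1) by auto
  obtain H where H: "\<forall>x. GDERIV g x :> H x" "\<forall>i. C_k k (\<lambda>x. H x $ i)"
    using Suc.prems(2) by auto
  show ?case
    using G H Suc.IH by (auto intro!: exI[of _ "\<lambda>x. G x + H x"] GDERIV_add)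
qed

lemma C_k_mult: "C_k k f \<Longrightarrow> C_k k g \<Longrightarrow> C_k k (\<lambda>x. f x * g x)"
proof (induction k arbitrary: f g)
  case 0
  then show ?case by (auto intro: continuous_intros)
next
  case (Suc k)
  obtain G where G: "\<forall>x. GDERIV f x :> G x" "\<forall>i. C_k k (\<lambda>x. G x $ i)"
    using Suc.prems(1) by auto
  obtain H where H: "\<forall>x. GDERIV g x :> H x" "\<forall>i. C_k k (\<lambda>x. H x $ i)"
    using Suc.prems(2) by auto
  have "C_k k f" "C_k k g" using Suc.prems C_k_Suc_imp by auto
  then show ?case
    using G H Suc.IH
    by (auto intro!: exI[of _ "\<lambda>x. f x *\<^sub>R H x + g x *\<^sub>R G x"] GDERIV_mult C_k_add)
qed

lemma C_k_cmult: "C_k k f \<Longrightarrow> C_k k (\<lambda>x. c * f x)"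
  by (intro C_k_mult C_k_const)

lemma C_k_prod:
  "finite I \<Longrightarrow> (\<And>i. i \<in> I \<Longrightarrow> C_k k (f i)) \<Longrightarrow> C_k k (\<lambda>x. \<Prod>i\<in>I. f i x)"
  by (induction I rule: finite_induct) (auto intro: C_k_const C_k_mult)

text \<open>For \<open>n = 0\<close> the classical smooth function \<open>exp (- 1 / t)\<close>
  extended by zero. The powers of \<open>1 / t\<close> make the linear span of the family closed
  under differentiation.\<close>

definition flat :: "nat \<Rightarrow> real \<Rightarrow> real" where
  "flat n t = (if 0 < t then (1 / t) ^ n * exp (- (1 / t)) else 0)"

lemma flat_tendsto_0: "(flat n \<longlongrightarrow> 0) (at_right 0)"
proof -
  have "((\<lambda>t::real. (inverse t) ^ n / exp (inverse t)) \<longlongrightarrow> 0) (at_right 0)"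
    by (rule filterlim_compose[OF tendsto_power_div_exp_0 filterlim_inverse_at_top_right])
  then show ?thesis
    by (rule Lim_transform_eventually)
      (auto simp: flat_def eventually_at_filter exp_minus inverse_eq_divide divide_simps)
qed

lemma DERIV_flat:
  "(flat n has_field_derivative flat (n + 2) t - real n * flat (n + 1) t) (at t)"
proof -
  consider "t < 0" | "t = 0" | "0 < t" by linarith
  then show ?thesis
  proof cases
    case 1
    then have "((\<lambda>t. 0) has_field_derivative flat (n + 2) t - real n * flat (n + 1) t) (at t)"
      by (simp add: flat_def)
    then show ?thesis
      by (rule has_field_derivative_transform_within_open[of _ _ _ "{..<0}"])
        (use 1 in \<open>auto simp: flat_def\<close>)
  next
    case 2
    have "((\<lambda>h. (flat n (0 + h) - flat n 0) / h) \<longlongrightarrow> 0) (at 0)"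
    proof (rule filterlim_split_at)
      show "((\<lambda>h. (flat n (0 + h) - flat n 0) / h) \<longlongrightarrow> 0) (at_left 0)"
        by (rule tendsto_eventually) (auto simp: flat_def eventually_at_filter)
      \<comment> \<open>For \<open>0 < h\<close> the difference quotient at zero is exactly
        \<open>flat (Suc n) h\<close>.\<close>
      show "((\<lambda>h. (flat n (0 + h) - flat n 0) / h) \<longlongrightarrow> 0) (at_right 0)"
        by (rule Lim_transform_eventually[OF flat_tendsto_0[of "Suc n"]])
          (auto simp: flat_def eventually_at_filter)
    qed
    then show ?thesis using 2 by (simp add: DERIV_def flat_def)
  next
    case 3
    have "((\<lambda>t. (1 / t) ^ n * exp (- (1 / t))) has_field_derivative
        flat (n + 2) t - real n * flat (n + 1) t) (at t)"
      using 3 by ((cases n; auto intro!: derivative_eq_intros simp: flat_def field_simps power2_eq_square),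
        metis Suc_pred neq0_conv power_Suc)
    then show ?thesis
      by (rule has_field_derivative_transform_within_open[of _ _ _ "{0<..}"])
        (use 3 in \<open>auto simp: flat_def\<close>)
  qed
qed

lemma flat_bounds: "0 \<le> flat 0 t" "flat 0 t \<le> 1"
  by (auto simp: flat_def)

text \<open>The induction must run over all \<open>n\<close> at once, since differentiating
  \<open>flat n\<close> produces \<open>flat (n + 1)\<close> and \<open>flat (n + 2)\<close>. The
  affine argument covers both faces of a box in direction \<open>i\<close>.\<close>

lemma C_k_flat: "C_k k (\<lambda>x. flat n (c * x $ i + d))"
proof (induction k arbitrary: n)
  have G: "GDERIV (\<lambda>x. flat n (c * x $ i + d)) x :>
      axis i (c * (flat (n + 2) (c * x $ i + d) - real n * flat (n + 1) (c * x $ i + d)))" for n x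
  proof -
    let ?D = "flat (n + 2) (c * x $ i + d) - real n * flat (n + 1) (c * x $ i + d)"
    have "((\<lambda>x. c * x $ i + d) has_derivative (\<lambda>h. c * h $ i)) (at x)"
      by (auto intro!: derivative_eq_intros bounded_linear_imp_has_derivative bounded_linear_vec_nth)
    then have "((\<lambda>x. flat n (c * x $ i + d)) has_derivative (\<lambda>h. c * h $ i * ?D)) (at x)"
      by (rule DERIV_compose_FDERIV[OF DERIV_flat])
    moreover have "c * h $ i * ?D = h \<bullet> axis i (c * ?D)" for h
      by (simp only: inner_axis) simp
    ultimately show ?thesis
      unfolding gderiv_def by simp
  qed
  {
    case 0
    have "isCont (\<lambda>x. flat n (c * x $ i + d)) x" for x
      using G[of n x] unfolding gderiv_def by (rule has_derivative_continuous)
    then show ?case by (simp add: continuous_at_imp_continuous_on)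
  next
    case (Suc k)
    have *: "C_k k (\<lambda>x. c * (flat (n + 2) (c * x $ i + d) +
        (- real n) * flat (n + 1) (c * x $ i + d)))"
      by (intro C_k_cmult C_k_add Suc.IH)
    have "C_k k (\<lambda>x. axis i (c * (flat (n + 2) (c * x $ i + d) -
        real n * flat (n + 1) (c * x $ i + d))) $ j)" for j
      using * by (cases "j = i") (auto simp: axis_def C_k_const)
    then show ?case
      unfolding C_k.simps using G
      by (intro exI[of _ "\<lambda>x. axis i (c * (flat (n + 2) (c * x $ i + d) -
        real n * flat (n + 1) (c * x $ i + d)))"] conjI allI)
  }
qed

text \<open>Per coordinate, one factor is zero up to \<open>a $ i\<close> and the other from
  \<open>b $ i\<close> on. Scaling both arguments by \<open>Suc m\<close> leaves the support in the
  closed box and sends the exponents to zero at every point of the open box.\<close>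

lemma box_bumps:
  fixes a b :: "real^'n"
  assumes sub: "cbox a b \<subseteq> interior \<Omega>"
  obtains \<phi> :: "nat \<Rightarrow> real^'n \<Rightarrow> real"
  where "\<And>m. \<phi> m \<in> test_functions \<Omega>" "\<And>m x. \<bar>\<phi> m x\<bar> \<le> 1"
    "\<And>x. (\<lambda>m. \<phi> m x) \<longlonglongrightarrow> indicator (box a b) x"
proof -
  define e where "e = (\<lambda>(m::nat) i (x::real^'n). flat 0 (real (Suc m) * x $ i + (- real (Suc m) * a $ i)) *
    flat 0 ((- real (Suc m)) * x $ i + real (Suc m) * b $ i))"
  define \<phi> where "\<phi> = (\<lambda>m x. \<Prod>i\<in>UNIV. e m i x)"
  have pos: "0 < real (Suc m) * s + - real (Suc m) * t \<longleftrightarrow> t < s"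
    "0 < - real (Suc m) * s + real (Suc m) * t \<longleftrightarrow> s < t" for m s t
    using zero_less_mult_iff[of "real (Suc m)" "s - t"] zero_less_mult_iff[of "real (Suc m)" "t - s"]
    by (simp_all add: algebra_simps)
  have e_eq: "e m i x = (if a $ i < x $ i \<and> x $ i < b $ i
      then exp (- (1 / (real (Suc m) * x $ i + (- real (Suc m) * a $ i)))) *
        exp (- (1 / ((- real (Suc m)) * x $ i + real (Suc m) * b $ i))) else 0)" for m i x
    unfolding e_def flat_def using pos by auto
  have zero: "\<phi> m x = 0" if "x \<notin> box a b" for m x
  proof -
    from that obtain i where "\<not> (a $ i < x $ i \<and> x $ i < b $ i)"
      by (auto simp: mem_box_cart)
    then have "e m i x = 0" by (auto simp: e_eq)
    then show ?thesis unfolding \<phi>_def by (intro prod_zero) auto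
  qed
  show thesis
  proof
    fix m
    have "{x. \<phi> m x \<noteq> 0} \<subseteq> box a b" using zero by blast
    then have "closure {x. \<phi> m x \<noteq> 0} \<subseteq> cbox a b"
      by (meson box_subset_cbox closed_cbox closure_minimal order_trans)
    moreover have "C_k k (\<phi> m)" for k
      unfolding \<phi>_def e_def by (intro C_k_prod C_k_mult C_k_flat) auto
    ultimately show "\<phi> m \<in> test_functions \<Omega>"
      unfolding test_functions_def using sub
      by (auto simp: compact_eq_bounded_closed intro: bounded_subset[OF bounded_cbox])
  next
    fix m x
    have "0 \<le> e m i x \<and> e m i x \<le> 1" for i
      unfolding e_def by (auto intro!: mult_nonneg_nonneg mult_le_one flat_bounds)
    then show "\<bar>\<phi> m x\<bar> \<le> 1"
      unfolding \<phi>_def by (auto simp: abs_prod intro!: prod_le_1)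
  next
    fix x
    show "(\<lambda>m. \<phi> m x) \<longlonglongrightarrow> indicator (box a b) x"
    proof (cases "x \<in> box a b")
      case True
      then have x: "a $ i < x $ i" "x $ i < b $ i" for i by (auto simp: mem_box_cart)
      have lim: "(\<lambda>m. exp (- (1 / (real (Suc m) * s)))) \<longlonglongrightarrow> 1" for s :: real
      proof -
        have "(\<lambda>m. exp (- (inverse (real (Suc m)) * (1 / s)))) \<longlonglongrightarrow> exp (- (0 * (1 / s)))"
          by (intro tendsto_intros LIMSEQ_inverse_real_of_nat)
        then show ?thesis by (simp add: field_simps)
      qed
      have "(\<lambda>m. e m i x) \<longlonglongrightarrow> 1" for i
      proof -
        have "e m i x = exp (- (1 / (real (Suc m) * (x $ i - a $ i)))) *
            exp (- (1 / (real (Suc m) * (b $ i - x $ i))))" for m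
          unfolding e_eq using x[of i] by (simp add: algebra_simps)
        then show ?thesis
          using tendsto_mult[OF lim[of "x $ i - a $ i"] lim[of "b $ i - x $ i"]] by simp
      qed
      then have "(\<lambda>m. \<phi> m x) \<longlonglongrightarrow> (\<Prod>i\<in>(UNIV::'n set). 1)"
        unfolding \<phi>_def by (intro tendsto_prod)
      then show ?thesis using True by simp
    qed (simp add: zero)
  qed
qed

subsection \<open>Weak derivatives\<close>

text \<open>Test functions see only the interior while integrals run over all of
  \<open>\<Omega>\<close>; the null boundary reconciles the two, and compactness makes continuous
  functions square-integrable.\<close>

locale null_boundary_domain =
  fixes \<Omega> :: "(real^'n) set"
  assumes compact: "compact \<Omega>" and null_boundary: "negligible (\<Omega> - interior \<Omega>)"
begin

lemma sets_\<Omega> [measurable]: "\<Omega> \<in> sets lebesgue"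
  using compact by (simp add: compact_imp_closed lmeasurable_compact fmeasurableD)

lemma finite_measure_\<Omega>: "finite_measure (lebesgue_on \<Omega>)"
  using compact by (intro finite_measure_lebesgue_on lmeasurable_compact)

lemma continuous_L2:
  assumes "continuous_on \<Omega> f"
  shows "f \<in> L2 \<Omega>"
proof -
  interpret finite_measure "lebesgue_on \<Omega>" by (rule finite_measure_\<Omega>)
  have [measurable]: "f \<in> borel_measurable (lebesgue_on \<Omega>)"
    using assms sets_\<Omega> by (rule continuous_imp_measurable_on_sets_lebesgue)
  obtain B where B: "\<And>x. x \<in> \<Omega> \<Longrightarrow> norm (f x) \<le> B"
    using compact_continuous_image[OF assms compact] compact_imp_bounded bounded_iff by (metis imageI)
  have "integrable (lebesgue_on \<Omega>) (\<lambda>x. (f x)\<^sup>2)"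
  proof (rule integrable_const_bound)
    have "(f x)\<^sup>2 \<le> B\<^sup>2" if "x \<in> \<Omega>" for x
      using power_mono[OF B[OF that], of 2] by simp
    then show "AE x in lebesgue_on \<Omega>. norm ((f x)\<^sup>2) \<le> B\<^sup>2" by (intro AE_I2) auto
  qed measurable
  then show ?thesis by (simp add: L2_def)
qed

lemma test_continuous: "\<phi> \<in> test_functions \<Omega> \<Longrightarrow> continuous_on S \<phi>"
  unfolding test_functions_def using C_k.simps(1) continuous_on_subset by blast

lemma test_L2: "\<phi> \<in> test_functions \<Omega> \<Longrightarrow> \<phi> \<in> L2 \<Omega>"
  by (intro continuous_L2 test_continuous)

lemma test_gradient:
  assumes "\<phi> \<in> test_functions \<Omega>"
  obtains G where "\<And>x. GDERIV \<phi> x :> G x" "\<And>j. continuous_on UNIV (\<lambda>x. G x $ j)"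
    "\<And>x j. frechet_derivative \<phi> (at x) (axis j 1) = G x $ j"
proof -
  have "C_k (Suc 0) \<phi>" using assms unfolding test_functions_def by blast
  then obtain G where G: "\<And>x. GDERIV \<phi> x :> G x" "\<And>j. continuous_on UNIV (\<lambda>x. G x $ j)"
    by auto
  have "frechet_derivative \<phi> (at x) (axis j 1) = G x $ j" for x j
    using frechet_derivative_at[OF G(1)[of x, unfolded gderiv_def], symmetric]
    by (simp add: inner_axis')
  then show ?thesis using G that by blast
qed

text \<open>
  The averages of \<open>g\<close> over all small boxes vanish because test functions converge boundedly to their
  indicators; Lebesgue differentiation does the rest.
\<close>

lemma fundamental_lemma:
  assumes g: "g \<in> L2 \<Omega>"
    and zero: "\<And>\<phi>. \<phi> \<in> test_functions \<Omega> \<Longrightarrow> (LINT x|lebesgue_on \<Omega>. g x * \<phi> x) = 0"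
  shows "AE x in lebesgue_on \<Omega>. g x = 0"
proof -
  have g_int: "integrable (lebesgue_on \<Omega>) g"
    using L2_mult_integrable[OF g continuous_L2[OF continuous_on_const, of 1]] by simp
  \<comment> \<open>Extension by zero, because the differentiation theorem used below concerns
    functions on the whole space.\<close>
  define h where "h = (\<lambda>x. indicator \<Omega> x *\<^sub>R g x)"
  have h_int: "integrable lebesgue h"
    unfolding h_def using g_int by (subst integrable_restrict_space[symmetric]) auto
  have box_zero: "integral (cbox a b) h = 0" if sub: "cbox a b \<subseteq> interior \<Omega>" for a b
  proof -
    obtain \<phi> :: "nat \<Rightarrow> real^'n \<Rightarrow> real" where \<phi>: "\<And>m. \<phi> m \<in> test_functions \<Omega>"
      "\<And>m x. \<bar>\<phi> m x\<bar> \<le> 1" "\<And>x. (\<lambda>m. \<phi> m x) \<longlonglongrightarrow> indicator (box a b) x"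
      using box_bumps[OF sub] by blast
    have box\<Omega>: "box a b \<subseteq> \<Omega>"
      using sub interior_subset box_subset_cbox by (metis order_trans)
    have m\<phi>: "(\<lambda>x. g x * \<phi> m x) \<in> borel_measurable (lebesgue_on \<Omega>)" for m
      using borel_measurable_integrable[OF L2_mult_integrable[OF g test_L2[OF \<phi>(1)]]] .
    have "(\<lambda>m. LINT x|lebesgue_on \<Omega>. g x * \<phi> m x) \<longlonglongrightarrow>
        (LINT x|lebesgue_on \<Omega>. g x * indicator (box a b) x)"
    proof (rule integral_dominated_convergence[where w = "\<lambda>x. \<bar>g x\<bar>"])
      show "integrable (lebesgue_on \<Omega>) (\<lambda>x. \<bar>g x\<bar>)" using g_int by simp
      show "AE x in lebesgue_on \<Omega>. (\<lambda>m. g x * \<phi> m x) \<longlonglongrightarrow> g x * indicator (box a b) x"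
        by (intro AE_I2 tendsto_mult tendsto_const \<phi>(3))
      show "AE x in lebesgue_on \<Omega>. norm (g x * \<phi> m x) \<le> \<bar>g x\<bar>" for m
        using \<phi>(2) by (intro AE_I2) (simp add: abs_mult mult_left_le)
      show "(\<lambda>x. g x * \<phi> m x) \<in> borel_measurable (lebesgue_on \<Omega>)" for m by (rule m\<phi>)
      show "(\<lambda>x. g x * indicator (box a b) x) \<in> borel_measurable (lebesgue_on \<Omega>)"
        by (rule borel_measurable_LIMSEQ_real[where u = "\<lambda>m x. g x * \<phi> m x"])
            (intro tendsto_mult tendsto_const \<phi>(3) m\<phi>)+
    qed
    then have "(LINT x|lebesgue_on \<Omega>. g x * indicator (box a b) x) = 0"
      using zero[OF \<phi>(1)] by (simp add: LIMSEQ_const_iff)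
    moreover have "(LINT x|lebesgue_on \<Omega>. g x * indicator (box a b) x) =
        (LINT x|lebesgue. indicator \<Omega> x *\<^sub>R (g x * indicator (box a b) x))"
      by (rule integral_restrict_space) simp
    moreover have "(\<lambda>x. indicator \<Omega> x *\<^sub>R (g x * indicator (box a b) x)) =
        (\<lambda>x. indicator (box a b) x *\<^sub>R h x)"
      using box\<Omega> by (auto simp: h_def fun_eq_iff indicator_def)
    ultimately have "set_lebesgue_integral lebesgue (box a b) h = 0"
      by (simp add: set_lebesgue_integral_def)
    moreover have "set_integrable lebesgue (box a b) h"
      unfolding set_integrable_def using h_int by (rule integrable_mult_indicator[rotated]) simp
    ultimately have "integral (box a b) h = 0"
      using set_lebesgue_integral_eq_integral(2) by metis
    then show ?thesis by (simp add: integral_open_interval)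
  qed
  have "h integrable_on cbox a b" for a b
  proof -
    have "set_integrable lebesgue (cbox a b) h"
      unfolding set_integrable_def using h_int by (rule integrable_mult_indicator[rotated]) simp
    then show ?thesis by (rule set_lebesgue_integral_eq_integral(1))
  qed
  then obtain N where N: "negligible N"
    "\<And>x e. x \<notin> N \<Longrightarrow> 0 < e \<Longrightarrow> \<exists>d>0. \<forall>t. 0 < t \<and> t < d \<longrightarrow>
        norm (integral (cbox x (x + t *\<^sub>R One)) h /\<^sub>R t ^ DIM(real^'n) - h x) < e"
    using integrable_ccontinuous_explicit[of h] by metis
  have "g x = 0" if x: "x \<in> interior \<Omega>" "x \<notin> N" for x
  proof (rule ccontr)
    assume "g x \<noteq> 0"
    then obtain d where d: "d > 0" "\<And>t. 0 < t \<Longrightarrow> t < d \<Longrightarrow>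
        norm (integral (cbox x (x + t *\<^sub>R One)) h /\<^sub>R t ^ DIM(real^'n) - h x) < \<bar>g x\<bar>"
      using N(2)[OF x(2), of "\<bar>g x\<bar>"] by auto
    obtain r where r: "r > 0" "cball x r \<subseteq> interior \<Omega>"
      using x(1) open_interior open_contains_cball by blast
    \<comment> \<open>Side length of a cube with lower corner \<open>x\<close>: below
      \<open>d\<close> for the differentiation theorem, and small enough for the cube to stay in the
      ball of radius \<open>r\<close>, since its points are within \<open>t * norm One\<close> of
      \<open>x\<close>.\<close>
    define t where "t = min (d / 2) (r / (norm (One :: real^'n) + 1))"
    have t: "0 < t" "t < d"
      using d(1) r(1) by (auto simp: t_def add_nonneg_pos)
    have "cbox x (x + t *\<^sub>R One) \<subseteq> cball x r"
    proof
      fix y assume "y \<in> cbox x (x + t *\<^sub>R One)"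
      then have "\<forall>i\<in>Basis. \<bar>(y - x) \<bullet> i\<bar> \<le> \<bar>(t *\<^sub>R (One :: real^'n)) \<bullet> i\<bar>"
        using t by (auto simp: mem_box inner_diff_left inner_add_left)
      then have "norm (y - x) \<le> norm (t *\<^sub>R (One :: real^'n))"
        by (intro norm_le_componentwise) auto
      also have "\<dots> = t * norm (One :: real^'n)" using t by simp
      also have "\<dots> \<le> t * (norm (One :: real^'n) + 1)" using t by simp
      also have "\<dots> \<le> r"
      proof -
        have "t \<le> r / (norm (One :: real^'n) + 1)" by (simp add: t_def)
        then show ?thesis by (simp add: pos_le_divide_eq add_nonneg_pos)
      qed
      finally show "y \<in> cball x r" by (simp add: dist_norm norm_minus_commute)
    qed
    then have "integral (cbox x (x + t *\<^sub>R One)) h = 0"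
      using r(2) by (intro box_zero) auto
    moreover have "h x = g x" using x(1) interior_subset[of \<Omega>] by (auto simp: h_def)
    ultimately show False using d(2)[OF t] by simp
  qed
  then have "{x \<in> \<Omega>. g x \<noteq> 0} \<subseteq> N \<union> (\<Omega> - interior \<Omega>)" by blast
  then have "negligible {x \<in> \<Omega>. g x \<noteq> 0}"
    using N(1) null_boundary negligible_subset negligible_Un by metis
  then have "AE x in lebesgue. x \<in> \<Omega> \<longrightarrow> g x = 0"
    by (intro AE_I'[of "{x \<in> \<Omega>. g x \<noteq> 0}"]) (auto simp: negligible_iff_null_sets)
  then show ?thesis by (subst AE_restrict_space_iff) auto
qed

text \<open>Makes the choice in \<open>partial_deriv\<close> immaterial for every integral.\<close>

lemma weak_partial_unique:
  assumes "weak_partial \<Omega> j u g" "weak_partial \<Omega> j u g'"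
  shows "AE x in lebesgue_on \<Omega>. g x = g' x"
proof -
  have g: "g \<in> L2 \<Omega>" "g' \<in> L2 \<Omega>" using assms by (auto simp: weak_partial_def)
  have "AE x in lebesgue_on \<Omega>. g x + (-1) * g' x = 0"
  proof (rule fundamental_lemma)
    show "(\<lambda>x. g x + (-1) * g' x) \<in> L2 \<Omega>" using g by (rule L2_lincomb)
    fix \<phi> assume \<phi>: "\<phi> \<in> test_functions \<Omega>"
    have "(LINT x|lebesgue_on \<Omega>. g x * \<phi> x) = (LINT x|lebesgue_on \<Omega>. g' x * \<phi> x)"
    proof -
      have "- (LINT x|lebesgue_on \<Omega>. g x * \<phi> x) = - (LINT x|lebesgue_on \<Omega>. g' x * \<phi> x)"
        using assms \<phi> unfolding weak_partial_def by (blast intro: trans sym)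
      then show ?thesis by simp
    qed
    then show "(LINT x|lebesgue_on \<Omega>. (g x + (-1) * g' x) * \<phi> x) = 0"
      using L2_inner_lin[OF g test_L2[OF \<phi>], of "-1"] unfolding L2_inner_def by simp
  qed
  then show ?thesis by eventually_elim simp
qed

lemma weak_partial_lincomb:
  assumes u: "u \<in> L2 \<Omega>" "weak_partial \<Omega> j u g" and v: "v \<in> L2 \<Omega>" "weak_partial \<Omega> j v h"
  shows "weak_partial \<Omega> j (\<lambda>x. u x + c * v x) (\<lambda>x. g x + c * h x)"
  unfolding weak_partial_def
proof (intro conjI ballI)
  have gh: "g \<in> L2 \<Omega>" "h \<in> L2 \<Omega>" using u v by (auto simp: weak_partial_def)
  then show "(\<lambda>x. g x + c * h x) \<in> L2 \<Omega>" by (rule L2_lincomb)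
  fix \<phi> assume \<phi>: "\<phi> \<in> test_functions \<Omega>"
  obtain G where "\<And>x. GDERIV \<phi> x :> G x" and G: "\<And>j. continuous_on UNIV (\<lambda>x. G x $ j)"
    "\<And>x j. frechet_derivative \<phi> (at x) (axis j 1) = G x $ j"
    by (rule test_gradient[OF \<phi>]) (rule that)
  have d: "(\<lambda>x. G x $ j) \<in> L2 \<Omega>"
    using continuous_on_subset[OF G(1)] by (intro continuous_L2) auto
  have "L2_inner \<Omega> u (\<lambda>x. G x $ j) = - L2_inner \<Omega> g \<phi>" "L2_inner \<Omega> v (\<lambda>x. G x $ j) = - L2_inner \<Omega> h \<phi>"
  proof -
    show "L2_inner \<Omega> u (\<lambda>x. G x $ j) = - L2_inner \<Omega> g \<phi>"
      using u(2) \<phi> unfolding weak_partial_def L2_inner_def G(2)[symmetric] by blast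
    show "L2_inner \<Omega> v (\<lambda>x. G x $ j) = - L2_inner \<Omega> h \<phi>"
      using v(2) \<phi> unfolding weak_partial_def L2_inner_def G(2)[symmetric] by blast
  qed
  then have "L2_inner \<Omega> (\<lambda>x. u x + c * v x) (\<lambda>x. G x $ j) = - L2_inner \<Omega> (\<lambda>x. g x + c * h x) \<phi>"
    using u(1) v(1) gh test_L2[OF \<phi>] d by (simp add: L2_inner_lin)
  then show "(LINT x|lebesgue_on \<Omega>. (u x + c * v x) * frechet_derivative \<phi> (at x) (axis j 1)) =
      - (LINT x|lebesgue_on \<Omega>. (g x + c * h x) * \<phi> x)"
    unfolding L2_inner_def G(2) .
qed

lemma H1_L2: "u \<in> H1 \<Omega> \<Longrightarrow> u \<in> L2 \<Omega>"
  by (simp add: H1_def)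

lemma H1_partial: "u \<in> H1 \<Omega> \<Longrightarrow> weak_partial \<Omega> j u (partial_deriv \<Omega> j u)"
  using someI_ex[of "weak_partial \<Omega> j u"] unfolding H1_def partial_deriv_def by simp

lemma partial_L2: "u \<in> H1 \<Omega> \<Longrightarrow> partial_deriv \<Omega> j u \<in> L2 \<Omega>"
  using H1_partial by (auto simp: weak_partial_def)

lemma H1_lincomb: "u \<in> H1 \<Omega> \<Longrightarrow> v \<in> H1 \<Omega> \<Longrightarrow> (\<lambda>x. u x + c * v x) \<in> H1 \<Omega>"
  using weak_partial_lincomb[OF H1_L2 H1_partial H1_L2 H1_partial] L2_lincomb[OF H1_L2 H1_L2]
  unfolding H1_def[of \<Omega>] by blast

text \<open>The chosen representatives need not combine pointwise, but both sides are weak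
  derivatives of the same function.\<close>

lemma partial_deriv_lincomb:
  assumes "u \<in> H1 \<Omega>" "v \<in> H1 \<Omega>"
  shows "AE x in lebesgue_on \<Omega>. partial_deriv \<Omega> j (\<lambda>x. u x + c * v x) x =
    partial_deriv \<Omega> j u x + c * partial_deriv \<Omega> j v x"
  using assms by (intro weak_partial_unique[of j "\<lambda>x. u x + c * v x"] H1_partial H1_lincomb
      weak_partial_lincomb H1_L2)

lemma L2_inner_partial_lincomb:
  assumes "u \<in> H1 \<Omega>" "v \<in> H1 \<Omega>" "w \<in> L2 \<Omega>"
  shows "L2_inner \<Omega> (partial_deriv \<Omega> j (\<lambda>x. u x + c * v x)) w =
    L2_inner \<Omega> (partial_deriv \<Omega> j u) w + c * L2_inner \<Omega> (partial_deriv \<Omega> j v) w"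
proof -
  have "L2_inner \<Omega> (partial_deriv \<Omega> j (\<lambda>x. u x + c * v x)) w =
      L2_inner \<Omega> (\<lambda>x. partial_deriv \<Omega> j u x + c * partial_deriv \<Omega> j v x) w"
    unfolding L2_inner_def
  proof (rule integral_cong_AE)
    show "AE x in lebesgue_on \<Omega>. partial_deriv \<Omega> j (\<lambda>x. u x + c * v x) x * w x =
        (partial_deriv \<Omega> j u x + c * partial_deriv \<Omega> j v x) * w x"
      using partial_deriv_lincomb[OF assms(1,2)] by (rule AE_mp) (auto intro!: AE_I2)
  qed (use assms in \<open>auto intro!: borel_measurable_integrable[OF L2_mult_integrable]
    partial_L2 H1_lincomb L2_lincomb\<close>)
  then show ?thesis
    using assms by (simp add: L2_inner_lin partial_L2)
qed

end

section \<open>Test functions and linear combinations in \<open>H10\<close>\<close>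

context null_boundary_domain
begin

lemma test_lincomb:
  assumes "\<phi> \<in> test_functions \<Omega>" "\<psi> \<in> test_functions \<Omega>"
  shows "(\<lambda>x. \<phi> x + c * \<psi> x) \<in> test_functions \<Omega>"
proof -
  have "closure {x. \<phi> x + c * \<psi> x \<noteq> 0} \<subseteq> closure ({x. \<phi> x \<noteq> 0} \<union> {x. \<psi> x \<noteq> 0})"
    by (intro closure_mono) auto
  moreover have "compact (closure {x. \<phi> x + c * \<psi> x \<noteq> 0})"
  proof -
    have "bounded ({x. \<phi> x \<noteq> 0} \<union> {x. \<psi> x \<noteq> 0})"
      using assms by (auto simp: test_functions_def)
    then have "bounded {x. \<phi> x + c * \<psi> x \<noteq> 0}"
      by (rule bounded_subset) auto
    then show ?thesis by simp
  qed
  ultimately show ?thesis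
    using assms by (auto simp: test_functions_def closure_Un intro!: C_k_add C_k_cmult)
qed

lemma test_mult:
  assumes "\<phi> \<in> test_functions \<Omega>" "\<psi> \<in> test_functions \<Omega>"
  shows "(\<lambda>x. \<phi> x * \<psi> x) \<in> test_functions \<Omega>"
proof -
  have "closure {x. \<phi> x * \<psi> x \<noteq> 0} \<subseteq> closure {x. \<phi> x \<noteq> 0}"
    by (intro closure_mono) auto
  moreover have "compact (closure {x. \<phi> x * \<psi> x \<noteq> 0})"
    using assms bounded_subset[of "{x. \<phi> x \<noteq> 0}" "{x. \<phi> x * \<psi> x \<noteq> 0}"]
    by (auto simp: test_functions_def)
  ultimately show ?thesis
    using assms by (auto simp: test_functions_def intro!: C_k_mult)
qed

lemma test_zero: "(\<lambda>x. 0) \<in> test_functions \<Omega>"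
  by (auto simp: test_functions_def C_k_const)

text \<open>Difference quotients integrate to zero by translation invariance.\<close>

lemma integral_partial_test:
  assumes f: "f \<in> test_functions \<Omega>" and G: "\<And>x. GDERIV f x :> G x"
    and cont: "\<And>j. continuous_on UNIV (\<lambda>x. G x $ j)"
  shows "(LINT x|lebesgue_on \<Omega>. G x $ j) = 0"
proof -
  define K where "K = closure {x. f x \<noteq> 0}"
  have K: "compact K" "K \<subseteq> \<Omega>"
    using f interior_subset[of \<Omega>] by (auto simp: test_functions_def K_def)
  have f0: "f x = 0" if "x \<notin> K" for x
    using that closure_subset[of "{x. f x \<noteq> 0}"] by (auto simp: K_def)
  have fcont: "continuous_on S f" for S
    using f by (rule test_continuous)
  have G0: "G x = 0" if "x \<notin> K" for x
  proof -
    have "open (- K)" using K(1) by (intro open_Compl compact_imp_closed)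
    have "((\<lambda>x. 0) has_derivative (\<lambda>h. 0)) (at x)" by simp
    then have "(f has_derivative (\<lambda>h. 0)) (at x)"
      by (rule has_derivative_transform_within_open[OF _ \<open>open (- K)\<close>]) (use that f0 in auto)
    then have "(\<lambda>h. 0) = (\<lambda>h. h \<bullet> G x)"
      using G[of x] unfolding gderiv_def by (rule has_derivative_unique)
    from fun_cong[OF this, of "G x"] show ?thesis by simp
  qed
  obtain B where B: "0 \<le> B" "\<And>x. \<bar>G x $ j\<bar> \<le> B"
  proof -
    have "compact ((\<lambda>x. G x $ j) ` K)"
      using continuous_on_subset[OF cont] K(1) by (intro compact_continuous_image) auto
    then obtain b where b: "\<And>x. x \<in> K \<Longrightarrow> \<bar>G x $ j\<bar> \<le> b"
      using compact_imp_bounded[of "(\<lambda>x. G x $ j) ` K"] by (auto simp: bounded_iff)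
    show thesis
    proof (rule that[of "max b 0"])
      show "\<bar>G x $ j\<bar> \<le> max b 0" for x
        using b[of x] G0[of x] by (cases "x \<in> K") auto
    qed simp
  qed
  obtain R where R: "\<And>x. x \<in> K \<Longrightarrow> norm x \<le> R"
    using compact_imp_bounded[OF K(1)] by (auto simp: bounded_iff)
  define t where "t = (\<lambda>n. 1 / real (Suc n))"
  have t: "0 < t n" "t n \<le> 1" for n by (auto simp: t_def)
  define e :: "real^'n" where "e = axis j 1"
  define q where "q = (\<lambda>n x. (f (t n *\<^sub>R e + x) - f x) / t n)"
  have der: "((\<lambda>s. f (s *\<^sub>R e + x)) has_field_derivative G (s *\<^sub>R e + x) $ j) (at s)" for s x
  proof -
    have "((\<lambda>s. s *\<^sub>R e + x) has_derivative (\<lambda>h. h *\<^sub>R e)) (at s)"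
      by (auto intro!: derivative_eq_intros)
    then have "((\<lambda>s. f (s *\<^sub>R e + x)) has_derivative (\<lambda>h. (h *\<^sub>R e) \<bullet> G (s *\<^sub>R e + x))) (at s)"
      by (rule has_derivative_compose) (rule G[unfolded gderiv_def])
    moreover have "(\<lambda>h. (h *\<^sub>R e) \<bullet> G (s *\<^sub>R e + x)) = (*) (G (s *\<^sub>R e + x) $ j)"
      by (simp add: fun_eq_iff e_def inner_axis' mult.commute)
    ultimately show ?thesis by (simp add: has_field_derivative_def)
  qed
  have q_lim: "(\<lambda>n. q n x) \<longlonglongrightarrow> G x $ j" for x
  proof -
    have "(\<lambda>h. (f ((0 + h) *\<^sub>R e + x) - f (0 *\<^sub>R e + x)) / h) \<midarrow>0\<rightarrow> G x $ j"
      using der[of x 0] unfolding DERIV_def by simp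
    moreover have "filterlim t (at 0) sequentially"
      unfolding filterlim_at t_def using LIMSEQ_inverse_real_of_nat
      by (auto simp: inverse_eq_divide)
    ultimately show ?thesis
      unfolding q_def using filterlim_compose by fastforce
  qed
  \<comment> \<open>An integrable majorant: shifts have length at most 1, so every quotient vanishes
    outside the ball of radius \<open>R + 1\<close>, and inside it the mean value theorem gives the
    bound \<open>B\<close> of the derivative.\<close>
  have q_le: "\<bar>q n x\<bar> \<le> B * indicator (cball 0 (R + 1)) x" for n x
  proof (cases "x \<in> cball 0 (R + 1)")
    case True
    obtain s where "f (t n *\<^sub>R e + x) - f (0 *\<^sub>R e + x) = (t n - 0) * G (s *\<^sub>R e + x) $ j"
      using MVT2[of 0 "t n" "\<lambda>s. f (s *\<^sub>R e + x)" "\<lambda>s. G (s *\<^sub>R e + x) $ j"] t der by auto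
    then have "q n x = G (s *\<^sub>R e + x) $ j"
      unfolding q_def using t[of n] by simp
    then show ?thesis using True B by simp
  next
    case False
    then have "norm x > R + 1" by simp
    moreover have "norm (t n *\<^sub>R e + x) \<ge> norm x - 1"
      using norm_triangle_ineq2[of x "- (t n *\<^sub>R e)"] t[of n] by (simp add: e_def add.commute)
    ultimately have "x \<notin> K" "t n *\<^sub>R e + x \<notin> K" using R by fastforce+
    then show ?thesis using f0 False by (simp add: q_def)
  qed
  have f_int: "integrable lborel f"
  proof -
    have "integrable lborel (\<lambda>x. indicator K x *\<^sub>R f x)"
      using K(1) fcont by (rule borel_integrable_compact)
    moreover have "(\<lambda>x. indicator K x *\<^sub>R f x) = f"
      using f0 by (auto simp: fun_eq_iff indicator_def)
    ultimately show ?thesis by simp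
  qed
  have [measurable]: "f \<in> borel_measurable borel" "(\<lambda>x. G x $ j) \<in> borel_measurable borel"
    using fcont cont by (auto intro: borel_measurable_continuous_onI)
  have shift: "integrable lborel (\<lambda>x. f (c + x))" "(LINT x|lborel. f (c + x)) = (LINT x|lborel. f x)" for c
  proof -
    show "integrable lborel (\<lambda>x. f (c + x))"
      using f_int by (subst (asm) lborel_distr_plus[of c, symmetric])
        (auto simp: integrable_distr_eq)
    show "(LINT x|lborel. f (c + x)) = (LINT x|lborel. f x)"
      by (subst (2) lborel_distr_plus[of c, symmetric]) (auto simp: integral_distr)
  qed
  have "(\<lambda>n. LINT x|lborel. q n x) \<longlonglongrightarrow> (LINT x|lborel. G x $ j)"
  proof (rule integral_dominated_convergence[where w = "\<lambda>x. B * indicator (cball 0 (R + 1)) x"])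
    show "integrable lborel (\<lambda>x::real^'n. B * indicator (cball 0 (R + 1)) x)"
      by (intro integrable_mult_right integrable_real_indicator) (auto intro: emeasure_lborel_cball_finite[unfolded infinity_ennreal_def])
    show "q n \<in> borel_measurable lborel" for n
      unfolding q_def by measurable
  qed (use q_lim q_le in auto)
  moreover have "(LINT x|lborel. q n x) = 0" for n
    unfolding q_def using shift f_int by (simp add: Bochner_Integration.integral_diff)
  ultimately have "(LINT x|lborel. G x $ j) = 0"
    by (simp add: LIMSEQ_const_iff)
  moreover have "(LINT x|lebesgue_on \<Omega>. G x $ j) = (LINT x|lebesgue. indicator \<Omega> x *\<^sub>R (G x $ j))"
    by (rule integral_restrict_space) simp
  moreover have "(\<lambda>x. indicator \<Omega> x *\<^sub>R (G x $ j)) = (\<lambda>x. G x $ j)"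
  proof
    fix x
    show "indicator \<Omega> x *\<^sub>R (G x $ j) = G x $ j"
      using G0[of x] K(2) by (cases "x \<in> K") auto
  qed
  moreover have "(LINT x|lebesgue. G x $ j) = (LINT x|lborel. G x $ j)"
    by (rule integral_completion) simp
  ultimately show ?thesis by simp
qed

text \<open>Integration by parts: the product with a second test function is again a test function,
  so its partial derivative integrates to zero.\<close>

lemma weak_partial_test:
  assumes \<phi>: "\<phi> \<in> test_functions \<Omega>" and G: "\<And>x. GDERIV \<phi> x :> G x"
    "\<And>j. continuous_on UNIV (\<lambda>x. G x $ j)"
  shows "weak_partial \<Omega> j \<phi> (\<lambda>x. G x $ j)"
  unfolding weak_partial_def
proof (intro conjI ballI)
  show GL: "(\<lambda>x. G x $ j) \<in> L2 \<Omega>"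
    using continuous_on_subset[OF G(2)] by (intro continuous_L2) auto
  fix \<psi> assume \<psi>: "\<psi> \<in> test_functions \<Omega>"
  obtain H where H: "\<And>x. GDERIV \<psi> x :> H x" "\<And>j. continuous_on UNIV (\<lambda>x. H x $ j)"
    "\<And>x j. frechet_derivative \<psi> (at x) (axis j 1) = H x $ j"
    by (rule test_gradient[OF \<psi>]) (rule that)
  have HL: "(\<lambda>x. H x $ j) \<in> L2 \<Omega>"
    using continuous_on_subset[OF H(2)] by (intro continuous_L2) auto
  have "(LINT x|lebesgue_on \<Omega>. (\<phi> x *\<^sub>R H x + \<psi> x *\<^sub>R G x) $ j) = 0"
  proof (rule integral_partial_test)
    show "(\<lambda>x. \<phi> x * \<psi> x) \<in> test_functions \<Omega>" using \<phi> \<psi> by (rule test_mult)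
    show "GDERIV (\<lambda>x. \<phi> x * \<psi> x) x :> \<phi> x *\<^sub>R H x + \<psi> x *\<^sub>R G x" for x
      using G(1) H(1) by (rule GDERIV_mult)
    show "continuous_on UNIV (\<lambda>x. (\<phi> x *\<^sub>R H x + \<psi> x *\<^sub>R G x) $ i)" for i
      using G(2) H(2) test_continuous[OF \<phi>] test_continuous[OF \<psi>]
      unfolding vector_add_component vector_scaleR_component
      by (intro continuous_on_add continuous_on_scaleR)
  qed
  moreover have "(LINT x|lebesgue_on \<Omega>. (\<phi> x *\<^sub>R H x + \<psi> x *\<^sub>R G x) $ j) =
      (LINT x|lebesgue_on \<Omega>. \<phi> x * H x $ j) + (LINT x|lebesgue_on \<Omega>. G x $ j * \<psi> x)"
    using L2_mult_integrable[OF test_L2[OF \<phi>] HL] L2_mult_integrable[OF GL test_L2[OF \<psi>]]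
    by (simp add: mult.commute)
  ultimately show "(LINT x|lebesgue_on \<Omega>. \<phi> x * frechet_derivative \<psi> (at x) (axis j 1)) =
      - (LINT x|lebesgue_on \<Omega>. G x $ j * \<psi> x)"
    unfolding H(3) by linarith
qed

text \<open>Brings the differences \<open>u - \<phi> m\<close> of an approximating sequence into
  \<open>H1\<close>, where \<open>H1_norm\<close> can be estimated.\<close>

lemma test_H1:
  assumes \<phi>: "\<phi> \<in> test_functions \<Omega>"
  shows "\<phi> \<in> H1 \<Omega>"
proof -
  obtain G where "\<And>x. GDERIV \<phi> x :> G x" "\<And>j. continuous_on UNIV (\<lambda>x. G x $ j)"
    "\<And>x j. frechet_derivative \<phi> (at x) (axis j 1) = G x $ j"
    by (rule test_gradient[OF \<phi>]) (rule that)
  then have "weak_partial \<Omega> j \<phi> (\<lambda>x. G x $ j)" for j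
    using \<phi> by (intro weak_partial_test)
  then show ?thesis
    using test_L2[OF \<phi>] unfolding H1_def by blast
qed

lemma H1_norm_square:
  "(H1_norm \<Omega> u)\<^sup>2 = L2_inner \<Omega> u u +
    (\<Sum>j\<in>UNIV. L2_inner \<Omega> (partial_deriv \<Omega> j u) (partial_deriv \<Omega> j u))"
  unfolding H1_norm_def
  by (intro real_sqrt_pow2 add_nonneg_nonneg sum_nonneg L2_inner_nonneg)

text \<open>The parallelogram law with the square of \<open>u - c v\<close> dropped. The left side
  is the square of \<open>u + c v\<close> in expanded form, so that it also fits
  \<open>partial_deriv\<close> of a combination, which splits only inside inner products.\<close>

lemma L2_inner_lincomb_le:
  assumes "u \<in> L2 \<Omega>" "v \<in> L2 \<Omega>"
  shows "L2_inner \<Omega> u u + c * L2_inner \<Omega> v u + c * (L2_inner \<Omega> u v + c * L2_inner \<Omega> v v) \<le>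
    2 * L2_inner \<Omega> u u + 2 * c\<^sup>2 * L2_inner \<Omega> v v"
proof -
  let ?d = "\<lambda>x. u x + (- c) * v x"
  have d: "?d \<in> L2 \<Omega>" using assms by (rule L2_lincomb)
  have "0 \<le> L2_inner \<Omega> ?d ?d" by (rule L2_inner_nonneg)
  also have "\<dots> = L2_inner \<Omega> ?d u + (- c) * L2_inner \<Omega> ?d v"
    using L2_inner_lin[OF assms d, of "- c"] by (simp only: L2_inner_sym[of \<Omega> u ?d] L2_inner_sym[of \<Omega> v ?d])
  also have "\<dots> = L2_inner \<Omega> u u - c * L2_inner \<Omega> v u - c * (L2_inner \<Omega> u v - c * L2_inner \<Omega> v v)"
    using L2_inner_lin[OF assms assms(1), of "- c"] L2_inner_lin[OF assms assms(2), of "- c"] by simp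
  finally show ?thesis by (simp add: power2_eq_square algebra_simps)
qed

lemma H1_norm_lincomb:
  assumes u: "u \<in> H1 \<Omega>" and v: "v \<in> H1 \<Omega>"
  shows "(H1_norm \<Omega> (\<lambda>x. u x + c * v x))\<^sup>2 \<le> 2 * (H1_norm \<Omega> u)\<^sup>2 + 2 * c\<^sup>2 * (H1_norm \<Omega> v)\<^sup>2"
proof -
  let ?w = "\<lambda>x. u x + c * v x"
  have w: "?w \<in> H1 \<Omega>" using u v by (rule H1_lincomb)
  have "L2_inner \<Omega> ?w ?w = L2_inner \<Omega> u u + c * L2_inner \<Omega> v u + c * (L2_inner \<Omega> u v + c * L2_inner \<Omega> v v)"
  proof -
    have m: "u \<in> L2 \<Omega>" "v \<in> L2 \<Omega>" "?w \<in> L2 \<Omega>" using u v w H1_L2 by auto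
    have "L2_inner \<Omega> ?w ?w = L2_inner \<Omega> u ?w + c * L2_inner \<Omega> v ?w"
      by (rule L2_inner_lin[OF m])
    also have "L2_inner \<Omega> u ?w = L2_inner \<Omega> u u + c * L2_inner \<Omega> v u"
      unfolding L2_inner_sym[of \<Omega> u ?w] by (rule L2_inner_lin[OF m(1,2,1)])
    also have "L2_inner \<Omega> v ?w = L2_inner \<Omega> u v + c * L2_inner \<Omega> v v"
      unfolding L2_inner_sym[of \<Omega> v ?w] by (rule L2_inner_lin[OF m(1,2,2)])
    finally show ?thesis .
  qed
  then have 1: "L2_inner \<Omega> ?w ?w \<le> 2 * L2_inner \<Omega> u u + 2 * c\<^sup>2 * L2_inner \<Omega> v v"
    using L2_inner_lincomb_le[OF H1_L2[OF u] H1_L2[OF v], of c] by linarith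
  have 2: "L2_inner \<Omega> (partial_deriv \<Omega> j ?w) (partial_deriv \<Omega> j ?w) \<le>
      2 * L2_inner \<Omega> (partial_deriv \<Omega> j u) (partial_deriv \<Omega> j u) +
      2 * c\<^sup>2 * L2_inner \<Omega> (partial_deriv \<Omega> j v) (partial_deriv \<Omega> j v)" for j
  proof -
    let ?u = "partial_deriv \<Omega> j u" and ?v = "partial_deriv \<Omega> j v" and ?w' = "partial_deriv \<Omega> j ?w"
    have m: "?u \<in> L2 \<Omega>" "?v \<in> L2 \<Omega>" "?w' \<in> L2 \<Omega>" using u v w partial_L2 by auto
    have "L2_inner \<Omega> ?w' ?w' = L2_inner \<Omega> ?u ?w' + c * L2_inner \<Omega> ?v ?w'"
      by (rule L2_inner_partial_lincomb[OF u v m(3)])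
    also have "L2_inner \<Omega> ?u ?w' = L2_inner \<Omega> ?u ?u + c * L2_inner \<Omega> ?v ?u"
      unfolding L2_inner_sym[of \<Omega> ?u ?w'] by (rule L2_inner_partial_lincomb[OF u v m(1)])
    also have "L2_inner \<Omega> ?v ?w' = L2_inner \<Omega> ?u ?v + c * L2_inner \<Omega> ?v ?v"
      unfolding L2_inner_sym[of \<Omega> ?v ?w'] by (rule L2_inner_partial_lincomb[OF u v m(2)])
    also have "L2_inner \<Omega> ?u ?u + c * L2_inner \<Omega> ?v ?u + c * (L2_inner \<Omega> ?u ?v + c * L2_inner \<Omega> ?v ?v) \<le>
        2 * L2_inner \<Omega> ?u ?u + 2 * c\<^sup>2 * L2_inner \<Omega> ?v ?v"
      by (rule L2_inner_lincomb_le[OF m(1,2)])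
    finally show ?thesis .
  qed
  have "(H1_norm \<Omega> ?w)\<^sup>2 \<le> (2 * L2_inner \<Omega> u u + 2 * c\<^sup>2 * L2_inner \<Omega> v v) +
      (\<Sum>j\<in>UNIV. 2 * L2_inner \<Omega> (partial_deriv \<Omega> j u) (partial_deriv \<Omega> j u) +
        2 * c\<^sup>2 * L2_inner \<Omega> (partial_deriv \<Omega> j v) (partial_deriv \<Omega> j v))"
    unfolding H1_norm_square by (intro add_mono 1 sum_mono 2)
  also have "\<dots> = 2 * (H1_norm \<Omega> u)\<^sup>2 + 2 * c\<^sup>2 * (H1_norm \<Omega> v)\<^sup>2"
    unfolding H1_norm_square by (simp add: sum.distrib sum_distrib_left algebra_simps)
  finally show ?thesis .
qed

text \<open>The same combination of the approximants converges: \<open>H1_norm_lincomb\<close>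
  squeezes the squared norms to zero, and a square root returns to the norms.\<close>

lemma H10_lincomb:
  assumes u: "u \<in> H10 \<Omega>" and v: "v \<in> H10 \<Omega>"
  shows "(\<lambda>x. u x + c * v x) \<in> H10 \<Omega>"
proof -
  obtain \<phi> :: "nat \<Rightarrow> real^'n \<Rightarrow> real" where \<phi>: "\<forall>m. \<phi> m \<in> test_functions \<Omega>"
    "(\<lambda>m. H1_norm \<Omega> (\<lambda>x. u x - \<phi> m x)) \<longlonglongrightarrow> 0"
    using u unfolding H10_def by blast
  obtain \<psi> :: "nat \<Rightarrow> real^'n \<Rightarrow> real" where \<psi>: "\<forall>m. \<psi> m \<in> test_functions \<Omega>"
    "(\<lambda>m. H1_norm \<Omega> (\<lambda>x. v x - \<psi> m x)) \<longlonglongrightarrow> 0"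
    using v unfolding H10_def by blast
  note t = \<phi>(1)[rule_format] \<psi>(1)[rule_format] and lim = \<phi>(2) \<psi>(2)
  have H1: "u \<in> H1 \<Omega>" "v \<in> H1 \<Omega>" using u v unfolding H10_def by blast+
  let ?d = "\<lambda>m x. (u x + c * v x) - (\<phi> m x + c * \<psi> m x)"
  have le: "(H1_norm \<Omega> (?d m))\<^sup>2 \<le> 2 * (H1_norm \<Omega> (\<lambda>x. u x - \<phi> m x))\<^sup>2 +
      2 * c\<^sup>2 * (H1_norm \<Omega> (\<lambda>x. v x - \<psi> m x))\<^sup>2" for m
  proof -
    have d: "(\<lambda>x. u x - \<phi> m x) \<in> H1 \<Omega>" "(\<lambda>x. v x - \<psi> m x) \<in> H1 \<Omega>"
      using H1_lincomb[OF H1(1) test_H1[OF t(1)], of "-1"] H1_lincomb[OF H1(2) test_H1[OF t(2)], of "-1"]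
      by auto
    have "(\<lambda>x. (u x - \<phi> m x) + c * (v x - \<psi> m x)) = ?d m"
      by (simp add: fun_eq_iff algebra_simps)
    then show ?thesis
      using H1_norm_lincomb[OF d, of c] by simp
  qed
  have "(\<lambda>m. (H1_norm \<Omega> (?d m))\<^sup>2) \<longlonglongrightarrow> 0"
  proof (rule tendsto_sandwich[OF _ _ tendsto_const])
    show "(\<lambda>m. 2 * (H1_norm \<Omega> (\<lambda>x. u x - \<phi> m x))\<^sup>2 + 2 * c\<^sup>2 * (H1_norm \<Omega> (\<lambda>x. v x - \<psi> m x))\<^sup>2) \<longlonglongrightarrow> 0"
      using tendsto_add[OF tendsto_mult[OF tendsto_const[of 2] tendsto_power[OF lim(1), of 2]]
          tendsto_mult[OF tendsto_const[of "2 * c\<^sup>2"] tendsto_power[OF lim(2), of 2]]] by simp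
  qed (use le in auto)
  then have "(\<lambda>m. sqrt ((H1_norm \<Omega> (?d m))\<^sup>2)) \<longlonglongrightarrow> sqrt 0" by (rule tendsto_real_sqrt)
  then have "(\<lambda>m. \<bar>H1_norm \<Omega> (?d m)\<bar>) \<longlonglongrightarrow> 0" by simp
  then have "(\<lambda>m. H1_norm \<Omega> (?d m)) \<longlonglongrightarrow> 0" by (simp only: tendsto_rabs_zero_iff)
  moreover have "(\<lambda>x. \<phi> m x + c * \<psi> m x) \<in> test_functions \<Omega>" for m
    using t by (rule test_lincomb)
  ultimately have "\<exists>\<eta>::nat \<Rightarrow> real^'n \<Rightarrow> real. (\<forall>m. \<eta> m \<in> test_functions \<Omega>) \<and>
      (\<lambda>m. H1_norm \<Omega> (\<lambda>x. (u x + c * v x) - \<eta> m x)) \<longlonglongrightarrow> 0"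
    by (intro exI[of _ "\<lambda>m x. \<phi> m x + c * \<psi> m x"] conjI allI)
  then show ?thesis
    unfolding H10_def using H1_lincomb[OF H1, of c] by simp
qed

lemma H10_zero: "(\<lambda>x. 0) \<in> H10 \<Omega>"
proof -
  have z: "(\<lambda>x. 0) \<in> H1 \<Omega>" using test_zero by (rule test_H1)
  have "L2_inner \<Omega> (partial_deriv \<Omega> j (\<lambda>x. 0)) (partial_deriv \<Omega> j (\<lambda>x. 0)) = 0" for j
    using L2_inner_partial_lincomb[OF z z partial_L2[OF z], where j = j and c = 1] by simp
  then have "H1_norm \<Omega> (\<lambda>x. 0) = 0" by (simp add: H1_norm_def L2_inner_def)
  then show ?thesis
    using z test_zero unfolding H10_def by (intro CollectI conjI exI[of _ "\<lambda>m x. 0"]) auto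
qed

text \<open>A nonempty open set is not negligible, so a continuous function that is zero almost
  everywhere vanishes on the interior; continuity carries this to the closure of the interior, which
  contains \<open>\<Omega>\<close>.\<close>

lemma L2_inner_definite:
  assumes dense: "\<Omega> \<subseteq> closure (interior \<Omega>)"
    and v: "v \<in> L2 \<Omega>" "continuous_on \<Omega> v" "L2_inner \<Omega> v v = 0" and x: "x \<in> \<Omega>"
  shows "v x = 0"
proof -
  have "AE x in lebesgue_on \<Omega>. v x * v x = 0"
    using v(3) L2_mult_integrable[OF v(1) v(1)] unfolding L2_inner_def
    by (subst (asm) integral_nonneg_eq_0_iff_AE) auto
  then have "AE x in lebesgue. x \<in> \<Omega> \<longrightarrow> v x = 0"
    by (subst (asm) AE_restrict_space_iff) auto
  then obtain N where N: "\<And>x. x \<in> space lebesgue - N \<Longrightarrow> x \<in> \<Omega> \<longrightarrow> v x = 0" "N \<in> null_sets lebesgue"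
    by (rule AE_E3) (rule that)
  let ?U = "interior \<Omega> \<inter> v -` (- {0})"
  have "open ?U"
    using continuous_on_subset[OF v(2) interior_subset] by (intro continuous_open_preimage) auto
  moreover have "negligible ?U"
  proof (rule negligible_subset)
    show "negligible N" using N(2) by (simp add: negligible_iff_null_sets)
    show "?U \<subseteq> N" using N(1) interior_subset[of \<Omega>] by auto
  qed
  ultimately have "?U = {}" using open_not_negligible by blast
  then have 0: "v y = 0" if "y \<in> interior \<Omega>" for y using that by auto
  have "closed \<Omega>" using compact by (rule compact_imp_closed)
  then have "closed {y \<in> \<Omega>. v y = 0}" using v(2) by (rule continuous_closed_preimage_constant[rotated])
  then have "closure (interior \<Omega>) \<subseteq> {y \<in> \<Omega>. v y = 0}"
    using 0 interior_subset[of \<Omega>] by (intro closure_minimal) auto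
  then show ?thesis using dense x by auto
qed

end

section \<open>Symmetry and bilinearity of the energy form\<close>

lemma aform_eq:
  "aform D u v = (\<Sum>i\<in>UNIV. \<Sum>j\<in>UNIV. coeff D $ i $ j *
    L2_inner (subdomain D 0) (partial_deriv (subdomain D 0) j u) (partial_deriv (subdomain D 0) i v))"
  unfolding aform_def L2_inner_def by (simp add: mult.assoc)

lemma aform_sym:
  assumes "transpose (coeff D) = coeff D"
  shows "aform D u v = aform D v u"
proof -
  have c: "coeff D $ i $ j = coeff D $ j $ i" for i j
    by (subst assms[symmetric]) (simp add: transpose_def)
  have "aform D v u = (\<Sum>i\<in>UNIV. \<Sum>j\<in>UNIV. coeff D $ j $ i *
      L2_inner (subdomain D 0) (partial_deriv (subdomain D 0) i v) (partial_deriv (subdomain D 0) j u))"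
    unfolding aform_eq by (rule sum.swap)
  also have "\<dots> = aform D u v"
    unfolding aform_eq by (simp add: c[of _ i for i] L2_inner_sym)
  finally show ?thesis by simp
qed

lemma aform_lin:
  assumes "null_boundary_domain (subdomain D 0)"
    and "u \<in> H1 (subdomain D 0)" "v \<in> H1 (subdomain D 0)" "w \<in> H1 (subdomain D 0)"
  shows "aform D (\<lambda>x. u x + c * v x) w = aform D u w + c * aform D v w"
proof -
  interpret null_boundary_domain "subdomain D 0" by fact
  show ?thesis
    unfolding aform_eq using assms
    by (simp add: L2_inner_partial_lincomb partial_L2 sum.distrib sum_distrib_left algebra_simps)
qed

subsection \<open>Meshes with hanging vertices\<close>

abbreviation full_simplex :: "(real^'n) set \<Rightarrow> bool" where
  "full_simplex \<tau> \<equiv> int CARD('n) simplex \<tau>"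

lemma full_simplex_interior:
  fixes \<tau> :: "(real^'n) set"
  assumes "full_simplex \<tau>"
  shows "interior \<tau> \<noteq> {}" "closure (interior \<tau>) = \<tau>"
proof -
  have conv: "convex \<tau>" and cl: "closed \<tau>"
    using assms by (auto intro: convex_simplex closed_simplex)
  have dim: "aff_dim \<tau> = int DIM(real^'n)"
    using aff_dim_simplex[OF assms] by simp
  then have "affine hull \<tau> = UNIV" by (simp only: aff_dim_eq_full)
  then have "rel_interior \<tau> = interior \<tau>" by (rule rel_interior_interior)
  moreover have "\<tau> \<noteq> {}" using dim by auto
  ultimately show ne: "interior \<tau> \<noteq> {}"
    using rel_interior_eq_empty[OF conv] by auto
  show "closure (interior \<tau>) = \<tau>"
    using convex_closure_interior[OF conv ne] cl by simp
qed

lemma vertices_subset: "vertices \<tau> \<subseteq> \<tau>"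
  by (auto simp: vertices_def extreme_point_of_def)

lemma finite_vertices:
  assumes "full_simplex \<tau>"
  shows "finite (vertices \<tau>)"
proof -
  obtain C where C: "finite C" "\<tau> = convex hull C" using assms unfolding simplex by blast
  have "vertices \<tau> \<subseteq> C"
    unfolding vertices_def C(2) using extreme_point_of_convex_hull by blast
  then show ?thesis using C(1) by (rule finite_subset)
qed

lemma affine_zero_on_simplex:
  fixes w :: "real^'n \<Rightarrow> real"
  assumes \<tau>: "full_simplex \<tau>" and w: "\<And>x. x \<in> \<tau> \<Longrightarrow> w x = b + c \<bullet> x"
    and zero: "\<And>p. p \<in> vertices \<tau> \<Longrightarrow> w p = 0" and x: "x \<in> \<tau>"
  shows "w x = 0"
proof -
  have "\<tau> = convex hull vertices \<tau>"
    unfolding vertices_def using \<tau> by (intro Krein_Milman_Minkowski compact_simplex convex_simplex)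
  also have "\<dots> \<subseteq> {y. c \<bullet> y = - b}"
  proof (rule hull_minimal)
    show "vertices \<tau> \<subseteq> {y. c \<bullet> y = - b}"
      using zero w vertices_subset[of \<tau>] by fastforce
  qed (rule convex_hyperplane)
  finally show ?thesis using w x by auto
qed

text \<open>The intersection is a face of \<open>\<tau>\<close>, and a proper face misses the
  interior. It is proper because otherwise \<open>\<tau>\<close> would be a proper face of
  \<open>\<sigma>\<close> and miss the interior of \<open>\<sigma>\<close>, which contains the
  nonempty interior of \<open>\<tau>\<close>.\<close>

lemma triangulation_nonoverlap:
  assumes T: "triangulation T" "\<And>\<tau>. \<tau> \<in> T \<Longrightarrow> full_simplex \<tau>"
    and m: "\<tau> \<in> T" "\<sigma> \<in> T" "\<tau> \<noteq> \<sigma>"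
  shows "interior \<tau> \<inter> \<sigma> = {}"
proof -
  have f: "(\<tau> \<inter> \<sigma>) face_of \<tau>" "(\<sigma> \<inter> \<tau>) face_of \<sigma>"
    using T(1) m by (auto simp: triangulation_def)
  have "\<tau> \<inter> \<sigma> \<noteq> \<tau>"
  proof
    assume eq: "\<tau> \<inter> \<sigma> = \<tau>"
    then have "\<tau> face_of \<sigma>" using f(2) by (simp add: Int_commute)
    then have "\<tau> \<inter> interior \<sigma> = {}" using m(3) by (rule face_of_disjoint_interior)
    moreover have "interior \<tau> \<subseteq> interior \<sigma>" using eq by (intro interior_mono) auto
    moreover have "interior \<tau> \<subseteq> \<tau>" by (rule interior_subset)
    ultimately show False using full_simplex_interior(1)[OF T(2)[OF m(1)]] by blast
  qed
  then have "(\<tau> \<inter> \<sigma>) \<inter> interior \<tau> = {}" using f(1) by (intro face_of_disjoint_interior)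
  then show ?thesis using interior_subset[of \<tau>] by blast
qed

section \<open>Locally and uniformly refined meshes\<close>

locale mesh_hierarchy =
  fixes D :: "('n::finite) hierarchy" and J :: nat and \<kappa> h0 :: real
  assumes nested: "nested_hierarchy D J \<kappa> h0"
begin

abbreviation \<Omega> where "\<Omega> \<equiv> subdomain D 0"

lemma coarse: "triangulation (coarse_mesh D)" "\<tau> \<in> coarse_mesh D \<Longrightarrow> full_simplex \<tau>"
  "\<Omega> = \<Union> (coarse_mesh D)"
  using nested unfolding nested_hierarchy_def by simp_all

lemma subdomain_Suc:
  assumes "Suc k \<le> J"
  shows "subdomain D (Suc k) \<subseteq> subdomain D k"
    and "\<exists>U \<subseteq> mesh D k. subdomain D (Suc k) = \<Union> U"
proof -
  have "\<forall>k\<in>{1..J}. subdomain D k \<subseteq> subdomain D (k - 1) \<and>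
      (\<exists>U \<subseteq> mesh D (k - 1). subdomain D k = \<Union> U)"
    using nested unfolding nested_hierarchy_def by (elim conjE)
  from bspec[OF this, of "Suc k"] assms
  show "subdomain D (Suc k) \<subseteq> subdomain D k" "\<exists>U \<subseteq> mesh D k. subdomain D (Suc k) = \<Union> U"
    by auto
qed

lemma subdomain_mono: "i \<le> k \<Longrightarrow> k \<le> J \<Longrightarrow> subdomain D k \<subseteq> subdomain D i"
proof (induction k rule: dec_induct)
  case (step k)
  then show ?case using subdomain_Suc(1)[of k] by auto
qed simp

lemma refine: "k < J \<Longrightarrow> \<tau> \<in> uniform_mesh D k \<Longrightarrow> midpoint_refinement \<tau> (children D \<tau>)"
  using nested unfolding nested_hierarchy_def by simp

lemma uniform_triangulation: "k \<le> J \<Longrightarrow> triangulation (uniform_mesh D k)"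
  using nested unfolding nested_hierarchy_def by simp

lemma refinement_props:
  assumes "midpoint_refinement \<tau> C"
  shows "triangulation C" "\<sigma> \<in> C \<Longrightarrow> full_simplex \<sigma>" "\<Union>C = \<tau>"
    "p \<in> vertices \<tau> \<Longrightarrow> midpoint p ` \<tau> \<in> C" "finite C"
  using assms unfolding midpoint_refinement_def triangulation_def by simp_all

lemma mesh_0: "mesh D 0 = coarse_mesh D"
  by (simp add: mesh_def)

lemma mesh_Suc: "mesh D (Suc k) = {\<tau> \<in> mesh D k. \<not> \<tau> \<subseteq> subdomain D (Suc k)} \<union>
    \<Union> (children D ` {\<tau> \<in> mesh D k. \<tau> \<subseteq> subdomain D (Suc k)})"
  by (simp add: mesh_def)

lemma uniform_mesh_0: "uniform_mesh D 0 = coarse_mesh D"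
  by (simp add: uniform_mesh_def)

lemma uniform_mesh_subset: "k \<le> J \<Longrightarrow> \<tau> \<in> uniform_mesh D k \<Longrightarrow> full_simplex \<tau> \<and> \<tau> \<subseteq> \<Omega>"
proof (induction k arbitrary: \<tau>)
  case 0
  then show ?case using coarse by (auto simp: uniform_mesh_0)
next
  case (Suc k)
  show ?case
  proof (cases "\<tau> \<in> uniform_mesh D k")
    case True
    then show ?thesis using Suc by simp
  next
    case False
    then obtain \<sigma> where \<sigma>: "\<sigma> \<in> uniform_mesh D k" "\<tau> \<in> children D \<sigma>"
      using Suc.prems by (auto simp: uniform_mesh_def)
    have ref: "midpoint_refinement \<sigma> (children D \<sigma>)" using Suc.prems \<sigma>(1) by (intro refine) auto
    have "\<tau> \<subseteq> \<sigma>" using refinement_props(3)[OF ref] \<sigma>(2) by blast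
    moreover have "\<sigma> \<subseteq> \<Omega>" using Suc.IH[OF _ \<sigma>(1)] Suc.prems(1) by simp
    ultimately show ?thesis using refinement_props(2)[OF ref \<sigma>(2)] by simp
  qed
qed

lemma uniform_mesh_Suc:
  assumes "Suc k \<le> J"
  shows "uniform_mesh D (Suc k) = \<Union> (children D ` uniform_mesh D k)"
proof -
  have "\<tau> \<subseteq> \<Omega>" if "\<tau> \<in> uniform_mesh D k" for \<tau>
    using uniform_mesh_subset[of k \<tau>] that assms by simp
  then have "{\<tau> \<in> uniform_mesh D k. \<not> \<tau> \<subseteq> \<Omega>} = {}"
    "{\<tau> \<in> uniform_mesh D k. \<tau> \<subseteq> \<Omega>} = uniform_mesh D k" by auto
  moreover have "uniform_mesh D (Suc k) = {\<tau> \<in> uniform_mesh D k. \<not> \<tau> \<subseteq> \<Omega>} \<union>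
      \<Union> (children D ` {\<tau> \<in> uniform_mesh D k. \<tau> \<subseteq> \<Omega>})"
    by (simp add: uniform_mesh_def)
  ultimately show ?thesis by (simp only: Un_empty_left)
qed

text \<open>Nestedness: an element inside the current subdomain has been refined in every step, as
  its ancestors lie in the earlier subdomains. This gives access to the conditions on
  \<open>children\<close>, which are imposed along the uniform meshes.\<close>

lemma mesh_in_uniform:
  "k \<le> J \<Longrightarrow> \<tau> \<in> mesh D k \<Longrightarrow> \<tau> \<subseteq> subdomain D k \<Longrightarrow> \<tau> \<in> uniform_mesh D k"
proof (induction k arbitrary: \<tau>)
  case 0
  then show ?case by (simp add: mesh_0 uniform_mesh_0)
next
  case (Suc k)
  then obtain \<sigma> where \<sigma>: "\<sigma> \<in> mesh D k" "\<sigma> \<subseteq> subdomain D (Suc k)" "\<tau> \<in> children D \<sigma>"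
    by (auto simp: mesh_Suc)
  have "\<sigma> \<subseteq> subdomain D k" using \<sigma>(2) subdomain_Suc(1)[OF Suc.prems(1)] by simp
  then have "\<sigma> \<in> uniform_mesh D k" using Suc \<sigma>(1) by simp
  then show ?case using \<sigma>(3) Suc.prems(1) by (auto simp: uniform_mesh_Suc)
qed

lemma refine_mesh:
  assumes "Suc k \<le> J" "\<tau> \<in> mesh D k" "\<tau> \<subseteq> subdomain D (Suc k)"
  shows "midpoint_refinement \<tau> (children D \<tau>)"
  using assms subdomain_Suc(1)[OF assms(1)] by (intro refine[of k] mesh_in_uniform) auto

lemma mesh_Suc_cases:
  assumes "Suc k \<le> J" "\<sigma> \<in> mesh D (Suc k)"
  obtains "\<sigma> \<in> mesh D k" "\<not> \<sigma> \<subseteq> subdomain D (Suc k)"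
  | \<tau> where "\<tau> \<in> mesh D k" "\<tau> \<subseteq> subdomain D (Suc k)" "\<sigma> \<in> children D \<tau>"
    "midpoint_refinement \<tau> (children D \<tau>)" "\<sigma> \<subseteq> \<tau>"
proof -
  have "\<sigma> \<subseteq> \<tau>" if "\<sigma> \<in> children D \<tau>" "midpoint_refinement \<tau> (children D \<tau>)" for \<tau>
    using refinement_props(3)[OF that(2)] that(1) by blast
  then show ?thesis using assms(2) that refine_mesh[OF assms(1)] unfolding mesh_Suc by blast
qed

lemma mesh_props:
  "k \<le> J \<Longrightarrow> finite (mesh D k) \<and> (\<forall>\<tau>\<in>mesh D k. full_simplex \<tau>) \<and> \<Union> (mesh D k) = \<Omega>"
proof (induction k)
  case 0
  then show ?case using coarse by (auto simp: mesh_0 triangulation_def)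
next
  case (Suc k)
  have "finite (mesh D k) \<and> (\<forall>\<tau>\<in>mesh D k. full_simplex \<tau>) \<and> \<Union> (mesh D k) = \<Omega>"
    by (rule Suc.IH) (use Suc.prems in simp)
  then have IH: "finite (mesh D k)" "\<And>\<tau>. \<tau> \<in> mesh D k \<Longrightarrow> full_simplex \<tau>" "\<Union> (mesh D k) = \<Omega>"
    by blast+
  note ref = refine_mesh[OF Suc.prems]
  have fin: "finite (mesh D (Suc k))"
    unfolding mesh_Suc using IH(1) refinement_props(5)[OF ref] by (intro finite_UnI finite_Union finite_imageI) auto
  have full: "full_simplex \<sigma>" if "\<sigma> \<in> mesh D (Suc k)" for \<sigma>
    using Suc.prems that
  proof (cases rule: mesh_Suc_cases)
    case 1
    then show ?thesis by (intro IH(2))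
  next
    case (2 \<tau>)
    show ?thesis by (rule refinement_props(2)[OF 2(4,3)])
  qed
  have union: "\<Union> (mesh D (Suc k)) = \<Omega>"
  proof
    show "\<Union> (mesh D (Suc k)) \<subseteq> \<Omega>"
    proof (rule Union_least)
      fix \<sigma> assume "\<sigma> \<in> mesh D (Suc k)"
      with Suc.prems show "\<sigma> \<subseteq> \<Omega>"
      proof (cases rule: mesh_Suc_cases)
        case 1
        then show ?thesis using IH(3) by blast
      next
        case (2 \<tau>)
        then show ?thesis using IH(3) by blast
      qed
    qed
    show "\<Omega> \<subseteq> \<Union> (mesh D (Suc k))"
    proof
      fix x assume "x \<in> \<Omega>"
      then obtain \<tau> where \<tau>: "\<tau> \<in> mesh D k" "x \<in> \<tau>" using IH(3) by auto
      show "x \<in> \<Union> (mesh D (Suc k))"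
      proof (cases "\<tau> \<subseteq> subdomain D (Suc k)")
        case True
        then have "x \<in> \<Union> (children D \<tau>)" using refinement_props(3)[OF ref[OF \<tau>(1) True]] \<tau>(2) by simp
        then show ?thesis unfolding mesh_Suc using \<tau>(1) True by blast
      next
        case False
        then show ?thesis unfolding mesh_Suc using \<tau> by blast
      qed
    qed
  qed
  show ?case by (intro conjI ballI fin full union)
qed

lemma finite_mesh: "k \<le> J \<Longrightarrow> finite (mesh D k)"
  and mesh_simplex: "k \<le> J \<Longrightarrow> \<tau> \<in> mesh D k \<Longrightarrow> full_simplex \<tau>"
  and Union_mesh: "k \<le> J \<Longrightarrow> \<Union> (mesh D k) = \<Omega>"
  using mesh_props by blast+

text \<open>With hanging vertices the mesh is not face-to-face, so
  \<open>triangulation_nonoverlap\<close> serves only for the coarse mesh and for the children of a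
  common parent; children of different parents inherit the property from their parents.\<close>

lemma mesh_nonoverlap:
  "k \<le> J \<Longrightarrow> \<tau> \<in> mesh D k \<Longrightarrow> \<sigma> \<in> mesh D k \<Longrightarrow> \<tau> \<noteq> \<sigma> \<Longrightarrow> interior \<tau> \<inter> \<sigma> = {}"
proof (induction k arbitrary: \<tau> \<sigma>)
  case 0
  then show ?case using triangulation_nonoverlap[OF coarse(1,2)] by (simp add: mesh_0)
next
  case (Suc k)
  have IH: "interior \<alpha> \<inter> \<beta> = {}" if "\<alpha> \<in> mesh D k" "\<beta> \<in> mesh D k" "\<alpha> \<noteq> \<beta>" for \<alpha> \<beta>
    using Suc.IH that Suc.prems(1) by simp
  from Suc.prems(1,2) show ?case
  proof (cases rule: mesh_Suc_cases)
    case 1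
    note \<tau> = 1
    from Suc.prems(1,3) show ?thesis
    proof (cases rule: mesh_Suc_cases)
      case 1
      then show ?thesis using IH \<tau> Suc.prems(4) by blast
    next
      case (2 \<beta>)
      then show ?thesis using IH[of \<tau> \<beta>] \<tau> by blast
    qed
  next
    case (2 \<alpha>)
    note \<alpha> = 2
    have int: "interior \<tau> \<subseteq> interior \<alpha>" using \<alpha>(5) by (rule interior_mono)
    from Suc.prems(1,3) show ?thesis
    proof (cases rule: mesh_Suc_cases)
      case 1
      then show ?thesis using IH[of \<alpha> \<sigma>] \<alpha> int by blast
    next
      case (2 \<beta>)
      show ?thesis
      proof (cases "\<alpha> = \<beta>")
        case True
        then show ?thesis
          using triangulation_nonoverlap[OF refinement_props(1,2)[OF \<alpha>(4)]] \<alpha>(3) 2(3) Suc.prems(4)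
          by blast
      next
        case False
        then show ?thesis using IH[of \<alpha> \<beta>] \<alpha> 2 int by blast
      qed
    qed
  qed
qed

lemma mesh_refines:
  "i \<le> k \<Longrightarrow> k \<le> J \<Longrightarrow> \<sigma> \<in> mesh D k \<Longrightarrow> \<exists>\<tau>\<in>mesh D i. \<sigma> \<subseteq> \<tau>"
proof (induction k arbitrary: \<sigma> rule: dec_induct)
  case (step k)
  have "\<exists>\<alpha>\<in>mesh D k. \<sigma> \<subseteq> \<alpha>"
    using step.prems by (rule mesh_Suc_cases) blast+
  then show ?case using step by (meson Suc_leD order_trans)
qed blast

lemma V_mono:
  assumes "i \<le> k" "k \<le> J"
  shows "V D i \<subseteq> V D k"
proof
  fix v assume v: "v \<in> V D i"
  have "\<exists>b c. \<forall>x\<in>\<sigma>. v x = b + c \<bullet> x" if \<sigma>: "\<sigma> \<in> mesh D k" for \<sigma>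
  proof -
    obtain \<tau> where "\<tau> \<in> mesh D i" "\<sigma> \<subseteq> \<tau>" using mesh_refines[OF assms \<sigma>] by blast
    moreover from this have "\<exists>b c. \<forall>x\<in>\<tau>. v x = b + c \<bullet> x"
      using v by (simp add: V_def fe_space_def)
    ultimately show ?thesis by (meson subsetD)
  qed
  then show "v \<in> V D k" using v by (simp add: V_def fe_space_def)
qed

lemma compact_\<Omega>: "compact \<Omega>"
  unfolding coarse(3) using coarse(1,2)
  by (intro compact_Union) (auto simp: triangulation_def intro: compact_simplex)

lemma \<Omega>_dense: "\<Omega> \<subseteq> closure (interior \<Omega>)"
proof
  fix x assume "x \<in> \<Omega>"
  then obtain \<tau> where \<tau>: "\<tau> \<in> coarse_mesh D" "x \<in> \<tau>" using coarse(3) by auto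
  then have "closure (interior \<tau>) \<subseteq> closure (interior \<Omega>)"
    using coarse(3) by (intro closure_mono interior_mono) auto
  then show "x \<in> closure (interior \<Omega>)"
    using \<tau> full_simplex_interior(2)[OF coarse(2)[OF \<tau>(1)]] by auto
qed

sublocale null_boundary_domain \<Omega>
proof
  show "compact \<Omega>" by (rule compact_\<Omega>)
  have fin: "finite (coarse_mesh D)" using coarse(1) by (simp add: triangulation_def)
  have "\<Omega> - interior \<Omega> \<subseteq> frontier \<Omega>"
    using closure_subset by (auto simp: frontier_def)
  also have "\<dots> \<subseteq> (\<Union>\<tau>\<in>coarse_mesh D. frontier \<tau>)"
    unfolding coarse(3) using fin by (rule frontier_Union_subset)
  finally show "negligible (\<Omega> - interior \<Omega>)"
    by (rule negligible_subset[rotated])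
      (use fin coarse(2) in \<open>auto intro!: negligible_Union negligible_convex_frontier convex_simplex\<close>)
qed

section \<open>Finite element spaces as finite-dimensional spaces\<close>

lemma V_props:
  assumes "v \<in> V D k"
  shows "v \<in> H10 \<Omega>" "continuous_on \<Omega> v" "x \<notin> \<Omega> \<Longrightarrow> v x = 0"
    "\<tau> \<in> mesh D k \<Longrightarrow> \<exists>b c. \<forall>x\<in>\<tau>. v x = b + c \<bullet> x"
  using assms by (simp_all add: V_def fe_space_def)

lemma V_fun_space: "fun_space (V D k)"
proof
  show "(\<lambda>x. 0) \<in> V D k"
    unfolding V_def fe_space_def using H10_zero
    by (intro CollectI conjI ballI exI[of _ 0]) simp_all
  fix u v c assume uv: "u \<in> V D k" "v \<in> V D k"
  show "(\<lambda>x. u x + c * v x) \<in> V D k"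
    unfolding V_def fe_space_def
  proof (intro CollectI conjI ballI allI impI)
    show "(\<lambda>x. u x + c * v x) \<in> H10 \<Omega>"
      using uv by (intro H10_lincomb V_props)
    show "continuous_on \<Omega> (\<lambda>x. u x + c * v x)"
      using uv by (intro continuous_intros V_props)
    show "u x + c * v x = 0" if "x \<notin> \<Omega>" for x
      using V_props(3)[OF uv(1) that] V_props(3)[OF uv(2) that] by simp
    fix \<tau> assume \<tau>: "\<tau> \<in> mesh D k"
    obtain b d where u: "\<forall>x\<in>\<tau>. u x = b + d \<bullet> x"
      using V_props(4)[OF uv(1) \<tau>] by (elim exE)
    obtain b' d' where v: "\<forall>x\<in>\<tau>. v x = b' + d' \<bullet> x"
      using V_props(4)[OF uv(2) \<tau>] by (elim exE)
    from u v have "\<forall>x\<in>\<tau>. u x + c * v x = (b + c * b') + (d + c *\<^sub>R d') \<bullet> x"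
      by (simp add: inner_add_left algebra_simps)
    then show "\<exists>b d. \<forall>x\<in>\<tau>. u x + c * v x = b + d \<bullet> x" by (intro exI)
  qed
qed

lemma V_H1: "v \<in> V D k \<Longrightarrow> v \<in> H1 \<Omega>"
  using V_props(1)[of v k] by (simp add: H10_def)

lemma V_L2: "v \<in> V D k \<Longrightarrow> v \<in> L2 \<Omega>"
  using V_H1 H1_L2 by blast

lemma V_zero_on_simplex:
  assumes "k \<le> J" "v \<in> V D k" "\<tau> \<in> mesh D k" "\<And>p. p \<in> vertices \<tau> \<Longrightarrow> v p = 0" "x \<in> \<tau>"
  shows "v x = 0"
proof -
  obtain b c where "\<forall>x\<in>\<tau>. v x = b + c \<bullet> x"
    using V_props(4)[OF assms(2,3)] by (elim exE)
  then show ?thesis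
    using affine_zero_on_simplex[OF mesh_simplex[OF assms(1,3)], of v b c x] assms(4,5) by simp
qed

text \<open>The determining set consists of all vertices, hanging ones included, so each element can
  be treated by itself.\<close>

lemma V_determined:
  assumes k: "k \<le> J"
  shows "\<exists>F. finite F \<and> (\<forall>u\<in>V D k. (\<forall>p\<in>F. u p = 0) \<longrightarrow> u = (\<lambda>x. 0))"
proof (intro exI conjI ballI impI ext)
  show "finite (\<Union> (vertices ` mesh D k))"
    using finite_mesh[OF k] mesh_simplex[OF k] finite_vertices by blast
  fix u x assume u: "u \<in> V D k" "\<forall>p\<in>\<Union> (vertices ` mesh D k). u p = 0"
  show "u x = 0"
  proof (cases "x \<in> \<Omega>")
    case True
    then obtain \<tau> where "\<tau> \<in> mesh D k" "x \<in> \<tau>" using Union_mesh[OF k] by blast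
    then show ?thesis using V_zero_on_simplex[OF k u(1), of \<tau> x] u(2) by auto
  qed (rule V_props(3)[OF u(1)])
qed

lemma V_ip_form:
  assumes k: "k \<le> J"
  shows "finite_form (V D k) (ip D)"
proof -
  interpret fun_space "V D k" by (rule V_fun_space)
  show ?thesis
  proof
    show "ip D u v = ip D v u" for u v unfolding ip_def by (rule L2_inner_sym)
    show "ip D (\<lambda>x. u x + c * v x) w = ip D u w + c * ip D v w"
      if "u \<in> V D k" "v \<in> V D k" "w \<in> V D k" for u v w c
      unfolding ip_def using that by (intro L2_inner_lin V_L2)
    show "0 \<le> ip D u u" for u unfolding ip_def by (rule L2_inner_nonneg)
    show "u = (\<lambda>x. 0)" if u: "u \<in> V D k" "ip D u u = 0" for u
    proof
      fix x
      show "u x = 0"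
        using L2_inner_definite[OF \<Omega>_dense V_L2[OF u(1)] V_props(2)[OF u(1)], of x] u(2) V_props(3)[OF u(1), of x]
        by (cases "x \<in> \<Omega>") (auto simp: ip_def)
    qed
  qed (rule V_determined[OF k])
qed

text \<open>The child shrunk towards \<open>p\<close> contains \<open>p\<close>, and an extreme
  point of \<open>\<tau>\<close> remains extreme in every subset of \<open>\<tau>\<close> that
  contains it.\<close>

lemma uniform_vertex:
  assumes "i \<le> k" "k \<le> J" "\<tau> \<in> uniform_mesh D i" "p \<in> vertices \<tau>"
  shows "\<exists>\<tau>'\<in>uniform_mesh D k. p \<in> vertices \<tau>'"
  using assms
proof (induction k rule: dec_induct)
  case (step k)
  then obtain \<tau>' where \<tau>': "\<tau>' \<in> uniform_mesh D k" "p \<in> vertices \<tau>'" by auto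
  have ref: "midpoint_refinement \<tau>' (children D \<tau>')" using step \<tau>' by (intro refine[of k]) auto
  have m: "midpoint p ` \<tau>' \<in> children D \<tau>'" using refinement_props(4)[OF ref \<tau>'(2)] .
  then have sub: "midpoint p ` \<tau>' \<subseteq> \<tau>'" using refinement_props(3)[OF ref] by blast
  have "p = midpoint p p" by simp
  then have "p \<in> midpoint p ` \<tau>'" using \<tau>'(2) vertices_subset by blast
  then have "p \<in> vertices (midpoint p ` \<tau>')"
    using \<tau>'(2) sub unfolding vertices_def extreme_point_of_def by blast
  then show ?case using m \<tau>'(1) step.prems by (auto simp: uniform_mesh_Suc)
qed blast

text \<open>\<open>p\<close> survives as a vertex of some element of level \<open>k\<close>. The
  intersection of that element with \<open>\<sigma>\<close> is a face of both, and extreme points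
  pass through faces in either direction.\<close>

lemma uniform_vertex_of_finer:
  assumes "i \<le> k" "k \<le> J" "\<tau> \<in> uniform_mesh D i" "p \<in> vertices \<tau>" "\<sigma> \<in> uniform_mesh D k" "p \<in> \<sigma>"
  shows "p \<in> vertices \<sigma>"
proof -
  obtain \<tau>' where \<tau>': "\<tau>' \<in> uniform_mesh D k" "p \<in> vertices \<tau>'"
    using uniform_vertex[OF assms(1-4)] by blast
  have f: "(\<tau>' \<inter> \<sigma>) face_of \<tau>'" "(\<tau>' \<inter> \<sigma>) face_of \<sigma>"
    using uniform_triangulation[OF assms(2)] \<tau>'(1) assms(5)
    unfolding triangulation_def by (blast, metis Int_commute)
  have "p \<in> \<tau>' \<inter> \<sigma>" using \<tau>'(2) assms(6) vertices_subset by blast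
  then have "p extreme_point_of (\<tau>' \<inter> \<sigma>)"
    using extreme_point_of_face[OF f(1)] \<tau>'(2) by (simp add: vertices_def)
  then show ?thesis using extreme_point_of_face[OF f(2)] by (simp add: vertices_def)
qed

text \<open>Assigns to each element of a locally refined mesh a level on which to run
  inductions.\<close>

lemma mesh_level:
  "k \<le> J \<Longrightarrow> \<tau> \<in> mesh D k \<Longrightarrow> \<exists>l\<le>k. \<tau> \<in> uniform_mesh D l"
proof (induction k)
  case 0
  then show ?case by (simp add: mesh_0 uniform_mesh_0)
next
  case (Suc k)
  show ?case
  proof (cases "\<tau> \<subseteq> subdomain D (Suc k)")
    case True
    then show ?thesis using mesh_in_uniform[OF Suc.prems True] by blast
  next
    case False
    then have "\<tau> \<in> mesh D k"
      using mesh_Suc_cases[OF Suc.prems] by (metis order_trans)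
    then show ?thesis using Suc by (meson Suc_leD le_SucI)
  qed
qed

lemma unrefined_persists:
  "j \<le> k \<Longrightarrow> k \<le> J \<Longrightarrow> \<tau> \<in> mesh D j \<Longrightarrow> \<not> \<tau> \<subseteq> subdomain D (Suc j) \<Longrightarrow> \<tau> \<in> mesh D k"
proof (induction k rule: dec_induct)
  case (step k)
  have "subdomain D (Suc k) \<subseteq> subdomain D (Suc j)"
    using step by (intro subdomain_mono) auto
  then show ?case using step by (auto simp: mesh_Suc)
qed

text \<open>If they met, interior points of \<open>\<tau>\<close> would lie in the subdomain. That
  is a union of elements, none of them \<open>\<tau>\<close>, so elements would overlap.\<close>

lemma unrefined_disjoint:
  assumes "Suc j \<le> J" "\<tau> \<in> mesh D j" "\<not> \<tau> \<subseteq> subdomain D (Suc j)"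
  shows "\<tau> \<inter> interior (subdomain D (Suc j)) = {}"
proof (rule ccontr)
  assume "\<not> ?thesis"
  moreover have \<tau>: "closure (interior \<tau>) = \<tau>"
    using mesh_simplex[OF _ assms(2)] assms(1) full_simplex_interior(2) by simp
  ultimately have "interior (subdomain D (Suc j)) \<inter> closure (interior \<tau>) \<noteq> {}" by auto
  then have "interior (subdomain D (Suc j)) \<inter> interior \<tau> \<noteq> {}"
    by (simp add: open_Int_closure_eq_empty)
  then obtain q where q: "q \<in> subdomain D (Suc j)" "q \<in> interior \<tau>"
    using interior_subset by blast
  obtain U where U: "U \<subseteq> mesh D j" "subdomain D (Suc j) = \<Union> U"
    using subdomain_Suc(2)[OF assms(1)] by blast
  obtain \<sigma> where \<sigma>: "\<sigma> \<in> U" "q \<in> \<sigma>" using q(1) U(2) by blast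
  then have "\<sigma> \<noteq> \<tau>" using U(2) assms(3) by blast
  then show False
    using mesh_nonoverlap[OF _ assms(2), of \<sigma>] assms(1) \<sigma> U(1) q(2) by auto
qed

text \<open>
  Hanging vertices make this non-trivial. A vertex of an element that is not a node lies in a
  strictly coarser element, and that element is not refined either, so one can induct on the level.
\<close>

lemma zero_on_unrefined:
  assumes jk: "j < k" and k: "k \<le> J" and w: "w \<in> V D k"
    and nodes: "\<And>p. p \<in> nodes (mesh D j) \<Longrightarrow> p \<notin> interior (subdomain D (Suc j)) \<Longrightarrow> w p = 0"
    and \<tau>: "\<tau> \<in> mesh D j" "\<not> \<tau> \<subseteq> subdomain D (Suc j)" and x: "x \<in> \<tau>"
  shows "w x = 0"
proof -
  have jJ: "Suc j \<le> J" "j \<le> J" using jk k by auto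
  have "\<forall>x\<in>\<tau>. w x = 0"
    if "l \<le> j" "\<tau> \<in> uniform_mesh D l" "\<tau> \<in> mesh D j" "\<not> \<tau> \<subseteq> subdomain D (Suc j)" for l \<tau>
    using that
  proof (induction l arbitrary: \<tau> rule: less_induct)
    case (less l)
    have "w p = 0" if p: "p \<in> vertices \<tau>" for p
    proof (cases "p \<in> nodes (mesh D j)")
      case True
      have "p \<notin> interior (subdomain D (Suc j))"
        using unrefined_disjoint[OF jJ(1) less.prems(3,4)] p vertices_subset by blast
      then show ?thesis using nodes True by blast
    next
      case False
      then obtain \<sigma> where \<sigma>: "\<sigma> \<in> mesh D j" "p \<in> \<sigma>" "p \<notin> vertices \<sigma>"
        using p less.prems(3) unfolding nodes_def by blast
      \<comment> \<open>On its own or any finer uniform level a vertex of \<open>\<tau>\<close>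
        cannot hang, so \<open>\<sigma>\<close> must be strictly coarser than
        \<open>\<tau>\<close>.\<close>
      have fine: "\<not> (l \<le> i \<and> i \<le> J \<and> \<sigma> \<in> uniform_mesh D i)" for i
        using uniform_vertex_of_finer[OF _ _ less.prems(2) p, of i \<sigma>] \<sigma>(2,3) by blast
      have "\<not> \<sigma> \<subseteq> subdomain D (Suc j)"
      proof
        assume "\<sigma> \<subseteq> subdomain D (Suc j)"
        then have "\<sigma> \<in> uniform_mesh D j"
          using mesh_in_uniform[OF jJ(2) \<sigma>(1)] subdomain_Suc(1)[OF jJ(1)] by blast
        then show False using fine less.prems(1) jJ by blast
      qed
      moreover obtain i where i: "i \<le> j" "\<sigma> \<in> uniform_mesh D i"
        using mesh_level[OF jJ(2) \<sigma>(1)] by blast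
      moreover have "i < l" using fine[of i] i jJ by simp
      ultimately show ?thesis using less.IH \<sigma> by blast
    qed
    \<comment> \<open>\<open>w\<close> is known to be affine on elements of level \<open>k\<close>;
      \<open>\<tau>\<close>, never being refined, is still one of them.\<close>
    moreover have "\<tau> \<in> mesh D k"
      using unrefined_persists[OF _ k less.prems(3,4)] jk by simp
    ultimately show ?case using V_zero_on_simplex[OF k w] by blast
  qed
  then show ?thesis using mesh_level[OF jJ(2) \<tau>(1)] \<tau> x by blast
qed

section \<open>Local subspaces and the pieces of the decomposition\<close>

lemma V_sub_subset: "i \<le> k \<Longrightarrow> k \<le> J \<Longrightarrow> V_sub D k i \<subseteq> V D i"
  by (auto simp: V_sub_def)

lemma V_sub_fun_space: "fun_space (V_sub D k i)"
proof (cases "i = 0")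
  case True
  then show ?thesis using V_fun_space by (simp add: V_sub_def)
next
  case False
  interpret fun_space "V D i" by (rule V_fun_space)
  show ?thesis
  proof
    show "(\<lambda>x. 0) \<in> V_sub D k i" using False zero_mem by (simp add: V_sub_def)
    fix u v c assume uv: "u \<in> V_sub D k i" "v \<in> V_sub D k i"
    have "closure {x. u x + c * v x \<noteq> 0} \<subseteq> closure ({x. u x \<noteq> 0} \<union> {x. v x \<noteq> 0})"
      by (intro closure_mono) auto
    also have "\<dots> \<subseteq> subdomain D i" using uv False by (simp add: V_sub_def closure_Un)
    finally show "(\<lambda>x. u x + c * v x) \<in> V_sub D k i"
      using uv False by (simp add: V_sub_def lincomb_mem)
  qed
qed

lemma closed_subdomain: "Suc j \<le> J \<Longrightarrow> closed (subdomain D (Suc j))"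
proof -
  assume j: "Suc j \<le> J"
  obtain U where U: "U \<subseteq> mesh D j" "subdomain D (Suc j) = \<Union> U"
    using subdomain_Suc(2)[OF j] by blast
  have "finite U" using U(1) finite_mesh[of j] j finite_subset by auto
  moreover have "closed \<tau>" if "\<tau> \<in> U" for \<tau>
    using that U(1) mesh_simplex[of j \<tau>] j closed_simplex by auto
  ultimately show ?thesis unfolding U(2) by (intro closed_Union) auto
qed

lemma Q_hat_mem:
  assumes "is_Q_hat D k Qh" "v \<in> V D k" "i \<le> k" "k \<le> J"
  shows "Qh i v \<in> V D i"
proof (cases "i = k")
  case True
  then show ?thesis using assms by (auto simp: is_Q_hat_def)
next
  case False
  then show ?thesis using assms by (auto simp: is_Q_hat_def)
qed

text \<open>At nodes outside the interior of the next subdomain \<open>Qh i\<close> copies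
  \<open>v\<close>, so \<open>zero_on_unrefined\<close> applies to the difference. That lemma is
  formulated for functions of the finest space because \<open>v\<close> itself lies only in
  \<open>V D k\<close>.\<close>

lemma Q_hat_eq:
  assumes Q: "is_Q_hat D k Qh" and v: "v \<in> V D k" and i: "i < k" "k \<le> J"
    and \<tau>: "\<tau> \<in> mesh D i" "\<not> \<tau> \<subseteq> subdomain D (Suc i)" and x: "x \<in> \<tau>"
  shows "Qh i v x = v x"
proof -
  interpret fun_space "V D k" by (rule V_fun_space)
  have Qv: "Qh i v \<in> V D k" using Q_hat_mem[OF Q v] i V_mono[of i k] by auto
  have "Qh i v x - v x = 0"
  proof (rule zero_on_unrefined[OF i _ _ \<tau> x, of "\<lambda>x. Qh i v x - v x"])
    show "(\<lambda>x. Qh i v x - v x) \<in> V D k" using Qv v by (rule diff_mem)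
    show "Qh i v p - v p = 0"
      if "p \<in> nodes (mesh D i)" "p \<notin> interior (subdomain D (Suc i))" for p
      using Q v i that by (auto simp: is_Q_hat_def)
  qed
  then show ?thesis by simp
qed

text \<open>On an element outside \<open>subdomain D (Suc i)\<close> both operators reproduce
  \<open>v\<close>: the element is kept by the next mesh and, by nestedness, is not refined there
  either. What remains is supported in the subdomain, which is closed.\<close>

lemma Q_hat_diff:
  assumes Q: "is_Q_hat D k Qh" and v: "v \<in> V D k" and i: "Suc i \<le> k" "k \<le> J"
  shows "(\<lambda>x. Qh (Suc i) v x - Qh i v x) \<in> V_sub D k (Suc i)"
proof -
  interpret fun_space "V D (Suc i)" by (rule V_fun_space)
  let ?d = "\<lambda>x. Qh (Suc i) v x - Qh i v x"
  have iJ: "Suc i \<le> J" "i \<le> J" using i by auto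
  have m: "?d \<in> V D (Suc i)"
    using Q_hat_mem[OF Q v, of "Suc i"] Q_hat_mem[OF Q v, of i] V_mono[of i "Suc i"] i
    by (intro diff_mem) auto
  have "{x. ?d x \<noteq> 0} \<subseteq> subdomain D (Suc i)"
  proof
    fix x assume "x \<in> {x. ?d x \<noteq> 0}"
    then have x: "?d x \<noteq> 0" by simp
    then have "x \<in> \<Omega>" using V_props(3)[OF m] by blast
    then obtain \<tau> where \<tau>: "\<tau> \<in> mesh D i" "x \<in> \<tau>" using Union_mesh[OF iJ(2)] by blast
    show "x \<in> subdomain D (Suc i)"
    proof (cases "\<tau> \<subseteq> subdomain D (Suc i)")
      case False
      have 1: "Qh i v x = v x" using Q_hat_eq[OF Q v _ i(2) \<tau>(1) False \<tau>(2)] i by simp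
      have "Qh (Suc i) v x = v x"
      proof (cases "Suc i = k")
        case True
        then show ?thesis using Q v by (simp add: is_Q_hat_def)
      next
        case neq: False
        then have lt: "Suc i < k" using i by simp
        have \<tau>': "\<tau> \<in> mesh D (Suc i)" using \<tau>(1) False by (simp add: mesh_Suc)
        have "\<not> \<tau> \<subseteq> subdomain D (Suc (Suc i))"
          using False subdomain_Suc(1)[of "Suc i"] lt i by auto
        then show ?thesis using Q_hat_eq[OF Q v lt i(2) \<tau>' _ \<tau>(2)] by blast
      qed
      then show ?thesis using 1 x by simp
    qed (use \<tau> in blast)
  qed
  then have "closure {x. ?d x \<noteq> 0} \<subseteq> subdomain D (Suc i)"
    using closed_subdomain[OF iJ(1)] by (rule closure_minimal)
  then show ?thesis using m by (simp add: V_sub_def)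
qed

end

subsection \<open>The multigrid operators\<close>

locale multilevel_problem = mesh_hierarchy D J \<kappa> h0
  for D :: "('n::finite) hierarchy" and J \<kappa> h0 +
  fixes C\<Theta>1 :: real
  assumes symmetric: "transpose (coeff D) = coeff D"
    and C\<Theta>1: "0 < C\<Theta>1"
    and elliptic: "k \<le> J \<Longrightarrow> u \<in> V D k \<Longrightarrow> C\<Theta>1 * (H1_norm (subdomain D 0) u)\<^sup>2 \<le> aform D u u"
begin

lemma V_a_form:
  assumes k: "k \<le> J"
  shows "finite_form (V D k) (aform D)"
proof -
  interpret ip: finite_form "V D k" "ip D" by (rule V_ip_form[OF k])
  have le: "C\<Theta>1 * ip D u u \<le> aform D u u" if "u \<in> V D k" for u
  proof -
    have "ip D u u \<le> (H1_norm \<Omega> u)\<^sup>2"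
      unfolding H1_norm_square ip_def by (simp add: sum_nonneg L2_inner_nonneg)
    then have "C\<Theta>1 * ip D u u \<le> C\<Theta>1 * (H1_norm \<Omega> u)\<^sup>2"
      using C\<Theta>1 by (intro mult_left_mono) auto
    then show ?thesis using elliptic[OF k that] by linarith
  qed
  show ?thesis
  proof
    show "aform D u v = aform D v u" for u v by (rule aform_sym[OF symmetric])
    show "aform D (\<lambda>x. u x + c * v x) w = aform D u w + c * aform D v w"
      if "u \<in> V D k" "v \<in> V D k" "w \<in> V D k" for u v w c
      using that by (intro aform_lin V_H1 null_boundary_domain_axioms)
    show "0 \<le> aform D u u" if "u \<in> V D k" for u
      using le[OF that] ip.nonneg[OF that] C\<Theta>1 mult_nonneg_nonneg[of "C\<Theta>1" "ip D u u"] by linarith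
    show "u = (\<lambda>x. 0)" if u: "u \<in> V D k" "aform D u u = 0" for u
    proof (rule ip.definite[OF u(1)])
      have "C\<Theta>1 * ip D u u \<le> 0" using le[OF u(1)] u(2) by simp
      then show "ip D u u = 0" using C\<Theta>1 ip.nonneg[OF u(1)] by (simp add: mult_le_0_iff)
    qed
  qed (rule V_determined[OF k])
qed

lemma A_pair:
  assumes k: "k \<le> J"
  shows "form_pair (V D k) (ip D) (aform D) (A D k)"
proof -
  interpret ip: finite_form "V D k" "ip D" by (rule V_ip_form[OF k])
  interpret a: finite_form "V D k" "aform D" by (rule V_a_form[OF k])
  have "A D k u \<in> V D k \<and> (\<forall>v\<in>V D k. ip D (A D k u) v = aform D u v)" if "u \<in> V D k" for u
    unfolding A_def using ip.representing_operator[of "aform D u"] a.lin_right that by blast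
  then show ?thesis by unfold_locales blast+
qed

section \<open>The subspace operators of a fixed level\<close>

context
  fixes k :: nat
  assumes k: "k \<le> J"
begin

interpretation ip: finite_form "V D k" "ip D" by (rule V_ip_form[OF k])
interpretation a: finite_form "V D k" "aform D" by (rule V_a_form[OF k])
interpretation A: form_pair "V D k" "ip D" "aform D" "A D k" by (rule A_pair[OF k])

lemma V_sub_V: "i \<le> k \<Longrightarrow> V_sub D k i \<subseteq> V D k"
  using V_sub_subset[of i k] V_mono[of i k] k by blast

lemma A_sub_pair:
  assumes i: "i \<le> k"
  shows "form_pair (V_sub D k i) (ip D) (aform D) (A_sub D k i)"
proof -
  note sub = V_sub_V[OF i]
  interpret sip: finite_form "V_sub D k i" "ip D"
    by (rule ip.subspace_finite_form[OF V_sub_fun_space sub])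
  interpret sa: finite_form "V_sub D k i" "aform D"
    by (rule a.subspace_finite_form[OF V_sub_fun_space sub])
  have "A_sub D k i u \<in> V_sub D k i \<and>
      (\<forall>v\<in>V_sub D k i. ip D (A_sub D k i u) v = ip D (A D k u) v)" if "u \<in> V_sub D k i" for u
  proof -
    have Au: "A D k u \<in> V D k" using that sub A.Op_mem by blast
    have "ip D (A D k u) (\<lambda>x. y x + c * z x) = ip D (A D k u) y + c * ip D (A D k u) z"
      if "y \<in> V_sub D k i" "z \<in> V_sub D k i" for y z c
      using that sub Au by (intro ip.lin_right) auto
    then show ?thesis
      unfolding A_sub_def using sip.representing_operator[of "ip D (A D k u)"] by blast
  qed
  moreover have "ip D (A D k u) v = aform D u v" if "u \<in> V_sub D k i" "v \<in> V_sub D k i" for u v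
    using that sub A.Op by blast
  ultimately show ?thesis by unfold_locales (blast, metis)
qed

text \<open>Both spectral radii bound the same Rayleigh quotient, over nested spaces. This connects
  the subsolvers, scaled by \<open>lambda_sub\<close>, with the known estimate in terms of
  \<open>lambda_max\<close>.\<close>

lemma lambda_sub_le:
  assumes i: "i \<le> k"
  shows "0 \<le> lambda_sub D k i" "lambda_sub D k i \<le> lambda_max D i"
proof -
  interpret s: form_pair "V_sub D k i" "ip D" "aform D" "A_sub D k i" by (rule A_sub_pair[OF i])
  interpret Ai: form_pair "V D i" "ip D" "aform D" "A D i" using i k by (intro A_pair) simp
  show "0 \<le> lambda_sub D k i" unfolding lambda_sub_def by (rule s.spectral_radius_nonneg)
  show "lambda_sub D k i \<le> lambda_max D i"
    unfolding lambda_sub_def lambda_max_def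
    using V_sub_subset[OF i k] Ai.Rayleigh Ai.spectral_radius_nonneg
    by (intro s.spectral_radius_le) auto
qed

lemma Q_sub:
  assumes i: "i \<le> k" and u: "u \<in> V D k"
  shows "Q_sub D k i u \<in> V_sub D k i" "z \<in> V_sub D k i \<Longrightarrow> ip D (Q_sub D k i u) z = ip D u z"
  unfolding Q_sub_def using ip.orth_proj[OF V_sub_fun_space V_sub_V[OF i] u] by blast+

text \<open>The exact solver undoes the passage to \<open>A D 0\<close>, so the coarse correction is
  the energy projection onto \<open>V D 0\<close>.\<close>

lemma T_sub_0:
  assumes v: "v \<in> V D k"
  shows "T_sub D k 0 v \<in> V D 0" "w \<in> V D 0 \<Longrightarrow> aform D (T_sub D k 0 v) w = aform D v w"
proof -
  interpret ip0: finite_form "V D 0" "ip D" by (rule V_ip_form) simp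
  interpret a0: finite_form "V D 0" "aform D" by (rule V_a_form) simp
  interpret A0: form_pair "V D 0" "ip D" "aform D" "A D 0" by (rule A_pair) simp
  have sub: "V D 0 \<subseteq> V D k" using V_mono[of 0 k] k by simp
  have V0: "V_sub D k 0 = V D 0" by (simp add: V_sub_def)
  have Av: "A D k v \<in> V D k" by (rule A.Op_mem[OF v])
  define q where "q = Q_sub D k 0 (A D k v)"
  have q: "q \<in> V D 0" "z \<in> V D 0 \<Longrightarrow> ip D q z = aform D v z" for z
    unfolding q_def using Q_sub(1)[of 0 "A D k v"] Q_sub(2)[of 0 "A D k v" z] Av A.Op[OF v] sub unfolding V0 by auto
  \<comment> \<open>\<open>inv_into\<close> can be trusted only on the range of
    \<open>A D 0\<close>; the representative of \<open>ip D q\<close> in the energy form is a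
    preimage of \<open>q\<close>.\<close>
  have "\<exists>!u. u \<in> V D 0 \<and> (\<forall>z\<in>V D 0. aform D u z = ip D q z)"
    using q(1) by (intro a0.Riesz ip0.lin_right)
  then obtain u where u: "u \<in> V D 0" "\<And>z. z \<in> V D 0 \<Longrightarrow> aform D u z = ip D q z" by blast
  have "A D 0 u = q"
    using A0.Op_mem[OF u(1)] q(1) A0.Op[OF u(1)] u(2) by (intro ip0.eqI) auto
  then have img: "q \<in> A D 0 ` V D 0" using u(1) by blast
  have T: "T_sub D k 0 v = inv_into (V D 0) (A D 0) q"
    by (simp add: T_sub_def R_sub_def q_def)
  show mem: "T_sub D k 0 v \<in> V D 0" unfolding T using img by (rule inv_into_into)
  show "aform D (T_sub D k 0 v) w = aform D v w" if w: "w \<in> V D 0"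
  proof -
    have "A D 0 (T_sub D k 0 v) = q" unfolding T using img by (rule f_inv_into_f)
    then show ?thesis using A0.Op[OF mem w] q(2)[OF w] by simp
  qed
qed

text \<open>Stated with the scaling multiplied out, so that it stays correct when
  \<open>V_sub D k i\<close> is the zero space.\<close>

lemma T_sub_Suc:
  assumes i: "1 \<le> i" "i \<le> k" and v: "v \<in> V D k"
  shows "T_sub D k i v \<in> V_sub D k i"
    "w \<in> V_sub D k i \<Longrightarrow> lambda_sub D k i * real k * ip D (T_sub D k i v) w = aform D v w"
proof -
  interpret s: form_pair "V_sub D k i" "ip D" "aform D" "A_sub D k i" by (rule A_sub_pair[OF i(2)])
  define q where "q = Q_sub D k i (A D k v)"
  let ?c = "lambda_sub D k i * real k"
  have Av: "A D k v \<in> V D k" by (rule A.Op_mem[OF v])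
  have q: "q \<in> V_sub D k i" unfolding q_def by (rule Q_sub(1)[OF i(2) Av])
  have T: "T_sub D k i v = (\<lambda>x. 1 / ?c * q x)"
    using i(1) by (simp add: T_sub_def R_sub_def q_def)
  show "T_sub D k i v \<in> V_sub D k i" unfolding T using q by (rule s.b.scale_mem)
  assume w: "w \<in> V_sub D k i"
  then have wk: "w \<in> V D k" using V_sub_V[OF i(2)] by blast
  show "?c * ip D (T_sub D k i v) w = aform D v w"
  proof (cases "lambda_sub D k i = 0")
    case True
    \<comment> \<open>Spectral radius zero forces every \<open>w\<close> in the subspace to be zero;
      the division by zero inside \<open>R_sub\<close> does no harm then.\<close>
    have "aform D w w \<le> lambda_sub D k i * ip D w w"
      unfolding lambda_sub_def by (rule s.Rayleigh[OF w])
    then have "aform D w w = 0" using True a.nonneg[OF wk] by simp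
    then have "w = (\<lambda>x. 0)" by (rule a.definite[OF wk])
    then show ?thesis using True a.zero_right[OF v] by simp
  next
    case False
    have "ip D q w = aform D v w"
      unfolding q_def using Q_sub(2)[OF i(2) Av w] A.Op[OF v wk] by simp
    then show ?thesis
      unfolding T s.b.scale_left[OF q w] using False i by simp
  qed
qed

end

text \<open>Level 0 enters the stability estimate with \<open>C2\<close>. A level
  \<open>i \<ge> 1\<close> enters with \<open>k * C1\<close>: the weight
  \<open>lambda_sub D k i * real k\<close> of its subsolver meets
  \<open>C1 / lambda_max D i\<close>, and the ratio of the spectral radii is at most one. The total
  \<open>C2 + k^2 * C1\<close> is at most \<open>C * (1 + k^2)\<close>.\<close>

lemma subspace_correction:
  fixes Qh :: "nat \<Rightarrow> (real^'n \<Rightarrow> real) \<Rightarrow> (real^'n \<Rightarrow> real)"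
  assumes k: "1 \<le> k" "k \<le> J" and Q: "is_Q_hat D k Qh"
    and C1: "\<And>i v. 1 \<le> i \<Longrightarrow> i \<le> k \<Longrightarrow> v \<in> V D k \<Longrightarrow>
      ip D (\<lambda>x. Qh i v x - Qh (i - 1) v x) (\<lambda>x. Qh i v x - Qh (i - 1) v x)
        \<le> C1 * inverse (lambda_max D i) * aform D v v" "0 \<le> C1" "C1 \<le> C"
    and C2: "\<And>v. v \<in> V D k \<Longrightarrow> aform D (Qh 0 v) (Qh 0 v) \<le> C2 * aform D v v" "0 \<le> C2" "C2 \<le> C"
  shows "subspace_correction (V D k) (aform D) (T_sub D k) k (C * (1 + (real k)\<^sup>2))"
proof -
  interpret ip: finite_form "V D k" "ip D" by (rule V_ip_form[OF k(2)])
  interpret a: finite_form "V D k" "aform D" by (rule V_a_form[OF k(2)])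
  note T0 = T_sub_0[OF k(2)] and TS = T_sub_Suc[OF k(2)] and sub = V_sub_V[OF k(2)]
  have V0: "V D 0 \<subseteq> V D k" using V_mono[of 0 k] k by simp
  let ?T = "T_sub D k" and ?c = "\<lambda>i. lambda_sub D k i * real k"
  have T_mem: "?T i v \<in> V D k" if "i \<le> k" "v \<in> V D k" for i v
  proof (cases "i = 0")
    case True
    then show ?thesis using T0(1)[OF that(2)] V0 by auto
  next
    case False
    then have "?T i v \<in> V_sub D k i" using TS(1) that by simp
    then show ?thesis using sub[OF that(1)] by auto
  qed
  have T_sq: "aform D v (?T i v) = ?c i * ip D (?T i v) (?T i v)"
    if "1 \<le> i" "i \<le> k" "v \<in> V D k" for i v
    using TS[OF that] by simp
  have T_sym: "aform D (?T i u) v = aform D u (?T i v)"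
    if m: "i \<le> k" "u \<in> V D k" "v \<in> V D k" for i u v
  proof (cases "i = 0")
    case True
    have "aform D (?T 0 u) v = aform D v (?T 0 u)" using m T_mem by (intro a.sym) auto
    also have "\<dots> = aform D (?T 0 v) (?T 0 u)" using T0(2)[OF m(3) T0(1)[OF m(2)]] by simp
    also have "\<dots> = aform D (?T 0 u) (?T 0 v)" using m T_mem by (intro a.sym) auto
    also have "\<dots> = aform D u (?T 0 v)" using T0(2)[OF m(2) T0(1)[OF m(3)]] by simp
    finally show ?thesis using True by simp
  next
    case False
    then have i: "1 \<le> i" "i \<le> k" using m by auto
    have "aform D (?T i u) v = aform D v (?T i u)" using m T_mem by (intro a.sym) auto
    also have "\<dots> = ?c i * ip D (?T i v) (?T i u)" using TS(2)[OF i m(3) TS(1)[OF i m(2)]] by simp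
    also have "ip D (?T i v) (?T i u) = ip D (?T i u) (?T i v)" using m T_mem by (intro ip.sym) auto
    also have "?c i * ip D (?T i u) (?T i v) = aform D u (?T i v)"
      using TS(2)[OF i m(2) TS(1)[OF i m(3)]] by simp
    finally show ?thesis .
  qed
  have stable: "aform D v v \<le> C * (1 + (real k)\<^sup>2) * (\<Sum>i\<le>k. aform D (?T i v) v)"
    if v: "v \<in> V D k" for v
  proof -
    \<comment> \<open>The sum telescopes to \<open>Qh k v\<close>, which is
      \<open>v\<close>.\<close>
    define d where "d = (\<lambda>i::nat. if i = 0 then Qh 0 v else (\<lambda>x. Qh i v x - Qh (i - 1) v x))"
    define X where "X = (\<lambda>i. aform D (?T i v) v)"
    \<comment> \<open>\<open>B i\<close> bounds the square of the piece \<open>d i\<close> in the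
      norm dual to its subsolver: the energy for \<open>i = 0\<close>, and \<open>?c i\<close> times
      the squared L2 norm otherwise.\<close>
    define B where "B = (\<lambda>i::nat. (if i = 0 then C2 else real k * C1) * aform D v v)"
    have a0: "0 \<le> aform D v v" by (rule a.nonneg[OF v])
    have B0: "0 \<le> B i" for i unfolding B_def using C1(2) C2(2) a0 by simp
    have dsub: "d i \<in> V_sub D k i" if i: "1 \<le> i" "i \<le> k" for i
      using Q_hat_diff[OF Q v, of "i - 1"] i k by (simp add: d_def)
    have d0: "d 0 \<in> V D 0" using Q_hat_mem[OF Q v, of 0] k by (simp add: d_def)
    have d_mem: "d i \<in> V D k" if "i \<le> k" for i
      using dsub[of i] d0 sub[OF that] V0 that by (cases "i = 0") auto
    have dsum: "(\<Sum>i\<le>j. d i x) = Qh j v x" for j x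
      by (induction j) (simp_all add: d_def)
    have v_eq: "v = (\<lambda>x. \<Sum>i\<le>k. 1 * d i x)"
      using dsum[of _ k] Q v by (simp add: is_Q_hat_def)
    have piece: "0 \<le> X i \<and> aform D v (d i) \<le> sqrt (X i) * sqrt (B i)" if i: "i \<le> k" for i
    proof (cases "i = 0")
      case True
      have Tv: "?T 0 v \<in> V D k" using T_mem v by simp
      have X: "X 0 = aform D (?T 0 v) (?T 0 v)"
        unfolding X_def using T_sym[of 0 v v] T0(2)[OF v T0(1)[OF v]] v by simp
      have "aform D v (d 0) = aform D (?T 0 v) (d 0)" using T0(2)[OF v d0] by simp
      also have "\<dots> \<le> sqrt (X 0) * sqrt (aform D (d 0) (d 0))"
        using a.Cauchy_Schwarz[OF Tv d_mem[of 0]] X by simp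
      also have "\<dots> \<le> sqrt (X 0) * sqrt (B 0)"
        using C2(1)[OF v] a.nonneg[OF Tv] X by (intro mult_left_mono) (simp_all add: d_def B_def)
      finally show ?thesis using True X a.nonneg[OF Tv] by simp
    next
      case False
      then have i1: "1 \<le> i" by simp
      have Tv: "?T i v \<in> V D k" using T_mem v i by simp
      have c0: "0 \<le> ?c i" using lambda_sub_le(1)[OF k(2) i] by simp
      have X: "X i = ?c i * ip D (?T i v) (?T i v)"
        unfolding X_def using T_sym[OF i v v] T_sq[OF i1 i v] by simp
      have X0: "0 \<le> X i" unfolding X using c0 ip.nonneg[OF Tv] by (rule mult_nonneg_nonneg)
      \<comment> \<open>For \<open>lambda_max D i = 0\<close> the left side is zero, as
        \<open>inverse 0 = 0\<close>.\<close>
      have "lambda_sub D k i * inverse (lambda_max D i) \<le> 1"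
        using lambda_sub_le[OF k(2) i] by (cases "lambda_max D i = 0") (auto simp: field_simps)
      then have r: "(real k * C1 * aform D v v) * (lambda_sub D k i * inverse (lambda_max D i)) \<le>
          (real k * C1 * aform D v v) * 1"
        using C1(2) a0 by (intro mult_left_mono) auto
      have "?c i * ip D (d i) (d i) \<le> ?c i * (C1 * inverse (lambda_max D i) * aform D v v)"
        using C1(1)[OF i1 i v] c0 i1 by (intro mult_left_mono) (simp_all add: d_def)
      also have "\<dots> = (real k * C1 * aform D v v) * (lambda_sub D k i * inverse (lambda_max D i))"
        by (simp only: ac_simps)
      also have "\<dots> \<le> B i" using r i1 by (simp add: B_def)
      finally have cd: "?c i * ip D (d i) (d i) \<le> B i" .
      have "aform D v (d i) = ?c i * ip D (?T i v) (d i)"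
        using TS(2)[OF i1 i v dsub[OF i1 i]] by simp
      also have "\<dots> \<le> ?c i * (sqrt (ip D (?T i v) (?T i v)) * sqrt (ip D (d i) (d i)))"
        using ip.Cauchy_Schwarz[OF Tv d_mem[OF i]] c0 by (intro mult_left_mono) auto
      also have "\<dots> = (sqrt (?c i) * sqrt (?c i)) * (sqrt (ip D (?T i v) (?T i v)) * sqrt (ip D (d i) (d i)))"
        using c0 by simp
      also have "\<dots> = sqrt (X i) * sqrt (?c i * ip D (d i) (d i))"
        unfolding X by (simp only: real_sqrt_mult ac_simps)
      also have "\<dots> \<le> sqrt (X i) * sqrt (B i)"
        using cd X0 by (intro mult_left_mono) auto
      finally show ?thesis using X0 by simp
    qed
    have X0: "0 \<le> (\<Sum>i\<le>k. X i)" using piece by (intro sum_nonneg) auto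
    have B_sum: "(\<Sum>i\<le>k. B i) \<le> C * (1 + (real k)\<^sup>2) * aform D v v"
    proof -
      have "(\<Sum>i\<le>k. B i) = (C2 + real k * (real k * C1)) * aform D v v"
        by (simp add: atMost_atLeast0 sum.atLeast_Suc_atMost B_def algebra_simps)
      also have "\<dots> \<le> (C + real k * (real k * C)) * aform D v v"
        using C1(3) C2(3) a0 by (intro mult_right_mono add_mono mult_left_mono) auto
      finally show ?thesis by (simp add: power2_eq_square algebra_simps)
    qed
    have "aform D v v = aform D v (\<lambda>x. \<Sum>i\<le>k. 1 * d i x)"
      by (rule arg_cong[OF v_eq])
    also have "\<dots> = (\<Sum>i\<le>k. aform D v (d i))"
      using a.sum_right[of "{..k}" d v "\<lambda>_. 1"] d_mem v by simp
    also have "\<dots> \<le> (\<Sum>i\<le>k. sqrt (X i) * sqrt (B i))"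
      using piece by (intro sum_mono) auto
    also have "\<dots> \<le> sqrt (\<Sum>i\<le>k. X i) * sqrt (\<Sum>i\<le>k. B i)"
      using piece B0 by (intro Cauchy_Schwarz_sum) auto
    also have "\<dots> \<le> sqrt (\<Sum>i\<le>k. X i) * sqrt (C * (1 + (real k)\<^sup>2) * aform D v v)"
      using B_sum X0 by (intro mult_left_mono) auto
    finally have *: "aform D v v \<le> sqrt (\<Sum>i\<le>k. X i) * sqrt (C * (1 + (real k)\<^sup>2) * aform D v v)" .
    have K0: "0 \<le> C * (1 + (real k)\<^sup>2)" using C1(2,3) by simp
    have "(aform D v v)\<^sup>2 \<le> (sqrt (\<Sum>i\<le>k. X i) * sqrt (C * (1 + (real k)\<^sup>2) * aform D v v))\<^sup>2"
      using * a0 by (rule power_mono)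
    also have "\<dots> = (\<Sum>i\<le>k. X i) * (C * (1 + (real k)\<^sup>2) * aform D v v)"
      using X0 K0 a0 by (simp add: power_mult_distrib del: real_sqrt_mult)
    finally have "aform D v v * aform D v v \<le> (C * (1 + (real k)\<^sup>2) * (\<Sum>i\<le>k. X i)) * aform D v v"
      by (simp add: power2_eq_square algebra_simps)
    then show ?thesis
      using a0 X0 K0 unfolding X_def[symmetric]
      by (cases "aform D v v = 0") (auto intro: mult_right_le_imp_le simp: X_def)
  qed
  show ?thesis
  proof unfold_locales
    show "aform D (?T 0 v) (?T 0 v) \<le> aform D (?T 0 v) v" if v: "v \<in> V D k" for v
      using T_sym[of 0 v v] T0(2)[OF v T0(1)[OF v]] v by simp
    show "aform D (?T i v) (?T i v) \<le> aform D (?T i v) v / real k"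
      if i: "1 \<le> i" "i \<le> k" and v: "v \<in> V D k" for i v
    proof -
      interpret s: form_pair "V_sub D k i" "ip D" "aform D" "A_sub D k i"
        by (rule A_sub_pair[OF k(2) i(2)])
      \<comment> \<open>The spectral radius from the Rayleigh bound cancels the one in the subsolver
        and leaves the damping \<open>1 / k\<close>.\<close>
      have "aform D (?T i v) (?T i v) \<le> lambda_sub D k i * ip D (?T i v) (?T i v)"
        unfolding lambda_sub_def by (rule s.Rayleigh[OF TS(1)[OF i v]])
      also have "\<dots> = aform D (?T i v) v / real k"
        using T_sym[OF i(2) v v] T_sq[OF i v] k(1) by simp
      finally show ?thesis .
    qed
  qed (use k T_mem T_sym stable in auto)
qed

text \<open>
  The smoother alone already contracts with the stated rate; the coarse grid correction is only
  needed not to increase the energy.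
\<close>

lemma mg_error_Suc:
  assumes k: "Suc k \<le> J" and ssc: "subspace_correction (V D (Suc k)) (aform D) (T_sub D (Suc k)) (Suc k) K"
    and K: "0 < K"
    and E: "\<And>u. u \<in> V D k \<Longrightarrow> mg_error D m k u \<in> V D k \<and> aform D (mg_error D m k u) u \<le> aform D u u"
    and v: "v \<in> V D (Suc k)"
  shows "mg_error D m (Suc k) v \<in> V D (Suc k)"
    "aform D (mg_error D m (Suc k) v) v \<le> 9 * K / (9 * K + 2 * real (m (Suc k))) * aform D v v"
proof -
  interpret a: finite_form "V D (Suc k)" "aform D" by (rule V_a_form[OF k])
  interpret S: subspace_correction "V D (Suc k)" "aform D" "T_sub D (Suc k)" "Suc k" K by (rule ssc)
  let ?S = "smoother D (Suc k) ^^ m (Suc k)"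
  have S: "smoother D (Suc k) = symmetric_product (T_sub D (Suc k)) (Suc k)"
    unfolding smoother_def ..
  have sub: "V D k \<subseteq> V D (Suc k)" using V_mono[of k "Suc k"] k by simp
  define w where "w = ?S v"
  have w: "w \<in> V D (Suc k)" unfolding w_def S by (rule S.power_mem[OF v])
  define p where "p = P D k w"
  have p: "p \<in> V D k" "\<And>z. z \<in> V D k \<Longrightarrow> aform D p z = aform D w z"
    unfolding p_def P_def using a.orth_proj[OF V_fun_space sub w] by blast+
  define e where "e = mg_error D m k p"
  have e: "e \<in> V D k" "aform D e p \<le> aform D p p" unfolding e_def using E[OF p(1)] by blast+
  define y where "y = (\<lambda>x. w x - (p x - e x))"
  have pe: "p \<in> V D (Suc k)" "e \<in> V D (Suc k)" using p(1) e(1) sub by auto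
  have y: "y \<in> V D (Suc k)" unfolding y_def using w pe by (intro a.diff_mem)
  have eq: "mg_error D m (Suc k) v = ?S y"
    by (simp add: y_def e_def p_def w_def id_minus_def)
  show "mg_error D m (Suc k) v \<in> V D (Suc k)"
    unfolding eq S by (rule S.power_mem[OF y])
  \<comment> \<open>The post-smoothing is moved to the second argument, where it acts as the
    pre-smoothing.\<close>
  have "aform D (mg_error D m (Suc k) v) v = aform D y w"
    unfolding eq w_def S by (rule S.power_sym[OF y v])
  also have "\<dots> = aform D w w - (aform D p w - aform D e w)"
    unfolding y_def using w pe by (simp add: a.diff_left a.diff_mem)
  also have "aform D p w = aform D p p"
    using p a.sym[OF pe(1) w] by simp
  \<comment> \<open>\<open>e\<close> lies in the coarse space, so it sees \<open>w\<close> only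
    through its projection \<open>p\<close>.\<close>
  also have "aform D e w = aform D e p"
    using p(2)[OF e(1)] a.sym[OF pe(2) w] a.sym[OF pe] by simp
  also have "aform D w w - (aform D p p - aform D e p) \<le> aform D w w" using e(2) by simp
  also have "\<dots> \<le> 9 * K / (9 * K + 2 * real (m (Suc k))) * aform D v v"
    unfolding w_def S by (rule S.power_contract[OF K v])
  finally show "aform D (mg_error D m (Suc k) v) v \<le>
    9 * K / (9 * K + 2 * real (m (Suc k))) * aform D v v" .
qed

end

section \<open>The rate as a function of the level\<close>

lemma gamma_proportional:
  assumes "0 < C4" "m k = q * (1 + k ^ 2)"
  shows "gamma C4 m k = C4 / (2 * real q + C4)"
proof -
  have pos: "0 < 1 + (real k)\<^sup>2" by (simp add: add_pos_nonneg)
  have "gamma C4 m k = (C4 * (1 + (real k)\<^sup>2)) / ((2 * real q + C4) * (1 + (real k)\<^sup>2))"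
    unfolding gamma_def assms(2) by (simp add: algebra_simps)
  also have "\<dots> = C4 / (2 * real q + C4)" using pos by (intro mult_divide_mult_cancel_right) simp
  finally show ?thesis .
qed

text \<open>Here \<open>L\<close> runs over all possible numbers of levels, which is how
  independence of \<open>J\<close> is expressed. The rate depends on \<open>m k / (1 + k^2)\<close>
  alone and determines it, so a constant rate means that this ratio is constant.\<close>

lemma gamma_constant_iff:
  assumes C4: "0 < C4"
  shows "(\<exists>c. \<forall>L\<ge>1. gamma C4 m L = c) \<longleftrightarrow> (\<exists>q::nat. \<forall>k\<ge>1. m k = q * (1 + k ^ 2))"
proof
  assume "\<exists>c. \<forall>L\<ge>1. gamma C4 m L = c"
  then obtain c where c: "\<And>L. 1 \<le> L \<Longrightarrow> gamma C4 m L = c" by blast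
  have ratio: "m k * 2 = m 1 * (1 + k ^ 2)" if "1 \<le> k" for k
  proof -
    define a where "a = C4 * (1 + (real k)\<^sup>2)"
    have a: "0 < a" using C4 by (simp add: a_def add_pos_nonneg)
    have "gamma C4 m k = gamma C4 m 1" using c[OF that] c[of 1] by simp
    then have eq: "a / (a + 2 * real (m k)) = (C4 * 2) / (C4 * 2 + 2 * real (m 1))"
      by (simp add: gamma_def a_def)
    have nz: "a + 2 * real (m k) \<noteq> 0" "C4 * 2 + 2 * real (m 1) \<noteq> 0"
      using a C4 by (simp_all add: add_pos_nonneg less_imp_neq[symmetric])
    have "a * (C4 * 2 + 2 * real (m 1)) = (C4 * 2) * (a + 2 * real (m k))"
      using eq by (rule iffD1[OF frac_eq_eq[OF nz]])
    then have "C4 * ((1 + (real k)\<^sup>2) * real (m 1)) = C4 * (2 * real (m k))"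
      by (simp add: a_def algebra_simps)
    then have "(1 + (real k)\<^sup>2) * real (m 1) = 2 * real (m k)"
      using C4 by simp
    then have "real (m k * 2) = real (m 1 * (1 + k ^ 2))"
      by (simp add: algebra_simps)
    then show ?thesis by (simp only: of_nat_eq_iff)
  qed
  \<comment> \<open>Level 1 yields only the ratio \<open>m 1 / 2\<close>. The odd value
    \<open>1 + 2^2 = 5\<close> at level 2 shows that it is an integer.\<close>
  have "m 2 * 2 = m 1 * 5" using ratio[of 2] by simp
  then have "even (m 1)" by presburger
  then obtain q where "m 1 = 2 * q" by blast
  then have "m k = q * (1 + k ^ 2)" if "1 \<le> k" for k using ratio[OF that] by simp
  then show "\<exists>q. \<forall>k\<ge>1. m k = q * (1 + k ^ 2)" by blast
next
  assume "\<exists>q::nat. \<forall>k\<ge>1. m k = q * (1 + k ^ 2)"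
  then obtain q :: nat where q: "\<And>k. 1 \<le> k \<Longrightarrow> m k = q * (1 + k ^ 2)" by blast
  have "gamma C4 m L = C4 / (2 * real q + C4)" if "1 \<le> L" for L
    using gamma_proportional[of C4 m L q] C4 q[OF that] by simp
  then show "\<exists>c. \<forall>L\<ge>1. gamma C4 m L = c" by blast
qed

theorem theorem4:
  fixes D :: "('n::finite) hierarchy"
    and J :: nat
    and m :: "nat \<Rightarrow> nat"
    and Qh :: "nat \<Rightarrow> nat \<Rightarrow> (real^'n \<Rightarrow> real) \<Rightarrow> (real^'n \<Rightarrow> real)"
    and \<kappa> h0 C\<Theta>1 C\<Theta>2 C1 C2 C3 C4 :: real
  assumes J: "1 \<le> J"
    and hierarchy: "nested_hierarchy D J \<kappa> h0"
    and symmetric: "transpose (coeff D) = coeff D"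
    and elliptic: "0 < C\<Theta>1" "0 < C\<Theta>2"
      "\<And>k u. k \<le> J \<Longrightarrow> u \<in> V D k \<Longrightarrow>
         C\<Theta>1 * (H1_norm (subdomain D 0) u)\<^sup>2 \<le> aform D u u \<and>
         aform D u u \<le> C\<Theta>2 * (H1_norm (subdomain D 0) u)\<^sup>2"
    and m_pos: "\<And>k. 1 \<le> k \<Longrightarrow> 1 \<le> m k"
    and C12_pos: "0 < C1" "0 < C2"
    and Q_hat: "\<And>k. 1 \<le> k \<Longrightarrow> k \<le> J \<Longrightarrow> is_Q_hat D k (Qh k)"
    and C1: "\<And>k i v. 1 \<le> i \<Longrightarrow> i \<le> k \<Longrightarrow> k \<le> J \<Longrightarrow> v \<in> V D k \<Longrightarrow>
         ip D (\<lambda>x. Qh k i v x - Qh k (i - 1) v x) (\<lambda>x. Qh k i v x - Qh k (i - 1) v x)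
           \<le> C1 * inverse (lambda_max D i) * aform D v v"
    and C2: "\<And>k i v. i < k \<Longrightarrow> k \<le> J \<Longrightarrow> v \<in> V D k \<Longrightarrow>
         aform D (Qh k i v) (Qh k i v) \<le> C2 * aform D v v"
    and C3: "C3 = max C1 C2"
    and C4: "C4 = 9 * C3"
  shows "(antimono_on {1..J} (psi C4 m) \<longrightarrow>
            (\<forall>k\<in>{1..J}. \<forall>v\<in>V D k. aform D (mg_error D m k v) v \<le> gamma C4 m k * aform D v v)) \<and>
         ((\<exists>c. \<forall>L\<ge>1. gamma C4 m L = c) \<longleftrightarrow> (\<exists>q::nat. \<forall>k\<ge>1. m k = q * (1 + k ^ 2))) \<and>
         (\<forall>q::nat. (\<forall>k\<in>{1..J}. m k = q * (1 + k ^ 2)) \<longrightarrow>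
            (\<forall>k\<in>{1..J}. gamma C4 m k = C4 / (2 * real q + C4)))"
proof -
  interpret multilevel_problem D J \<kappa> h0 C\<Theta>1
    using hierarchy symmetric elliptic by unfold_locales auto
  have C3_pos: "0 < C3" using C12_pos C3 by simp
  have C4_pos: "0 < C4" using C3_pos C4 by simp
  \<comment> \<open>The plain energy bound is carried along because it is what the next level asks
    of the coarse correction; it also covers level 0, where the error operator is zero and no rate
    is claimed.\<close>
  have bound: "mg_error D m k v \<in> V D k \<and> aform D (mg_error D m k v) v \<le> aform D v v \<and>
      (1 \<le> k \<longrightarrow> aform D (mg_error D m k v) v \<le> gamma C4 m k * aform D v v)"
    if "k \<le> J" "v \<in> V D k" for k v
    using that
  proof (induction k arbitrary: v)
    case 0
    interpret a: finite_form "V D 0" "aform D" by (rule V_a_form) simp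
    show ?case using a.zero_mem a.zero_left[OF 0(2)] a.nonneg[OF 0(2)] by simp
  next
    case (Suc k)
    interpret a: finite_form "V D (Suc k)" "aform D" by (rule V_a_form[OF Suc.prems(1)])
    \<comment> \<open>\<open>9 * ?K\<close> is \<open>C4 * (1 + (real (Suc k))^2)\<close>, so the
      rate of \<open>mg_error_Suc\<close> becomes \<open>gamma C4 m (Suc k)\<close>.\<close>
    let ?K = "C3 * (1 + (real (Suc k))\<^sup>2)"
    have K: "0 < ?K" using C3_pos by (simp add: add_pos_nonneg)
    have ssc: "subspace_correction (V D (Suc k)) (aform D) (T_sub D (Suc k)) (Suc k) ?K"
    proof (rule subspace_correction[where Qh = "Qh (Suc k)" and ?C1.0 = C1 and ?C2.0 = C2])
      show "is_Q_hat D (Suc k) (Qh (Suc k))" using Q_hat Suc.prems(1) by simp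
    qed (use Suc.prems(1) C1 C2 C3 C12_pos in auto)
    have IH: "mg_error D m k u \<in> V D k \<and> aform D (mg_error D m k u) u \<le> aform D u u"
      if "u \<in> V D k" for u
      using Suc.IH[OF _ that] Suc.prems(1) by simp
    have rate: "aform D (mg_error D m (Suc k) v) v \<le> gamma C4 m (Suc k) * aform D v v"
      using mg_error_Suc(2)[OF Suc.prems(1) ssc K IH Suc.prems(2)]
      by (simp only: gamma_def C4 mult.assoc)
    \<comment> \<open>A rate of at most one restores the plain energy bound for the next step of the
      induction.\<close>
    have "0 < C4 * (1 + (real (Suc k))\<^sup>2)"
      using C4_pos by (intro mult_pos_pos add_pos_nonneg) auto
    then have "gamma C4 m (Suc k) \<le> 1"
      unfolding gamma_def by simp
    then have "gamma C4 m (Suc k) * aform D v v \<le> 1 * aform D v v"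
      using a.nonneg[OF Suc.prems(2)] by (rule mult_right_mono)
    then show ?case
      using rate mg_error_Suc(1)[OF Suc.prems(1) ssc K IH Suc.prems(2)] by auto
  qed
  have "\<forall>k\<in>{1..J}. \<forall>v\<in>V D k. aform D (mg_error D m k v) v \<le> gamma C4 m k * aform D v v"
    using bound by simp
  moreover have "(\<exists>c. \<forall>L\<ge>1. gamma C4 m L = c) \<longleftrightarrow> (\<exists>q::nat. \<forall>k\<ge>1. m k = q * (1 + k ^ 2))"
    by (rule gamma_constant_iff[OF C4_pos])
  moreover have "\<forall>q::nat. (\<forall>k\<in>{1..J}. m k = q * (1 + k ^ 2)) \<longrightarrow>
      (\<forall>k\<in>{1..J}. gamma C4 m k = C4 / (2 * real q + C4))"
    using gamma_proportional[of C4 m _ _] C4_pos by blast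
  ultimately show ?thesis by blast
qed

end
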